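(* Let $q\in\mathbb{C}$ with $0<|q|<1$. Then $$\phi(q)-q^{-1}\psi(-q^4)+q^{-2}\chi(q^8)=\frac{\overline{J}_{1,2}\,j(-q^2;-q^{10})}{J_{2,8}}.$$
   Context: For a complex number $p$ with $0<|p|<1$ and $x\in\mathbb{C}^*=\mathbb{C}\setminus\{0\}$: $(x;p)_n=\prod_{i=0}^{n-1}(1-p^ix)$, $(x;p)_\infty=\prod_{i\ge0}(1-p^ix)$, and $j(x;p)=(x;p)_\infty(p/x;p)_\infty(p;p)_\infty=\sum_{n\in\mathbb{Z}}(-1)^np^{\binom n2}x^n$. For integers $a,m$ with $m\ge1$: $J_{a,m}=j(q^a;q^m)$ and $\overline{J}_{a,m}=j(-q^a;q^m)$. The tenth-order mock theta functions used are, for $|q|<1$, $\phi(q)=\sum_{n\ge0}\frac{q^{\binom{n+1}{2}}}{(q;q^2)_{n+1}}$, $\psi(q)=\sum_{n\ge0}\frac{q^{\binom{n+2}{2}}}{(q;q^2)_{n+1}}$, $\chi(q)=\sum_{n\ge0}\frac{(-1)^nq^{(n+1)^2}}{(-q;q)_{2n+1}}$. *)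

theory Defs
  imports "HOL-Analysis.Analysis"
begin

definition qpoch :: "complex \<Rightarrow> complex \<Rightarrow> nat \<Rightarrow> complex" where
  "qpoch x p n = (\<Prod>i<n. 1 - p ^ i * x)"

definition qpoch_inf :: "complex \<Rightarrow> complex \<Rightarrow> complex" where
  "qpoch_inf x p = (\<Prod>i. 1 - p ^ i * x)"

definition jtheta :: "complex \<Rightarrow> complex \<Rightarrow> complex" where
  "jtheta x p = qpoch_inf x p * qpoch_inf (p / x) p * qpoch_inf p p"

definition J :: "complex \<Rightarrow> int \<Rightarrow> int \<Rightarrow> complex" where
  "J q a m = jtheta (q powi a) (q powi m)"

definition J_bar :: "complex \<Rightarrow> int \<Rightarrow> int \<Rightarrow> complex" where
  "J_bar q a m = jtheta (- (q powi a)) (q powi m)"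

definition mock_phi :: "complex \<Rightarrow> complex" where
  "mock_phi q = (\<Sum>n. q ^ ((n + 1) choose 2) / qpoch q (q ^ 2) (n + 1))"

definition mock_psi :: "complex \<Rightarrow> complex" where
  "mock_psi q = (\<Sum>n. q ^ ((n + 2) choose 2) / qpoch q (q ^ 2) (n + 1))"

definition mock_chi :: "complex \<Rightarrow> complex" where
  "mock_chi q = (\<Sum>n. (-1) ^ n * q ^ ((n + 1) ^ 2) / qpoch (- q) q (2 * n + 1))"

end

(* Inserting a Bailey pair relative to p^2 with beta_n = (p;p)_n / (p;p)_{2n+1} into the Bailey transform turns
   each of the three mock theta functions into a value of one two-sided series, hecke x, divided by a theta constant.
   This series is determined by a q-difference equation x -> p^5 x and a reflection x -> p^3 / x; a combination of
   Appell-Lerch sums of base p^10 satisfies the same two equations, so each mock theta function is a sum of two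
   Appell-Lerch sums m(u, p^10, z).  The sums for psi and chi have base q^40; they match the even and odd parts of
   the base q^10 sums for phi, up to a change of the parameter z that costs a theta quotient.  What remains is an
   identity between theta quotients, which follows from product formulas and two-term dissections. *)
theory Submission
  imports Defs "HOL-Complex_Analysis.Cauchy_Integral_Formula"
begin

section \<open>Laurent series on the punctured plane\<close>

text \<open>The equation of \<open>hecke\<close> shifts the argument by \<open>p ^ 5\<close>, which
  is no integral power of \<open>p ^ 2\<close>, while its inhomogeneous term is a theta function of
  base \<open>p ^ 2\<close>. Only the second iterate, with shift
  \<open>p ^ 10 = (p ^ 2) ^ 5\<close>, lets that theta function reproduce itself up to a monomial,
  so that it can be taken out and an Appell-Lerch sum of base \<open>p ^ 10\<close> remains. The
  parameter z of these sums is free at first and is fixed by the final matching: the dissection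
  takes base P and parameter z to base P^4 and parameter P^2 z^2. With z = q^2 in base q^10 for phi
  this gives q^24 = (q^4)^6 in base q^40, and therefore the choice z = p^6 for psi and chi. The
  obstacle is chi. Its series is \<open>hecke\<close> of nome p^2 at -p, so chi(q^8) would lead to
  base q^160 at an argument that is not a signed integral power of the nome.\<close>

definition tri :: "int \<Rightarrow> int" where "tri n = n * (n - 1) div 2"

lemma two_tri: "2 * tri n = n * (n - 1)"
proof -
  have "even (n * (n - 1))" by simp
  then show ?thesis by (simp add: tri_def)
qed

lemma tri_add: "tri (a + b) = tri a + tri b + a * b"
  using two_tri[of "a + b"] two_tri[of a] two_tri[of b] by (simp add: algebra_simps)

lemma tri_minus: "tri (- n) = tri n + n"
  using two_tri[of "- n"] two_tri[of n] by (simp add: algebra_simps)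

lemma tri_0_1 [simp]: "tri 0 = 0" "tri 1 = 0"
  by (simp_all add: tri_def)

lemma tri_succ: "tri (n + 1) = tri n + n"
  by (simp add: tri_add)

lemma tri_nonneg: "tri n \<ge> 0"
proof -
  have "n * (n - 1) \<ge> 0" by (cases "n \<ge> 1") (auto simp: mult_nonpos_nonpos)
  then show ?thesis using two_tri[of n] by linarith
qed

lemma has_sum_int_nat:
  fixes f :: "int \<Rightarrow> 'a :: {topological_comm_monoid_add, t2_space}"
  assumes "((\<lambda>n. f (int n)) has_sum a) UNIV" "((\<lambda>n. f (- 1 - int n)) has_sum b) UNIV"
  shows "(f has_sum (a + b)) UNIV"
proof -
  have "(f has_sum a) {0..}"
  proof -
    have "bij_betw int UNIV {0..}"
      by (rule bij_betwI[where g = nat]) auto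
    from has_sum_reindex_bij_betw[OF this, of f a] assms(1) show ?thesis by simp
  qed
  moreover have "(f has_sum b) {..<0}"
  proof -
    have "bij_betw (\<lambda>n. - 1 - int n) UNIV {..<0}"
      by (rule bij_betwI[where g = "\<lambda>k. nat (- 1 - k)"]) auto
    from has_sum_reindex_bij_betw[OF this, of f b] assms(2) show ?thesis by simp
  qed
  moreover have "{0..} \<union> {..<0::int} = UNIV" by auto
  moreover have "{0..} \<inter> {..<0::int} = {}" by auto
  ultimately show ?thesis
    using has_sum_Un_disjoint[where f = f and a = a and b = b and A = "{0..}" and B = "{..<0}"] by simp
qed

lemma summable_on_int_nat:
  fixes f :: "int \<Rightarrow> 'a :: {topological_comm_monoid_add, t2_space}"
  assumes "(\<lambda>n. f (int n)) summable_on UNIV" "(\<lambda>n. f (- 1 - int n)) summable_on UNIV"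
  shows "f summable_on UNIV"
  using has_sum_int_nat[of f] assms unfolding summable_on_def by blast

text \<open>Consecutive terms have ratio \<open>r ^ n * R\<close>, which tends to 0 for every
  \<open>R\<close>; hence all series with such coefficients converge on the whole punctured
  plane.\<close>

lemma summable_tri_nat:
  fixes r R :: real
  assumes "0 \<le> r" "r < 1" "0 < R"
  shows "(\<lambda>n. r powi tri (int n) * R ^ n) summable_on UNIV"
proof -
  have "(\<lambda>n. r ^ n * R) \<longlonglongrightarrow> 0 * R"
    by (intro tendsto_mult LIMSEQ_power_zero tendsto_const) (use assms in auto)
  then have "eventually (\<lambda>n. r ^ n * R < 1/2) sequentially"
    by (rule order_tendstoD) auto
  then obtain N where N: "\<And>n. n \<ge> N \<Longrightarrow> r ^ n * R < 1/2"
    by (auto simp: eventually_sequentially)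
  have step: "r powi tri (int (Suc n)) = r powi tri (int n) * r ^ n" for n
  proof -
    have "tri (int (Suc n)) = tri (int n) + int n"
      using tri_succ[of "int n"] by (simp add: add.commute)
    moreover have "tri (int n) \<ge> 0" by (rule tri_nonneg)
    ultimately show ?thesis
      by (simp add: power_int_nonneg_exp nat_add_distrib power_add)
  qed
  have nn: "r powi tri (int n) * R ^ n \<ge> 0" for n using assms by simp
  have "summable (\<lambda>n. r powi tri (int n) * R ^ n)"
  proof (rule summable_ratio_test[where c = "1/2" and N = N])
    fix n assume "n \<ge> N"
    have "r powi tri (int (Suc n)) * R ^ Suc n = (r ^ n * R) * (r powi tri (int n) * R ^ n)"
      using step[of n] by simp
    also have "\<dots> \<le> 1/2 * (r powi tri (int n) * R ^ n)"
      by (rule mult_right_mono[OF _ nn]) (use N[OF \<open>n \<ge> N\<close>] in simp)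
    finally show "norm (r powi tri (int (Suc n)) * R ^ Suc n) \<le> 1/2 * norm (r powi tri (int n) * R ^ n)"
      using assms by simp
  qed simp
  then show ?thesis by (rule summable_nonneg_imp_summable_on) (use nn in auto)
qed

lemma summable_tri:
  fixes r R :: real
  assumes "0 \<le> r" "r < 1" "0 < R"
  shows "(\<lambda>n. r powi tri n * R powi n) summable_on UNIV"
proof (cases "r = 0")
  case True
  \<comment> \<open>Since \<open>0 powi 0 = 1\<close>, exactly the terms with
    \<open>tri n = 0\<close>, namely n = 0 and n = 1, survive for \<open>r = 0\<close>.\<close>
  have "(\<lambda>n. r powi tri n * R powi n) summable_on {0, 1}" by simp
  moreover have "r powi tri n * R powi n = 0" if "n \<notin> {0, 1}" for n
  proof -
    have "tri n \<noteq> 0" using two_tri[of n] that by auto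
    then show ?thesis using True by simp
  qed
  ultimately show ?thesis
    by (subst summable_on_cong_neutral[of "{0, 1}" UNIV]) auto
next
  case False
  show ?thesis
  proof (rule summable_on_int_nat)
    show "(\<lambda>n. r powi tri (int n) * R powi int n) summable_on UNIV"
      using summable_tri_nat[OF assms] by simp
    \<comment> \<open>Reflection of \<open>tri\<close> turns the negative half into a series of the
      same kind, with \<open>R\<close> replaced by \<open>r ^ 2 / R\<close>.\<close>
    have eq: "r powi tri (- 1 - int n) * R powi (- 1 - int n)
        = (r / R) * (r powi tri (int n) * (r ^ 2 / R) ^ n)" for n
    proof -
      have "- 1 - int n = - (int n + 1)" by simp
      then have "tri (- 1 - int n) = tri (int n) + 2 * int n + 1"
        using tri_minus[of "int n + 1"] tri_succ[of "int n"] by (simp only:)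
      moreover have "r powi (tri (int n) + 2 * int n + 1) = r powi tri (int n) * (r ^ 2) ^ n * r"
        using False by (simp add: power_int_add power_int_mult)
      moreover have "R powi (- 1 - int n) = 1 / (R * R ^ n)"
        using assms by (simp add: power_int_diff power_int_minus divide_inverse)
      ultimately show ?thesis by (simp add: field_simps power_divide)
    qed
    show "(\<lambda>n. r powi tri (- 1 - int n) * R powi (- 1 - int n)) summable_on UNIV"
      unfolding eq by (intro summable_on_cmult_right summable_tri_nat) (use assms False in auto)
  qed
qed

text \<open>Convergence at every nonzero x is part of the predicate, so that scalings, inversions
  and products never have to keep track of an annulus.\<close>

definition laurent :: "(int \<Rightarrow> complex) \<Rightarrow> (complex \<Rightarrow> complex) \<Rightarrow> bool" where
  "laurent c f \<longleftrightarrow> (\<forall>x. x \<noteq> 0 \<longrightarrow> ((\<lambda>n. c n * x powi n) has_sum f x) UNIV)"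

lemma laurentD: "laurent c f \<Longrightarrow> x \<noteq> 0 \<Longrightarrow> ((\<lambda>n. c n * x powi n) has_sum f x) UNIV"
  by (simp add: laurent_def)

text \<open>Evaluating at x only changes \<open>R\<close> to \<open>R * norm x\<close>, so a single
  Gaussian bound on the coefficients serves all x.\<close>

lemma laurent_I_bound:
  assumes r: "0 \<le> r" "r < 1" "0 < R" and b: "\<And>n. norm (c n) \<le> C * (r powi tri n * R powi n)"
  shows "laurent c (\<lambda>x. \<Sum>\<^sub>\<infinity>n. c n * x powi n)"
  unfolding laurent_def
proof (intro allI impI has_sum_infsum)
  fix x :: complex assume "x \<noteq> 0"
  have "(\<lambda>n. C * (r powi tri n * (R * norm x) powi n)) summable_on UNIV"
    using r \<open>x \<noteq> 0\<close> by (intro summable_on_cmult_right summable_tri) auto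
  then show "(\<lambda>n. c n * x powi n) summable_on UNIV"
  proof (rule abs_summable_summable[OF summable_on_comparison_test])
    fix n :: int
    have "norm (c n * x powi n) \<le> C * (r powi tri n * R powi n) * norm x powi n"
      using mult_right_mono[OF b[of n], of "norm x powi n"] by (simp add: norm_mult norm_power_int)
    also have "\<dots> = C * (r powi tri n * (R * norm x) powi n)"
      by (simp add: power_int_mult_distrib)
    finally show "norm (c n * x powi n) \<le> C * (r powi tri n * (R * norm x) powi n)" .
  qed auto
qed

text \<open>The nonnegative and the negative powers form entire functions of x and of 1/x. Indexing
  the latter by \<open>- 1 - n\<close> leaves one factor of its variable over, whence
  \<open>B 0 = 0\<close>.\<close>

lemma laurent_split:
  assumes "laurent c f"
  obtains A B where "A holomorphic_on UNIV" "B holomorphic_on UNIV" "A 0 = c 0" "B 0 = 0"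
    "\<And>x. x \<noteq> 0 \<Longrightarrow> f x = A x + B (inverse x)"
proof -
  have sm: "(\<lambda>n. c n * x powi n) summable_on UNIV" if "x \<noteq> 0" for x
    using laurentD[OF assms that] by (rule has_sum_imp_summable)
  define A where "A x = (\<Sum>n. c (int n) * x ^ n)" for x
  define B0 where "B0 x = (\<Sum>n. c (- 1 - int n) * x ^ n)" for x
  have smA: "(\<lambda>n. c (int n) * x ^ n) summable_on UNIV" if "x \<noteq> 0" for x
  proof -
    have "((\<lambda>n. c n * x powi n) \<circ> int) summable_on UNIV"
      by (subst summable_on_reindex[symmetric]) (use summable_on_subset_banach[OF sm[OF that]] in auto)
    then show ?thesis by (simp add: o_def)
  qed
  have smB: "(\<lambda>n. c (- 1 - int n) * x ^ n) summable_on UNIV" if "x \<noteq> 0" for x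
  proof -
    have "((\<lambda>n. c n * inverse x powi n) \<circ> (\<lambda>n. - 1 - int n)) summable_on UNIV"
      using that by (subst summable_on_reindex[symmetric])
        (auto intro!: injI summable_on_subset_banach[OF sm[of "inverse x"]])
    then have "(\<lambda>n. inverse x * (c (- 1 - int n) * inverse x powi (- 1 - int n))) summable_on UNIV"
      by (intro summable_on_cmult_right) (simp add: o_def)
    also have "(\<lambda>n. inverse x * (c (- 1 - int n) * inverse x powi (- 1 - int n))) = (\<lambda>n. c (- 1 - int n) * x ^ n)"
      using that by (auto simp: power_int_diff power_int_minus power_int_inverse field_simps fun_eq_iff)
    finally show ?thesis .
  qed
  have su: "summable (\<lambda>n. a n * x ^ n)" if "\<And>x. x \<noteq> 0 \<Longrightarrow> (\<lambda>n. a n * x ^ n) summable_on UNIV"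
    for a :: "nat \<Rightarrow> complex" and x
  proof (cases "x = 0")
    case True
    then show ?thesis by (simp add: powser_zero[symmetric])
  next
    case False
    then show ?thesis using that summable_on_imp_summable by blast
  qed
  have hol: "(\<lambda>x. \<Sum>n. a n * x ^ n) holomorphic_on UNIV"
    if a: "\<And>x. x \<noteq> 0 \<Longrightarrow> (\<lambda>n. a n * x ^ n) summable_on UNIV" for a :: "nat \<Rightarrow> complex"
  proof -
    have "(\<lambda>x. \<Sum>n. a n * x ^ n) field_differentiable (at x)" for x
    proof -
      have "(\<lambda>x. \<Sum>n. a n * x ^ n) holomorphic_on ball 0 (norm x + 1)"
        by (rule power_series_holomorphic[of 0 _ a]) (use su[OF a] in \<open>simp add: summable_sums\<close>)
      then show ?thesis
        by (rule holomorphic_on_imp_differentiable_at) auto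
    qed
    then show ?thesis by (auto simp: holomorphic_on_def intro: field_differentiable_at_within)
  qed
  show ?thesis
  proof (rule that[of A "\<lambda>x. x * B0 x"])
    show "A holomorphic_on UNIV" unfolding A_def by (rule hol[OF smA])
    have "B0 holomorphic_on UNIV" unfolding B0_def by (rule hol[OF smB])
    then show "(\<lambda>x. x * B0 x) holomorphic_on UNIV" by (intro holomorphic_intros)
    show "A 0 = c 0" by (simp add: A_def powser_zero)
    show "0 * B0 0 = 0" by simp
    fix x :: complex assume x: "x \<noteq> 0"
    have 1: "((\<lambda>n. c (int n) * x powi int n) has_sum A x) UNIV"
      using has_sum_imp_sums[OF has_sum_infsum[OF smA[OF x]]] smA[OF x]
      by (simp add: A_def sums_iff)
    have "((\<lambda>n. c (- 1 - int n) * inverse x ^ n) has_sum B0 (inverse x)) UNIV"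
      using has_sum_imp_sums[OF has_sum_infsum[OF smB[of "inverse x"]]] smB[of "inverse x"] x
      by (simp add: B0_def sums_iff)
    then have "((\<lambda>n. inverse x * (c (- 1 - int n) * inverse x ^ n)) has_sum (inverse x * B0 (inverse x))) UNIV"
      by (rule has_sum_cmult_right)
    also have "(\<lambda>n. inverse x * (c (- 1 - int n) * inverse x ^ n)) = (\<lambda>n. c (- 1 - int n) * x powi (- 1 - int n))"
      using x by (auto simp: power_int_diff power_int_minus power_int_inverse field_simps fun_eq_iff)
    finally have "((\<lambda>n. c n * x powi n) has_sum (A x + inverse x * B0 (inverse x))) UNIV"
      by (intro has_sum_int_nat 1)
    with laurentD[OF assms x] show "f x = A x + inverse x * B0 (inverse x)"
      by (rule has_sum_unique)
  qed
qed

lemma laurent_shift: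
  assumes "laurent c f"
  shows "laurent (\<lambda>n. c (n - k)) (\<lambda>x. x powi k * f x)"
  unfolding laurent_def
proof (intro allI impI)
  fix x :: complex assume x: "x \<noteq> 0"
  have "((\<lambda>n. x powi k * (c n * x powi n)) has_sum (x powi k * f x)) UNIV"
    by (rule has_sum_cmult_right[OF laurentD[OF assms x]])
  moreover have "bij_betw (\<lambda>n. n - k) UNIV UNIV"
    by (rule bij_betwI[where g = "\<lambda>n. n + k"]) auto
  ultimately have "((\<lambda>n. x powi k * (c (n - k) * x powi (n - k))) has_sum (x powi k * f x)) UNIV"
    using has_sum_reindex_bij_betw[of "\<lambda>n. n - k" UNIV UNIV "\<lambda>n. x powi k * (c n * x powi n)"] by simp
  moreover have "x powi k * (c (n - k) * x powi (n - k)) = c (n - k) * x powi n" for n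
    using x by (simp add: power_int_diff)
  ultimately show "((\<lambda>n. c (n - k) * x powi n) has_sum (x powi k * f x)) UNIV" by simp
qed

text \<open>A shift moves the coefficient in question to index 0. Then the entire function A
  coincides with -B(1/x) off 0 and so tends to 0 at infinity; Liouville gives A = 0.\<close>

lemma laurent_zero:
  assumes "laurent c f" "\<And>x. x \<noteq> 0 \<Longrightarrow> f x = 0"
  shows "c n = 0"
proof -
  have "laurent (\<lambda>m. c (m - (- n))) (\<lambda>x. x powi (- n) * f x)"
    by (rule laurent_shift[OF assms(1)])
  then obtain A B where AB: "A holomorphic_on UNIV" "B holomorphic_on UNIV" "A 0 = c n" "B 0 = 0"
    "\<And>x. x \<noteq> 0 \<Longrightarrow> x powi (- n) * f x = A x + B (inverse x)"
    by (rule laurent_split) auto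
  have "((\<lambda>x. - B (inverse x)) \<longlongrightarrow> - B 0) at_infinity"
  proof (intro tendsto_minus)
    have "isCont B 0" using AB(2) by (auto dest!: holomorphic_on_imp_continuous_on simp: continuous_on_eq_continuous_at[OF open_UNIV])
    then show "((\<lambda>x. B (inverse x)) \<longlongrightarrow> B 0) at_infinity"
      by (rule isCont_tendsto_compose) (rule tendsto_inverse_0)
  qed
  moreover have "eventually (\<lambda>x. - B (inverse x) = A x) at_infinity"
    using eventually_not_equal_at_infinity[of "0::complex"]
    by eventually_elim (use AB(5) assms(2) in \<open>metis add_eq_0_iff2 mult_zero_right\<close>)
  ultimately have "(A \<longlongrightarrow> 0) at_infinity"
    using AB(4) by (auto intro: Lim_transform_eventually)
  with AB(1) have "A 0 = 0" by (rule Liouville_weak_0)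
  with AB(3) show ?thesis by simp
qed

lemma laurent_diff:
  assumes "laurent c f" "laurent d g"
  shows "laurent (\<lambda>n. c n - d n) (\<lambda>x. f x - g x)"
  unfolding laurent_def
proof (intro allI impI)
  fix x :: complex assume x: "x \<noteq> 0"
  from has_sum_add[OF laurentD[OF assms(1) x] has_sum_uminusI[OF laurentD[OF assms(2) x]]]
  show "((\<lambda>n. (c n - d n) * x powi n) has_sum (f x - g x)) UNIV"
    by (simp add: algebra_simps)
qed

lemma laurent_add:
  assumes "laurent c f" "laurent d g"
  shows "laurent (\<lambda>n. c n + d n) (\<lambda>x. f x + g x)"
  unfolding laurent_def
proof (intro allI impI)
  fix x :: complex assume x: "x \<noteq> 0"
  from has_sum_add[OF laurentD[OF assms(1) x] laurentD[OF assms(2) x]]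
  show "((\<lambda>n. (c n + d n) * x powi n) has_sum (f x + g x)) UNIV"
    by (simp add: algebra_simps)
qed

lemma laurent_cmult:
  assumes "laurent c f"
  shows "laurent (\<lambda>n. a * c n) (\<lambda>x. a * f x)"
  unfolding laurent_def
proof (intro allI impI)
  fix x :: complex assume x: "x \<noteq> 0"
  from has_sum_cmult_right[OF laurentD[OF assms x], of a]
  show "((\<lambda>n. a * c n * x powi n) has_sum (a * f x)) UNIV"
    by (simp add: mult.assoc)
qed

lemma laurent_scale:
  assumes "laurent c f" "a \<noteq> 0"
  shows "laurent (\<lambda>n. c n * a powi n) (\<lambda>x. f (a * x))"
  unfolding laurent_def
proof (intro allI impI)
  fix x :: complex assume x: "x \<noteq> 0"
  with laurentD[OF assms(1), of "a * x"] assms(2)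
  show "((\<lambda>n. c n * a powi n * x powi n) has_sum f (a * x)) UNIV"
    by (simp add: power_int_mult_distrib mult.assoc)
qed

lemma laurent_inverse:
  assumes "laurent c f"
  shows "laurent (\<lambda>n. c (- n)) (\<lambda>x. f (inverse x))"
  unfolding laurent_def
proof (intro allI impI)
  fix x :: complex assume x: "x \<noteq> 0"
  have "((\<lambda>n. c n * inverse x powi n) has_sum f (inverse x)) UNIV"
    using laurentD[OF assms, of "inverse x"] x by simp
  moreover have "bij_betw (\<lambda>n::int. - n) UNIV UNIV"
    by (rule bij_betwI[where g = "\<lambda>n. - n"]) auto
  ultimately have "((\<lambda>n. c (- n) * inverse x powi (- n)) has_sum f (inverse x)) UNIV"
    using has_sum_reindex_bij_betw[of "\<lambda>n::int. - n" UNIV UNIV "\<lambda>n. c n * inverse x powi n"] by simp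
  then show "((\<lambda>n. c (- n) * x powi n) has_sum f (inverse x)) UNIV"
    by (simp add: power_int_minus power_int_inverse)
qed

lemma laurent_cong:
  assumes "laurent c f" "\<And>n. c n = d n" "\<And>x. x \<noteq> 0 \<Longrightarrow> f x = g x"
  shows "laurent d g"
proof -
  have "c = d" using assms(2) by blast
  with assms(1,3) show ?thesis by (auto simp: laurent_def)
qed

lemma laurent_eqI:
  assumes "laurent c f" "laurent d g" "\<And>n. c n = d n" "x \<noteq> 0"
  shows "f x = g x"
proof -
  have "c = d" using assms(3) by blast
  with assms show ?thesis using has_sum_unique laurentD by metis
qed

text \<open>This converts a functional equation into a recurrence for coefficients, which is how
  every uniqueness statement about theta, Appell and Hecke-type series is obtained.\<close>

lemma laurent_unique:
  assumes "laurent c f" "laurent d g" "\<And>x. x \<noteq> 0 \<Longrightarrow> f x = g x"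
  shows "c n = d n"
proof -
  have "c n - d n = 0"
    by (rule laurent_zero[OF laurent_diff[OF assms(1,2)]]) (use assms(3) in auto)
  then show ?thesis by simp
qed

lemma laurent_continuous:
  assumes "laurent c f" "x \<noteq> 0"
  shows "isCont f x"
proof -
  obtain A B where AB: "A holomorphic_on UNIV" "B holomorphic_on UNIV"
    "\<And>x. x \<noteq> 0 \<Longrightarrow> f x = A x + B (inverse x)"
    by (rule laurent_split[OF assms(1)]) blast
  have "isCont A y" "isCont B y" for y
    using AB(1,2) by (auto dest!: holomorphic_on_imp_continuous_on simp: continuous_on_eq_continuous_at[OF open_UNIV])
  note cont = this
  have "isCont inverse x" using assms(2) by (intro continuous_intros)
  then have "isCont (\<lambda>x. B (inverse x)) x" by (rule isCont_o2) (rule cont)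
  then have "isCont (\<lambda>x. A x + B (inverse x)) x" by (rule isCont_add[OF cont(1)])
  moreover have "eventually (\<lambda>y. A y + B (inverse y) = f y) (nhds x)"
    using t1_space_nhds[OF assms(2)] by (rule eventually_mono) (simp add: AB(3))
  ultimately show ?thesis using isCont_cong[of "\<lambda>y. A y + B (inverse y)" f x] by simp
qed

lemma summable_on_times_product:
  fixes f :: "'a \<Rightarrow> real" and g :: "'b \<Rightarrow> real"
  assumes "f summable_on X" "g summable_on Y" "\<And>x. x \<in> X \<Longrightarrow> f x \<ge> 0" "\<And>y. y \<in> Y \<Longrightarrow> g y \<ge> 0"
  shows "(\<lambda>(x, y). f x * g y) summable_on X \<times> Y"
proof (rule summable_on_SigmaI[where g = "\<lambda>x. f x * infsum g Y"], goal_cases)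
  case 1
  show ?case unfolding prod.case by (intro has_sum_cmult_right has_sum_infsum assms(2))
next
  case 2
  show ?case by (intro summable_on_cmult_left assms(1))
qed (use assms in auto)

text \<open>Both factors are two-sided, so each coefficient of the product is itself an infinite
  sum; absolute convergence allows the double series to be regrouped along n + m = N.\<close>

lemma laurent_mult:
  assumes "laurent c f" "laurent d g"
  shows "laurent (\<lambda>N. \<Sum>\<^sub>\<infinity>n. c n * d (N - n)) (\<lambda>x. f x * g x)"
  unfolding laurent_def
proof (intro allI impI)
  fix x :: complex assume x: "x \<noteq> 0"
  note fs = laurentD[OF assms(1) x] and gs = laurentD[OF assms(2) x]
  define F where "F = (\<lambda>(n, m). (c n * x powi n) * (d m * x powi m))"
  have "(\<lambda>(n, m). norm (c n * x powi n) * norm (d m * x powi m)) summable_on UNIV \<times> UNIV"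
    using has_sum_imp_summable[OF fs] has_sum_imp_summable[OF gs]
    by (intro summable_on_times_product) (auto simp: summable_on_iff_abs_summable_on_complex)
  then have F: "F summable_on UNIV \<times> UNIV"
    by (rule abs_summable_summable[OF summable_on_comparison_test]) (auto simp: F_def norm_mult)
  then obtain S where S: "(F has_sum S) (UNIV \<times> UNIV)" by (auto simp: summable_on_def)
  have "((\<lambda>n. (c n * x powi n) * g x) has_sum S) UNIV"
    by (rule has_sum_SigmaD[OF S]) (simp add: F_def has_sum_cmult_right[OF gs])
  with has_sum_cmult_left[OF fs, of "g x"] have S_eq: "S = f x * g x" by (rule has_sum_unique[symmetric])
  define F' where "F' = (\<lambda>(N, n). F (n, N - n))"
  have "(F' has_sum S) (UNIV \<times> UNIV) \<longleftrightarrow> (F has_sum S) (UNIV \<times> UNIV)"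
    by (rule has_sum_reindex_bij_witness[where j = "\<lambda>(N, n). (n, N - n)" and i = "\<lambda>(n, m). (n + m, n)"])
      (auto simp: F'_def)
  with S have S': "(F' has_sum S) (UNIV \<times> UNIV)" by blast
  have "((\<lambda>N. (\<Sum>\<^sub>\<infinity>n. c n * d (N - n)) * x powi N) has_sum S) UNIV"
  proof (rule has_sum_SigmaD[OF S'])
    fix N :: int
    have "(\<lambda>n. F' (N, n)) summable_on UNIV"
      using summable_on_SigmaD1[of "\<lambda>x y. F' (x, y)" UNIV "\<lambda>_. UNIV" N] has_sum_imp_summable[OF S']
      by (simp add: case_prod_unfold)
    moreover have "F' (N, n) = c n * d (N - n) * x powi N" for n
      using x by (simp add: F'_def F_def power_int_diff)
    ultimately show "((\<lambda>n. F' (N, n)) has_sum ((\<Sum>\<^sub>\<infinity>n. c n * d (N - n)) * x powi N)) UNIV"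
      by (simp add: infsum_cmult_left'[symmetric])
  qed
  then show "((\<lambda>N. (\<Sum>\<^sub>\<infinity>n. c n * d (N - n)) * x powi N) has_sum (f x * g x)) UNIV"
    by (simp only: S_eq)
qed

section \<open>Theta functions\<close>

definition tc :: "complex \<Rightarrow> int \<Rightarrow> complex" where
  "tc p n = (-1) powi n * p powi tri n"

definition theta :: "complex \<Rightarrow> complex \<Rightarrow> complex" where
  "theta p x = (\<Sum>\<^sub>\<infinity>n. tc p n * x powi n)"

text \<open>The value 0 at negative indices agrees with the usual convention for 1/(p;p)_k. It
  truncates the Bailey sums by itself and makes \<open>rq_pred\<close> valid for all
  integers.\<close>

definition rq :: "complex \<Rightarrow> int \<Rightarrow> complex" where
  "rq p k = (if k < 0 then 0 else 1 / qpoch p p (nat k))"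

lemma qpoch_0 [simp]: "qpoch x p 0 = 1"
  and qpoch_Suc: "qpoch x p (Suc n) = qpoch x p n * (1 - p ^ n * x)"
  by (simp_all add: qpoch_def)

lemma convergent_prod_qpoch:
  fixes p x :: complex
  assumes "norm p < 1"
  shows "convergent_prod (\<lambda>i. 1 - p ^ i * x)"
proof -
  have "summable (\<lambda>i. norm p ^ i)" by (rule summable_geometric) (use assms in simp)
  then have "summable (\<lambda>i. norm x * norm p ^ i)" by (rule summable_mult)
  moreover have "norm (1 - p ^ i * x - 1) = norm x * norm p ^ i" for i
    by (simp add: norm_mult norm_power)
  ultimately have "summable (\<lambda>i. norm (1 - p ^ i * x - 1))" by simp
  then show ?thesis
    by (intro abs_convergent_prod_imp_convergent_prod summable_imp_abs_convergent_prod)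
qed

lemma qpoch_tendsto:
  assumes "norm p < 1"
  shows "(\<lambda>n. qpoch x p n) \<longlonglongrightarrow> qpoch_inf x p"
proof -
  have "(\<lambda>n. \<Prod>i\<le>n. 1 - p ^ i * x) \<longlonglongrightarrow> qpoch_inf x p"
    unfolding qpoch_inf_def by (rule convergent_prod_LIMSEQ[OF convergent_prod_qpoch[OF assms]])
  then have "(\<lambda>n. qpoch x p (Suc n)) \<longlonglongrightarrow> qpoch_inf x p"
    by (simp add: qpoch_def lessThan_Suc_atMost)
  then show ?thesis by (simp add: filterlim_sequentially_Suc)
qed

lemma qpoch_inf_nonzero:
  assumes "norm p < 1" "\<And>i. p ^ i * x \<noteq> 1"
  shows "qpoch_inf x p \<noteq> 0"
  unfolding qpoch_inf_def
  by (rule prodinf_nonzero[OF convergent_prod_qpoch[OF assms(1)]]) (use assms(2) in \<open>metis eq_iff_diff_eq_0\<close>)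

lemma power_mult_neq_1:
  fixes p x :: complex
  assumes "norm p < 1" "norm x < 1"
  shows "p ^ i * x \<noteq> 1"
proof -
  have "norm (p ^ i * x) \<le> 1 * norm x"
    unfolding norm_mult norm_power by (intro mult_right_mono power_le_one) (use assms in auto)
  then show ?thesis using assms by auto
qed

lemma qpoch_nonzero: "norm p < 1 \<Longrightarrow> norm x < 1 \<Longrightarrow> qpoch x p n \<noteq> 0"
  using power_mult_neq_1[of p x] by (auto simp: qpoch_def)

lemma qpoch_inf_nonzero': "norm p < 1 \<Longrightarrow> norm x < 1 \<Longrightarrow> qpoch_inf x p \<noteq> 0"
  by (intro qpoch_inf_nonzero power_mult_neq_1)

lemma has_sum_int_imp_sums_pair:
  fixes f :: "int \<Rightarrow> complex"
  assumes "(f has_sum S) UNIV"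
  shows "(\<lambda>n. f (int n) + f (- 1 - int n)) sums S"
proof -
  have sm: "f summable_on X" for X
    using summable_on_subset_banach[OF has_sum_imp_summable[OF assms]] by auto
  have "(f \<circ> int) summable_on UNIV" "(f \<circ> (\<lambda>n. - 1 - int n)) summable_on UNIV"
    by (auto simp: summable_on_reindex[symmetric] inj_def sm)
  then obtain a b where ab: "((\<lambda>n. f (int n)) has_sum a) UNIV" "((\<lambda>n. f (- 1 - int n)) has_sum b) UNIV"
    unfolding summable_on_def o_def by blast
  have "S = a + b"
    using has_sum_unique[OF assms has_sum_int_nat[OF ab]] .
  then show ?thesis using sums_add[OF ab[THEN has_sum_imp_sums]] by simp
qed

locale nome =
  fixes p :: complex
  assumes p0: "p \<noteq> 0" and p1: "norm p < 1"
begin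

lemma power_nome: "n > 0 \<Longrightarrow> nome (p ^ n)"
  by unfold_locales (use p0 p1 in \<open>auto simp: norm_power power_less_one_iff\<close>)

lemma minus_nome: "nome (- p)"
  by unfold_locales (use p0 p1 in auto)

lemma powi_add: "p powi (i + j) = p powi i * p powi j"
  using p0 by (rule power_int_add[OF disjI1])

lemma p_pow_neq_1: "n > 0 \<Longrightarrow> p ^ n \<noteq> 1"
  using power_mult_neq_1[OF p1 p1, of "n - 1"] by (simp flip: power_Suc2)

lemma tc_0_1 [simp]: "tc p 0 = 1" "tc p 1 = -1"
  by (simp_all add: tc_def)

lemma tc_nonzero: "tc p n \<noteq> 0"
  using p0 by (simp add: tc_def)

lemma norm_tc: "norm (tc p n) = norm p powi tri n"
  by (simp add: tc_def norm_mult norm_power_int)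

lemma tc_add: "tc p (a + b) = tc p a * tc p b * p powi (a * b)"
  using p0 by (simp add: tc_def tri_add power_int_add)

lemma tc_succ: "tc p (n + 1) = - (p powi n) * tc p n"
  by (simp add: tc_add)

lemma tc_pred: "tc p (n - 1) = - (p powi (1 - n)) * tc p n"
  using tc_succ[of "n - 1"] p0 by (simp add: power_int_diff field_simps)

lemma tc_minus: "tc p (- n) = tc p n * p powi n"
  using p0 by (simp add: tc_def tri_minus power_int_add power_int_minus flip: power_int_inverse)

lemma tc_one_minus: "tc p (1 - n) = - tc p n"
  using tc_succ[of "- n"] p0 by (simp add: tc_minus power_int_minus)

lemma theta_laurent: "laurent (tc p) (theta p)"
  unfolding theta_def[abs_def]
  by (rule laurent_I_bound[of "norm p" 1 _ 1]) (use p1 in \<open>auto simp: norm_tc\<close>)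

text \<open>By \<open>tc_add\<close>, multiplying x by \<open>p powi n\<close> amounts to shifting
  the coefficients by n, up to the constant \<open>tc p n\<close>.\<close>

lemma theta_powi_mult:
  assumes "x \<noteq> 0"
  shows "theta p (p powi n * x) = theta p x / (tc p n * x powi n)"
proof -
  have "theta p (p powi n * x) = inverse (tc p n) * (x powi (- n) * theta p x)"
  proof (rule laurent_eqI[OF laurent_scale[OF theta_laurent]
        laurent_cmult[OF laurent_shift[OF theta_laurent]] _ assms])
    show "p powi n \<noteq> 0" using p0 by simp
    fix k
    have "(p powi n) powi k = p powi (k * n)" by (simp only: power_int_mult[symmetric] mult.commute)
    then show "tc p k * (p powi n) powi k = inverse (tc p n) * tc p (k - (- n))"
      using tc_nonzero[of n] by (simp add: tc_add)
  qed
  then show ?thesis by (simp add: power_int_minus divide_inverse mult_ac)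
qed

lemma theta_p_mult: "x \<noteq> 0 \<Longrightarrow> theta p (p * x) = - theta p x / x"
  using theta_powi_mult[of x 1] by simp

lemma theta_inverse:
  assumes "x \<noteq> 0"
  shows "theta p (inverse x) = - theta p x / x"
proof -
  have "theta p (inverse x) = - 1 * (x powi (- 1) * theta p x)"
  proof (rule laurent_eqI[OF laurent_inverse[OF theta_laurent]
        laurent_cmult[OF laurent_shift[OF theta_laurent]] _ assms])
    show "tc p (- k) = - 1 * tc p (k - (- 1))" for k
      using tc_one_minus[of "k + 1"] by simp
  qed
  then show ?thesis by (simp add: divide_inverse mult_ac)
qed

lemma theta_p_divide: "x \<noteq> 0 \<Longrightarrow> theta p (p / x) = theta p x"
  using theta_p_mult[of "inverse x"] theta_inverse[of x] by (simp add: divide_inverse)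

lemma theta_one [simp]: "theta p 1 = 0"
  using theta_inverse[of 1] by simp

text \<open>The factor \<open>1 - p powi k\<close> vanishes at k = 0, which is exactly where
  \<open>rq\<close> jumps from 0 to 1.\<close>

lemma rq_pred: "rq p (k - 1) = (1 - p powi k) * rq p k"
proof (cases "k \<le> 0")
  case True
  then show ?thesis by (cases "k = 0") (auto simp: rq_def)
next
  case False
  then obtain n where n: "k = int (Suc n)" by (metis not_le pos_int_cases not0_implies_Suc of_nat_0_less_iff less_numeral_extra(3))
  have "1 - p ^ n * p \<noteq> 0" using p_pow_neq_1[of "Suc n"] by (simp add: mult.commute)
  then show ?thesis by (simp add: n rq_def nat_add_distrib qpoch_Suc power_int_add p0 qpoch_nonzero p1 mult.commute)
qed

lemma rq_0 [simp]: "rq p 0 = 1" and rq_neg: "k < 0 \<Longrightarrow> rq p k = 0"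
  and rq_nat: "rq p (int n) = 1 / qpoch p p n"
  by (simp_all add: rq_def)

lemma rq_bounded: obtains C where "C > 0" "\<And>k. norm (rq p k) \<le> C"
proof -
  have "(\<lambda>n. 1 / qpoch p p n) \<longlonglongrightarrow> 1 / qpoch_inf p p"
    by (intro tendsto_divide tendsto_const qpoch_tendsto p1 qpoch_inf_nonzero')
  then have "Bseq (\<lambda>n. 1 / qpoch p p n)" by (rule convergent_imp_Bseq[OF convergentI])
  then obtain C where C: "C > 0" "\<And>n. norm (1 / qpoch p p n) \<le> C" by (auto simp: Bseq_def)
  show ?thesis by (rule that[of C]) (use C in \<open>auto simp: rq_def\<close>)
qed

end

section \<open>A Bailey pair and the Bailey transform\<close>

text \<open>The inner sum of a Hecke-type double series: next to the factor
  \<open>p ^ (r * (r + 1))\<close> the quadratic part of the exponent is r^2 + i r - i^2, an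
  indefinite form.\<close>

definition G :: "complex \<Rightarrow> nat \<Rightarrow> complex" where
  "G p n = (\<Sum>i\<le>n. p ^ (i * (n - i)))"

lemma G_0_1 [simp]: "G p 0 = 1" "G p (Suc 0) = 2"
  by (simp_all add: G_def)

text \<open>The two end terms equal 1, and for the inner ones (i + 1)(n + 1 - i) = n + 1 + i (n -
  i).\<close>

lemma G_rec: "G p (n + 2) = 2 + p ^ (n + 1) * G p n"
proof -
  have "G p (n + 2) = (\<Sum>i\<le>Suc (Suc n). p ^ (i * (Suc (Suc n) - i)))"
    by (simp add: G_def)
  also have "\<dots> = 1 + ((\<Sum>i\<le>n. p ^ (Suc i * (Suc n - i))) + 1)"
    by (subst sum.atMost_Suc_shift, subst sum.atMost_Suc) simp
  also have "(\<Sum>i\<le>n. p ^ (Suc i * (Suc n - i))) = (\<Sum>i\<le>n. p ^ (n + 1) * p ^ (i * (n - i)))"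
  proof (rule sum.cong)
    fix i assume "i \<in> {..n}"
    then obtain k where "n = i + k" by (auto simp: le_iff_add)
    then have "Suc i * (Suc n - i) = n + 1 + i * (n - i)" by (simp add: algebra_simps)
    then show "p ^ (Suc i * (Suc n - i)) = p ^ (n + 1) * p ^ (i * (n - i))"
      by (simp only: power_add)
  qed simp
  finally show ?thesis by (simp add: G_def sum_distrib_left)
qed

lemma qpoch_add: "qpoch x p (m + n) = qpoch x p m * qpoch (p ^ m * x) p n"
  by (induction n) (simp_all add: qpoch_Suc power_add mult_ac)

lemma qpoch_inf_split_first:
  assumes "norm p < 1"
  shows "qpoch_inf x p = qpoch x p m * qpoch_inf (p ^ m * x) p"
proof -
  have "(\<lambda>n. qpoch x p (n + m)) \<longlonglongrightarrow> qpoch_inf x p"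
    by (rule LIMSEQ_ignore_initial_segment[OF qpoch_tendsto[OF assms]])
  moreover have "(\<lambda>n. qpoch x p m * qpoch (p ^ m * x) p n) \<longlonglongrightarrow> qpoch x p m * qpoch_inf (p ^ m * x) p"
    by (intro tendsto_mult tendsto_const qpoch_tendsto assms)
  ultimately show ?thesis
    by (metis (no_types, lifting) LIMSEQ_unique add.commute ext qpoch_add)
qed

lemma tri_of_nat: "tri (int n) = int (n choose 2)"
proof -
  have "even (n * (n - 1))" by (cases n) simp_all
  then have "2 * (n * (n - 1) div 2) = n * (n - 1)" by (rule dvd_mult_div_cancel)
  then have "2 * (n choose 2) = n * (n - 1)" by (simp only: choose_two)
  then have "2 * int (n choose 2) = int n * (int n - 1)"
    by (cases n) (simp_all add: algebra_simps flip: of_nat_mult)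
  then show ?thesis using two_tri[of "int n"] by linarith
qed

context nome
begin

text \<open>The bound is the fixed point of c = 2 + |p| c, the worst case of
  \<open>G_rec\<close>.\<close>

lemma norm_G_le: "norm (G p n) \<le> 2 / (1 - norm p)"
proof (induction n rule: less_induct)
  case (less n)
  have d: "1 - norm p > 0" using p1 by simp
  consider "n = 0" | "n = Suc 0" | m where "n = m + 2"
    by (metis One_nat_def add_2_eq_Suc' not0_implies_Suc)
  then show ?case
  proof cases
    case 3
    have "norm (G p n) \<le> norm (2::complex) + norm (p ^ (m + 1) * G p m)"
      unfolding 3 G_rec by (rule norm_triangle_ineq)
    also have "norm (p ^ (m + 1) * G p m) \<le> norm p * (2 / (1 - norm p))"
      unfolding norm_mult norm_power
    proof (rule mult_mono)
      show "norm p ^ (m + 1) \<le> norm p"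
        using power_decreasing[of 1 "m + 1" "norm p"] p1 by simp
      show "norm (G p m) \<le> 2 / (1 - norm p)" by (rule less) (simp add: 3)
    qed auto
    finally show ?thesis using d by (simp add: field_simps)
  qed (use d in \<open>auto simp: field_simps\<close>)
qed

text \<open>Normalised for the kernel \<open>rq p (n - r) * rq p (n + r + 2)\<close>: compared with
  the customary (p^3;p)_{n+r} in the denominator, the constant (1 - p)(1 - p^2) is absorbed
  here.\<close>

definition bailey_alpha where "bailey_alpha r = - tc p (int r + 1) * (1 - p ^ (2 * r + 2)) * G p r"

text \<open>Summation by parts against \<open>G_rec\<close>: each \<open>B r\<close> meets G(r + 2)
  - p^(r+1) G(r) = 2. The values 1 and 2 of G at 0 and 1 produce the lower boundary terms.\<close>

lemma bailey_telescope:
  fixes B :: "int \<Rightarrow> complex"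
  shows "(\<Sum>r\<le>Suc m. (B (int r - 2) - p ^ (r + 1) * B (int r)) * G p r)
    = B (- 2) + 2 * B (- 1) + 2 * (\<Sum>r<m. B (int r)) - p ^ (m + 2) * B (int m + 1) * G p (Suc m)
      - p ^ (m + 1) * B (int m) * G p m"
proof (induction m)
  case 0
  then show ?case by (simp add: algebra_simps power2_eq_square)
next
  case (Suc m)
  have "G p (Suc (Suc m)) = 2 + p ^ (m + 1) * G p m" using G_rec[of p m] by simp
  then show ?case using Suc by (simp add: algebra_simps)
qed

text \<open>Both sides satisfy the same first-order recurrence in n; B in the proof is the certificate of a creative telescoping.\<close>

lemma bailey_pair:
  "(\<Sum>r\<le>n. bailey_alpha r * rq p (int n - int r) * rq p (int n + int r + 2)) = qpoch p p n / qpoch p p (2 * n + 1)"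
proof (induction n)
  case 0
  have "1 - p * p \<noteq> 0" using p_pow_neq_1[of 2] by (simp add: power2_eq_square)
  moreover have "rq p 2 = 1 / ((1 - p) * (1 - p * p))"
    using rq_nat[of 2] by (simp add: numeral_2_eq_2 qpoch_Suc)
  ultimately show ?case by (simp add: bailey_alpha_def power2_eq_square qpoch_Suc)
next
  case (Suc n)
  define S where "S n = (\<Sum>r\<le>n. bailey_alpha r * rq p (int n - int r) * rq p (int n + int r + 2))" for n
  define K where "K n r = - tc p (r + 1) * (1 - p powi (2 * r + 2)) * rq p (int n - r) * rq p (int n + r + 2)" for n r
  \<comment> \<open>A second layer of telescoping: \<open>B\<close> is itself a difference of
    \<open>C\<close>, so the sum of the \<open>B r\<close> left over by
    \<open>bailey_telescope\<close> collapses as well. The upper boundary values vanish because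
    \<open>rq\<close> is 0 at negative indices.\<close>
  define C where "C r = - tc p (r + 1) * p powi r * rq p (int n - r - 1) * rq p (int n + r + 2)" for r
  define B where "B r = p ^ (n + 2) * (C r - C (r + 1))" for r
  have S_K: "S n = (\<Sum>r\<le>n. K n (int r) * G p r)" for n
  proof -
    have "p powi (2 * int r + 2) = p ^ (2 * r + 2)" for r
      using power_int_of_nat[of p "2 * r + 2"] by (simp add: add.commute)
    then show ?thesis
      unfolding S_def K_def bailey_alpha_def by (intro sum.cong refl) (simp only: mult_ac)
  qed
  have step: "(1 - p ^ (2 * n + 2)) * (1 - p ^ (2 * n + 3)) * K (Suc n) r - (1 - p ^ (n + 1)) * K n r
      = B (r - 2) - p powi (r + 1) * B r" for r
  proof -
    define N R where "N = p ^ n" and "R = p powi r"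
    have nz: "R \<noteq> 0" "p \<noteq> 0" using p0 by (simp_all add: R_def)
    \<comment> \<open>X and Y carry the largest arguments that occur, so \<open>rq_pred\<close>
      expresses every other value of \<open>rq\<close> through them without division by a factor
      that might vanish. The claim becomes a rational identity in p, N and R.\<close>
    define X Y t where "X = rq p (int n - r + 1)" and "Y = rq p (int n + r + 3)" and "t = tc p (r + 1)"
    have pk: "p powi (int n - r + 1) = p * N / R" "p powi (int n - r) = N / R" "p powi (int n - r - 1) = N / (p * R)"
        "p powi (int n + r + 3) = p ^ 3 * N * R" "p powi (int n + r + 2) = p ^ 2 * N * R" "p powi (int n + r + 1) = p * N * R"
      using p0 by (simp_all add: N_def R_def power_int_add power_int_diff)
    have m1: "rq p (int n - r) = (1 - p * N / R) * X"
      using rq_pred[of "int n - r + 1"] unfolding pk X_def by simp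
    have m2: "rq p (int n - r - 1) = (1 - N / R) * ((1 - p * N / R) * X)"
      unfolding rq_pred[of "int n - r"] m1 pk ..
    have m3: "rq p (int n - (r + 1) - 1) = (1 - N / (p * R)) * ((1 - N / R) * ((1 - p * N / R) * X))"
      using rq_pred[of "int n - r - 1"] unfolding m2 pk by (simp add: algebra_simps)
    have q1: "rq p (int n + r + 2) = (1 - p ^ 3 * N * R) * Y"
    proof -
      have "int n + r + 3 - 1 = int n + r + 2" by simp
      then show ?thesis using rq_pred[of "int n + r + 3"] unfolding pk Y_def by (simp only:)
    qed
    have q2: "rq p (int n + r + 1) = (1 - p ^ 2 * N * R) * ((1 - p ^ 3 * N * R) * Y)"
    proof -
      have "int n + r + 2 - 1 = int n + r + 1" by simp
      then show ?thesis using rq_pred[of "int n + r + 2"] unfolding pk q1 by (simp only:)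
    qed
    have q3: "rq p (int n + r) = (1 - p * N * R) * ((1 - p ^ 2 * N * R) * ((1 - p ^ 3 * N * R) * Y))"
      using rq_pred[of "int n + r + 1"] unfolding pk q2 by simp
    have t1: "tc p r = - t / R"
      using tc_pred[of "r + 1"] p0 by (simp add: t_def R_def power_int_minus field_simps)
    have t2: "tc p (r - 1) = p * t / R ^ 2"
      using tc_pred[of r] p0 unfolding t1 by (simp add: R_def power_int_diff field_simps power2_eq_square)
    have t3: "tc p (r + 1 + 1) = - p * R * t"
      unfolding tc_succ[of "r + 1"] using p0 by (simp add: t_def R_def power_int_add)
    have C0: "C r = - t * R * ((1 - N / R) * ((1 - p * N / R) * X)) * ((1 - p ^ 3 * N * R) * Y)"
      unfolding C_def m2 q1 t_def[symmetric] R_def[symmetric] ..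
    have C1: "C (r + 1) = p ^ 2 * R ^ 2 * t * ((1 - N / (p * R)) * ((1 - N / R) * ((1 - p * N / R) * X))) * Y"
    proof -
      have i: "int n + (r + 1) + 2 = int n + r + 3" by simp
      have "p powi (r + 1) = p * R" using p0 by (simp add: R_def power_int_add)
      then show ?thesis unfolding C_def m3 t3 i Y_def[symmetric] by (simp add: power2_eq_square)
    qed
    have C2: "C (r - 1) = t / p * ((1 - p * N / R) * X) * ((1 - p ^ 2 * N * R) * ((1 - p ^ 3 * N * R) * Y))"
    proof -
      have i: "int n - (r - 1) - 1 = int n - r" "int n + (r - 1) + 2 = int n + r + 1" "r - 1 + 1 = r" by simp_all
      have "p powi (r - 1) = R / p" using p0 by (simp add: R_def power_int_diff)
      then show ?thesis unfolding C_def i t1 m1 q2 using nz by simp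
    qed
    have C3: "C (r - 2) = - t / (p * R) * X * ((1 - p * N * R) * ((1 - p ^ 2 * N * R) * ((1 - p ^ 3 * N * R) * Y)))"
    proof -
      have i: "int n - (r - 2) - 1 = int n - r + 1" "int n + (r - 2) + 2 = int n + r" "r - 2 + 1 = r - 1" by simp_all
      have "p powi (r - 2) = R / p ^ 2" using p0 by (simp add: R_def power_int_diff)
      then show ?thesis unfolding C_def i t2 X_def[symmetric] q3 using nz by (simp add: power2_eq_square)
    qed
    have K0: "K n r = - t * (1 - p ^ 2 * R ^ 2) * ((1 - p * N / R) * X) * ((1 - p ^ 3 * N * R) * Y)"
    proof -
      have "p powi (2 * r + 2) = p ^ 2 * R ^ 2"
        using p0 power_int_power'[of p r 2] by (simp add: R_def power_int_add mult.commute)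
      then show ?thesis unfolding K_def m1 q1 t_def[symmetric] by simp
    qed
    have K1: "K (Suc n) r = - t * (1 - p ^ 2 * R ^ 2) * X * Y"
    proof -
      have "p powi (2 * r + 2) = p ^ 2 * R ^ 2"
        using p0 power_int_power'[of p r 2] by (simp add: R_def power_int_add mult.commute)
      moreover have i: "int (Suc n) - r = int n - r + 1" "int (Suc n) + r + 2 = int n + r + 3" by simp_all
      ultimately show ?thesis unfolding K_def i X_def[symmetric] Y_def[symmetric] t_def[symmetric] by simp
    qed
    have pw: "p ^ (2 * n + 2) = p ^ 2 * N ^ 2" "p ^ (2 * n + 3) = p ^ 3 * N ^ 2" "p ^ (n + 1) = p * N" "p ^ (n + 2) = p ^ 2 * N"
      by (simp_all add: N_def power_add power_mult power2_eq_square power3_eq_cube mult_2 mult_ac)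
    have Bs: "B (r - 2) = p ^ 2 * N * (C (r - 2) - C (r - 1))" "B r = p ^ 2 * N * (C r - C (r + 1))"
      unfolding B_def pw by (simp_all add: algebra_simps)
    have "p powi (r + 1) = p * R" using p0 by (simp add: R_def power_int_add)
    then show ?thesis
      unfolding Bs C0 C1 C2 C3 K0 K1 pw using nz
      by (simp add: field_simps power2_eq_square power3_eq_cube)
  qed
  have B0: "B (int n + 1) = 0" "B (int n) = 0" and Cn: "C (int n) = 0"
    by (simp_all add: B_def C_def rq_neg)
  have "p powi int r * p = p powi (int r + 1)" for r using p0 by (simp add: power_int_add)
  have "(1 - p ^ (2 * n + 2)) * (1 - p ^ (2 * n + 3)) * S (Suc n) - (1 - p ^ (n + 1)) * S n
     = (\<Sum>r\<le>Suc n. ((1 - p ^ (2 * n + 2)) * (1 - p ^ (2 * n + 3)) * K (Suc n) (int r) - (1 - p ^ (n + 1)) * K n (int r)) * G p r)"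
  proof -
    have "K n (int (Suc n)) = 0" by (simp add: K_def rq_neg)
    then have "S n = (\<Sum>r\<le>Suc n. K n (int r) * G p r)" by (simp add: S_K)
    then show ?thesis
      unfolding S_K[of "Suc n"] by (simp add: sum_distrib_left sum_subtractf left_diff_distrib mult.assoc del: sum.atMost_Suc)
  qed
  also have "\<dots> = (\<Sum>r\<le>Suc n. (B (int r - 2) - p ^ (r + 1) * B (int r)) * G p r)"
    unfolding step by (intro sum.cong refl) (simp add: power_int_add p0)
  also have "\<dots> = B (- 2) + 2 * B (- 1) + 2 * (\<Sum>r<n. B (int r))"
    unfolding bailey_telescope B0 by simp
  also have "(\<Sum>r<n. B (int r)) = p ^ (n + 2) * (C 0 - C (int n))"
  proof -
    have "(\<Sum>r<m. B (int r)) = p ^ (n + 2) * (C 0 - C (int m))" for m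
      by (induction m) (simp_all add: B_def algebra_simps)
    then show ?thesis .
  qed
  also have "B (- 2) + 2 * B (- 1) + 2 * (p ^ (n + 2) * (C 0 - C (int n))) = p ^ (n + 2) * (C (- 2) + C (- 1))"
    unfolding Cn by (simp add: B_def algebra_simps)
  also have "C (- 2) + C (- 1) = 0"
  proof -
    have "tc p (- 1) = - p" using tc_minus[of 1] by simp
    then show ?thesis using p0 by (simp add: C_def power_int_minus power2_eq_square add.commute)
  qed
  finally have rec: "(1 - p ^ (2 * n + 2)) * (1 - p ^ (2 * n + 3)) * S (Suc n) = (1 - p ^ (n + 1)) * S n" by simp
  have nz: "1 - p ^ (2 * n + 2) \<noteq> 0" "1 - p ^ (2 * n + 3) \<noteq> 0"
    using p_pow_neq_1[of "2 * n + 2"] p_pow_neq_1[of "2 * n + 3"] by simp_all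
  have "S (Suc n) = (1 - p ^ (n + 1)) * S n / ((1 - p ^ (2 * n + 2)) * (1 - p ^ (2 * n + 3)))"
    using rec nz by (simp add: eq_divide_eq mult_ac)
  moreover have "S n = qpoch p p n / qpoch p p (2 * n + 1)" using Suc by (simp add: S_def)
  moreover have "qpoch p p (2 * Suc n + 1) = qpoch p p (2 * n + 1) * (1 - p ^ (2 * n + 2)) * (1 - p ^ (2 * n + 3))"
    by (simp add: qpoch_Suc mult_ac eval_nat_numeral)
  moreover have "qpoch p p (Suc n) = qpoch p p n * (1 - p ^ (n + 1))"
    by (simp add: qpoch_Suc mult_ac)
  ultimately show ?case unfolding S_def[symmetric] by (simp add: mult_ac)
qed

text \<open>An interchange of summation with n = r + m: \<open>bailey_alpha\<close> and
  \<open>rq\<close> are bounded, so geometric decay of W makes the double series absolutely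
  convergent. \<open>E\<close> is the sequence conjugate to W.\<close>

lemma bailey_transform:
  assumes W: "\<And>n. norm (W n) \<le> M * \<rho> ^ n" and \<rho>: "0 \<le> \<rho>" "\<rho> < 1"
    and E: "\<And>r. (\<lambda>m. W (r + m) * rq p (int m) * rq p (int (2 * r + 2 + m))) sums E r"
  shows "(\<lambda>n. W n * (qpoch p p n / qpoch p p (2 * n + 1))) sums (\<Sum>r. bailey_alpha r * E r)"
    and "summable (\<lambda>r. bailey_alpha r * E r)"
proof -
  define f where "f = (\<lambda>(r, m). bailey_alpha r * (W (r + m) * rq p (int m) * rq p (int (2 * r + 2 + m))))"
  obtain C where C: "C > 0" "\<And>k. norm (rq p k) \<le> C" using rq_bounded by blast
  define D where "D = 2 * (2 / (1 - norm p))"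
  have bailey_alpha_le: "norm (bailey_alpha r) \<le> D" for r
  proof -
    have "norm (tc p (int r + 1)) \<le> 1"
      unfolding norm_tc by (intro power_int_le_one) (use p1 tri_nonneg in auto)
    moreover have "norm (1 - p ^ (2 * r + 2)) \<le> 2"
    proof -
      have "norm (p ^ (2 * r + 2)) \<le> 1" unfolding norm_power by (intro power_le_one) (use p1 in auto)
      then show ?thesis using norm_triangle_ineq4[of 1 "p ^ (2 * r + 2)"] by simp
    qed
    ultimately have "norm (bailey_alpha r) \<le> 1 * 2 * (2 / (1 - norm p))"
      unfolding bailey_alpha_def norm_mult norm_minus_cancel by (intro mult_mono norm_G_le) auto
    then show ?thesis by (simp add: D_def)
  qed
  have M0: "0 \<le> M" using W[of 0] norm_ge_zero[of "W 0"] by (simp del: norm_ge_zero)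
  have D0: "0 \<le> D" using order_trans[OF norm_ge_zero bailey_alpha_le[of 0]] .
  have f_le: "norm (f (r, m)) \<le> D * (M * C * C) * (\<rho> ^ r * \<rho> ^ m)" for r m
  proof -
    have "norm (f (r, m)) \<le> D * (M * \<rho> ^ (r + m) * C * C)"
      unfolding f_def prod.case norm_mult
      by (intro mult_mono bailey_alpha_le W C mult_nonneg_nonneg) (use M0 D0 C(1) \<rho> in auto)
    then show ?thesis by (simp add: power_add mult_ac)
  qed
  have geo: "((\<lambda>m. \<rho> ^ m) has_sum (1 / (1 - \<rho>))) UNIV"
    using geometric_sums[of \<rho>] \<rho> by (intro sums_nonneg_imp_has_sum) auto
  have "(\<lambda>(r, m). D * (M * C * C) * (\<rho> ^ r * \<rho> ^ m)) summable_on UNIV \<times> UNIV"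
  proof (rule summable_on_SigmaI[where g = "\<lambda>r. D * (M * C * C) * (\<rho> ^ r * (1 / (1 - \<rho>)))"], goal_cases)
    case 1
    show ?case unfolding prod.case by (intro has_sum_cmult_right geo)
  next
    case 2
    show ?case by (intro summable_on_cmult_right summable_on_cmult_left has_sum_imp_summable[OF geo])
  qed (use M0 D0 C(1) \<rho> in auto)
  then have f_sm: "f summable_on UNIV \<times> UNIV"
    by (rule abs_summable_summable[OF summable_on_comparison_test]) (use f_le in auto)
  then obtain S where S: "(f has_sum S) (UNIV \<times> UNIV)" by (auto simp: summable_on_def)
  have "((\<lambda>r. bailey_alpha r * E r) has_sum S) UNIV"
  proof (rule has_sum_SigmaD[OF S])
    fix r :: nat
    have "(\<lambda>m. f (r, m)) summable_on UNIV"
      using summable_on_SigmaD1[of "\<lambda>x y. f (x, y)" UNIV "\<lambda>_. UNIV" r] f_sm by (simp add: case_prod_unfold)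
    moreover have "(\<lambda>m. f (r, m)) sums (bailey_alpha r * E r)"
      unfolding f_def prod.case by (rule sums_mult[OF E])
    ultimately show "((\<lambda>m. f (r, m)) has_sum (bailey_alpha r * E r)) UNIV"
      using has_sum_imp_sums[OF has_sum_infsum] sums_unique2 by (metis has_sum_infsum)
  qed
  then have 1: "(\<lambda>r. bailey_alpha r * E r) sums S" by (rule has_sum_imp_sums)
  have "((\<lambda>(n, r). f (r, n - r)) has_sum S) (Sigma UNIV (\<lambda>n. {..n})) \<longleftrightarrow> (f has_sum S) (UNIV \<times> UNIV)"
    by (rule has_sum_reindex_bij_witness[where j = "\<lambda>(n, r). (r, n - r)" and i = "\<lambda>(r, m). (r + m, r)"]) auto
  with S have "((\<lambda>(n, r). f (r, n - r)) has_sum S) (Sigma UNIV (\<lambda>n. {..n}))" by blast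
  then have "((\<lambda>n. \<Sum>r\<le>n. f (r, n - r)) has_sum S) UNIV"
    by (rule has_sum_SigmaD) (auto intro: has_sum_finiteI)
  then have "(\<lambda>n. \<Sum>r\<le>n. f (r, n - r)) sums S" by (rule has_sum_imp_sums)
  moreover have "(\<Sum>r\<le>n. f (r, n - r)) = W n * (qpoch p p n / qpoch p p (2 * n + 1))" for n
  proof -
    have "(\<Sum>r\<le>n. f (r, n - r)) = (\<Sum>r\<le>n. W n * (bailey_alpha r * rq p (int n - int r) * rq p (int n + int r + 2)))"
    proof (intro sum.cong refl)
      fix r assume "r \<in> {..n}"
      then have "int (n - r) = int n - int r" "int (2 * r + 2 + (n - r)) = int n + int r + 2" "r + (n - r) = n" by auto
      then show "f (r, n - r) = W n * (bailey_alpha r * rq p (int n - int r) * rq p (int n + int r + 2))"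
        unfolding f_def prod.case by (simp only: mult_ac)
    qed
    then show ?thesis by (simp add: bailey_pair sum_distrib_left[symmetric])
  qed
  ultimately have "(\<lambda>n. W n * (qpoch p p n / qpoch p p (2 * n + 1))) sums S" by simp
  with 1 show "(\<lambda>n. W n * (qpoch p p n / qpoch p p (2 * n + 1))) sums (\<Sum>r. bailey_alpha r * E r)" "summable (\<lambda>r. bailey_alpha r * E r)"
    by (auto simp: sums_iff)
qed

section \<open>The 1phi1 summation\<close>

lemma qpoch_bounded: obtains K where "K > 0" "\<And>n. norm (qpoch x p n) \<le> K"
  using convergent_imp_Bseq[OF convergentI[OF qpoch_tendsto[OF p1]]] by (auto simp: Bseq_def)

lemma inverse_qpoch_bounded:
  assumes "\<And>i. p ^ i * x \<noteq> 1"
  obtains K where "K > 0" "\<And>n. norm (1 / qpoch x p n) \<le> K"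
proof -
  have "(\<lambda>n. 1 / qpoch x p n) \<longlonglongrightarrow> 1 / qpoch_inf x p"
    by (intro tendsto_divide tendsto_const qpoch_tendsto p1 qpoch_inf_nonzero assms)
  then have "Bseq (\<lambda>n. 1 / qpoch x p n)" by (rule convergent_imp_Bseq[OF convergentI])
  then show ?thesis using that by (auto simp: Bseq_def)
qed

text \<open>The sum of 1phi1(a; a x; p, x). Write S N for the series in which x and c = a x are
  scaled by p^N while a is kept. A telescoping relation gives S N (1 - c p^N) = (1 - x p^N) S(N +
  1), and S N tends to 1; iterating produces the quotient of products.\<close>

lemma phi_1_1_sums:
  assumes c: "\<And>i. p ^ i * (a * x) \<noteq> 1"
  shows "(\<lambda>n. qpoch a p n * (- x) ^ n * p ^ (n choose 2) / (qpoch p p n * qpoch (a * x) p n))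
    sums (qpoch_inf x p / qpoch_inf (a * x) p)"
proof -
  define c where "c = a * x"
  define u where "u N n = qpoch a p n * (- (x * p ^ N)) ^ n * p ^ (n choose 2) / (qpoch p p n * qpoch (c * p ^ N) p n)" for N n
  have c_nz: "1 - c * p ^ i \<noteq> 0" for i using c[of i] by (simp add: c_def mult_ac)
  have pn_nz: "1 - p ^ Suc i \<noteq> 0" for i using p_pow_neq_1[of "Suc i"] by simp
  have qc_nz: "qpoch c p n \<noteq> 0" for n using c_nz by (auto simp: qpoch_def mult_ac)
  obtain K1 where K1: "K1 > 0" "\<And>n. norm (1 / qpoch c p n) \<le> K1"
    by (rule inverse_qpoch_bounded[of c]) (use c in \<open>auto simp: c_def\<close>)
  obtain K2 where K2: "K2 > 0" "\<And>n. norm (qpoch c p n) \<le> K2" by (rule qpoch_bounded) blast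
  obtain K3 where K3: "K3 > 0" "\<And>n. norm (qpoch a p n) \<le> K3" by (rule qpoch_bounded) blast
  obtain K4 where K4: "K4 > 0" "\<And>n. norm (1 / qpoch p p n) \<le> K4"
    by (rule inverse_qpoch_bounded[of p]) (use power_mult_neq_1[OF p1 p1] in auto)
  define K where "K = K3 * K4 * K2 * K1"
  have K0: "K \<ge> 0" using K1 K2 K3 K4 by (simp add: K_def)
  \<comment> \<open>Writing the shifted denominator as a quotient of two values of
    \<open>qpoch c p\<close> isolates the factor \<open>(p ^ n) ^ N\<close>: the rest is bounded
    uniformly in N, and this factor kills every term with n > 0 in the limit.\<close>
  have u_le: "norm (u N n) \<le> K * (norm p powi tri (int n) * (norm x + 1) ^ n) * (norm p ^ n) ^ N" for N n
  proof -
    have "u N n = qpoch a p n * (1 / qpoch p p n) * qpoch c p N * (1 / qpoch c p (N + n)) * (p ^ (n choose 2) * (- x) ^ n) * (p ^ n) ^ N"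
      unfolding u_def qpoch_add using qc_nz[of N]
      by (simp add: power_mult_distrib mult_ac power_minus[of "x * _"] power_minus[of x] flip: power_mult)
    also have "norm \<dots> \<le> K * (norm p powi tri (int n) * (norm x + 1) ^ n) * (norm p ^ n) ^ N"
    proof -
      have "norm (p ^ (n choose 2) * (- x) ^ n) \<le> norm p powi tri (int n) * (norm x + 1) ^ n"
        by (simp add: norm_mult norm_power tri_of_nat mult_left_mono power_mono)
      moreover have "norm (qpoch a p n * (1 / qpoch p p n) * qpoch c p N * (1 / qpoch c p (N + n))) \<le> K"
        unfolding K_def norm_mult using K1(1) K2(1) K3(1) K4(1)
        by (intro mult_mono mult_nonneg_nonneg norm_ge_zero K1(2) K2(2) K3(2) K4(2)) auto
      ultimately show ?thesis
        unfolding norm_mult[of _ "(p ^ n) ^ N"] norm_mult[of _ "p ^ (n choose 2) * (- x) ^ n"]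
          norm_power[of "p ^ n"] norm_power[of p]
        using K0 by (intro mult_right_mono mult_mono) auto
    qed
    finally show ?thesis .
  qed
  define Mb where "Mb n = K * (norm p powi tri (int n) * (norm x + 1) ^ n)" for n
  have sMb: "summable Mb"
    unfolding Mb_def
    by (intro summable_mult summable_on_imp_summable summable_tri_nat) (use p1 in \<open>auto simp: add_nonneg_pos\<close>)
  have u_le': "norm (u N n) \<le> Mb n" for N n
  proof -
    have "(norm p ^ n) ^ N \<le> 1" by (intro power_le_one) (use p1 in auto)
    moreover have "Mb n \<ge> 0" using K0 by (simp add: Mb_def)
    ultimately have "Mb n * (norm p ^ n) ^ N \<le> Mb n" by (rule mult_left_le)
    then show ?thesis using u_le[of N n] by (simp add: Mb_def)
  qed
  have su: "summable (u N)" for N by (rule summable_comparison_test'[OF sMb, of 0]) (use u_le' in auto)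
  define S where "S N = (\<Sum>n. u N n)" for N
  have rec: "S N * (1 - c * p ^ N) = (1 - x * p ^ N) * S (Suc N)" for N
  proof -
    define y d where "y = x * p ^ N" and "d = c * p ^ N"
    \<comment> \<open>The factor \<open>1 - p ^ n\<close> makes \<open>v 0 = 0\<close>, and
      \<open>v\<close> tends to 0, so the differences of \<open>v\<close> sum to 0; they are the
      terms of the recurrence up to the constant \<open>- (1 - d)\<close>.\<close>
    define v where "v n = (1 - p ^ n) * u N n" for n
    have "v \<longlonglongrightarrow> (1 - 0) * 0"
      unfolding v_def
      by (intro tendsto_mult tendsto_diff tendsto_const LIMSEQ_power_zero summable_LIMSEQ_zero su p1)
    then have "(\<lambda>n. v (Suc n) - v n) sums (0 - v 0)" using telescope_sums[of v 0] by simp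
    then have "(\<lambda>n. - (1 - d) * (v (Suc n) - v n)) sums 0"
      using sums_mult[of _ _ "- (1 - d)"] by (fastforce simp: v_def)
    moreover have "- (1 - d) * (v (Suc n) - v n) = u N n * (1 - d) - (1 - y) * u (Suc N) n" for n
    proof -
      have dn: "1 - d * p ^ n \<noteq> 0" "1 - d \<noteq> 0"
        using c_nz[of "N + n"] c_nz[of N] by (simp_all add: d_def power_add mult_ac)
      have qd: "qpoch d p k \<noteq> 0" for k
        using qpoch_add[where x = c and p = p and m = N and n = k] qc_nz[of "N + k"] by (auto simp: d_def mult_ac)
      have qp: "qpoch p p k \<noteq> 0" for k using qpoch_nonzero[OF p1 p1] .
      have "qpoch d p (Suc n) = (1 - d) * qpoch (d * p) p n"
        using qpoch_add[where x = d and p = p and m = 1 and n = n] by (simp add: qpoch_Suc mult_ac)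
      then have q1: "qpoch (d * p) p n = qpoch d p n * (1 - d * p ^ n) / (1 - d)"
        using dn by (simp add: qpoch_Suc field_simps)
      have U0: "u N n = qpoch a p n * (- y) ^ n * p ^ (n choose 2) / (qpoch p p n * qpoch d p n)"
        by (simp add: u_def y_def d_def)
      have "u (Suc N) n = qpoch a p n * (- (y * p)) ^ n * p ^ (n choose 2) / (qpoch p p n * qpoch (d * p) p n)"
        by (simp add: u_def y_def d_def mult_ac)
      also have "\<dots> = u N n * (p ^ n * (1 - d) / (1 - d * p ^ n))"
        unfolding U0 q1 minus_mult_left power_mult_distrib by (simp add: mult_ac)
      finally have U1: "u (Suc N) n = u N n * (p ^ n * (1 - d) / (1 - d * p ^ n))" .
      have "Suc n choose 2 = n + (n choose 2)" by (simp add: numeral_2_eq_2)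
      moreover have "d = a * y" by (simp add: d_def y_def c_def mult_ac)
      ultimately have U2: "u N (Suc n) = u N n * ((d * p ^ (2 * n) - y * p ^ n) / ((1 - p ^ Suc n) * (1 - d * p ^ n)))"
        unfolding u_def y_def[symmetric] d_def[symmetric]
        by (simp add: qpoch_Suc power_add mult_2 mult_2_right algebra_simps)
      have V1: "v (Suc n) = u N n * ((d * p ^ (2 * n) - y * p ^ n) / (1 - d * p ^ n))"
        unfolding v_def U2 using pn_nz[of n] by simp
      then show ?thesis
        unfolding U1 V1 v_def[of n] using dn by (simp add: field_simps power_add mult_2 mult_2_right)
    qed
    ultimately have "(\<lambda>n. u N n * (1 - d) - (1 - y) * u (Suc N) n) sums 0" by simp
    moreover have "(\<lambda>n. u N n * (1 - d) - (1 - y) * u (Suc N) n) sums (S N * (1 - d) - (1 - y) * S (Suc N))"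
      unfolding S_def by (intro sums_diff sums_mult sums_mult2 summable_sums su)
    ultimately have "S N * (1 - d) - (1 - y) * S (Suc N) = 0" using sums_unique2 by blast
    then show ?thesis by (simp add: y_def d_def)
  qed
  have S0: "S 0 = qpoch x p N / qpoch c p N * S N" for N
  proof (induction N)
    case (Suc N)
    have "S N = (1 - x * p ^ N) / (1 - c * p ^ N) * S (Suc N)"
      using rec[of N] c_nz[of N] by (simp add: field_simps)
    with Suc show ?case by (simp add: qpoch_Suc mult_ac)
  qed simp
  have "S \<longlonglongrightarrow> (\<Sum>n. if n = 0 then 1 else 0)"
    unfolding S_def
  proof (rule tannerys_theorem[where M = Mb, THEN conjunct2, THEN conjunct2])
    fix n
    show "(\<lambda>N. u N n) \<longlonglongrightarrow> (if n = 0 then 1 else 0)"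
    proof (cases "n = 0")
      case False
      have "(\<lambda>N. Mb n * (norm p ^ n) ^ N) \<longlonglongrightarrow> Mb n * 0"
        by (intro tendsto_mult tendsto_const LIMSEQ_power_zero) (use False p1 in \<open>auto simp: power_less_one_iff\<close>)
      then have lim: "(\<lambda>N. Mb n * (norm p ^ n) ^ N) \<longlonglongrightarrow> 0" by simp
      have "eventually (\<lambda>N. norm (u N n) \<le> Mb n * (norm p ^ n) ^ N) sequentially"
        by (rule always_eventually) (use u_le in \<open>simp add: Mb_def\<close>)
      then have "(\<lambda>N. u N n) \<longlonglongrightarrow> 0" using lim by (rule Lim_null_comparison)
      with False show ?thesis by simp
    qed (simp add: u_def numeral_2_eq_2)
  qed (use sMb u_le' in \<open>auto intro: always_eventually\<close>)
  moreover have "(\<Sum>n::nat. if n = 0 then 1 else 0 :: complex) = 1"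
    by (rule sums_unique[symmetric], rule sums_single)
  ultimately have "S \<longlonglongrightarrow> 1" by simp
  then have "(\<lambda>N. qpoch x p N / qpoch c p N * S N) \<longlonglongrightarrow> qpoch_inf x p / qpoch_inf c p * 1"
    using c by (intro tendsto_mult tendsto_divide qpoch_tendsto p1 qpoch_inf_nonzero) (auto simp: c_def)
  then have "S 0 = qpoch_inf x p / qpoch_inf c p"
    unfolding S0[symmetric] by (simp add: LIMSEQ_const_iff)
  moreover have "u 0 sums S 0" unfolding S_def by (rule summable_sums[OF su])
  ultimately show ?thesis by (simp add: u_def[abs_def] c_def)
qed

end

section \<open>Hecke-type series for the mock theta functions\<close>

lemma qpoch_mult_minus: "qpoch x p n * qpoch (- x) p n = qpoch (x ^ 2) (p ^ 2) n"
proof (induction n)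
  case (Suc n)
  have "(1 - p ^ n * x) * (1 - p ^ n * (- x)) = 1 - (p ^ 2) ^ n * x ^ 2"
    by (simp add: algebra_simps power2_eq_square power_mult_distrib)
  with Suc show ?case unfolding qpoch_Suc by (metis mult.assoc mult.left_commute)
qed simp

context nome
begin

text \<open>The odd powers give (p;p^2)_{n+1}, the even ones (p^2;p^2)_n = (p;p)_n (-p;p)_n. This
  exposes in beta_n the denominator of phi and psi.\<close>

lemma qpoch_p_double: "qpoch p p (2 * n + 1) = qpoch p p n * qpoch (- p) p n * qpoch p (p ^ 2) (n + 1)"
proof (induction n)
  case (Suc n)
  have "qpoch p p (2 * Suc n + 1) = qpoch p p (2 * n + 1) * ((1 - p ^ (2 * n + 1) * p) * (1 - p ^ (2 * n + 2) * p))"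
    by (simp add: qpoch_Suc)
  also have "\<dots> = (qpoch p p n * (1 - p ^ n * p)) * (qpoch (- p) p n * (1 - p ^ n * (- p)))
      * (qpoch p (p ^ 2) (n + 1) * (1 - (p ^ 2) ^ (n + 1) * p))"
  proof -
    have "(p ^ 2) ^ (n + 1) = p ^ (2 * n + 2)"
      unfolding power_mult[symmetric] by (simp only: distrib_left mult_1_right)
    moreover have "1 - p ^ (2 * n + 1) * p = (1 - p ^ n * p) * (1 - p ^ n * (- p))"
      by (simp add: algebra_simps power_add mult_2 mult_2_right)
    ultimately show ?thesis unfolding Suc by (simp only: mult_ac)
  qed
  finally show ?case by (simp only: qpoch_Suc Suc_eq_plus1[symmetric])
qed (simp add: qpoch_Suc)

lemma minus_tc_of_nat: "- tc p (int r + 1) = (- 1) ^ r * p ^ (Suc r choose 2)"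
proof -
  have "tri (int r + 1) = int (Suc r choose 2)" using tri_of_nat[of "Suc r"] by (simp add: add.commute)
  then show ?thesis by (simp add: tc_def power_int_add)
qed

text \<open>Supplies the geometric bound demanded by \<open>bailey_transform\<close>, with
  \<open>norm p\<close> as ratio, for the three choices of weights.\<close>

lemma qpoch_shift_bound:
  assumes b: "norm b < 1" and e: "\<And>n. n \<le> e n" and W: "\<And>n. W n = (- 1) ^ k n * p ^ e n * qpoch x b (l n)"
  obtains M where "\<And>n. norm (W n) \<le> M * norm p ^ n"
proof -
  have "(\<lambda>n. qpoch x b n) \<longlonglongrightarrow> qpoch_inf x b" by (rule qpoch_tendsto[OF b])
  then have "Bseq (\<lambda>n. qpoch x b n)" by (rule convergent_imp_Bseq[OF convergentI])
  then obtain K where K: "K > 0" "\<And>n. norm (qpoch x b n) \<le> K" by (auto simp: Bseq_def)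
  have "norm (W n) \<le> K * norm p ^ n" for n
  proof -
    have "norm p ^ e n \<le> norm p ^ n" by (rule power_decreasing[OF e]) (use p1 in auto)
    then have "norm p ^ e n * norm (qpoch x b (l n)) \<le> norm p ^ n * K"
      by (intro mult_mono K) auto
    then show ?thesis by (simp add: W norm_mult norm_power mult_ac)
  qed
  then show ?thesis using that by blast
qed

lemma rq_double: "rq p (int (2 * r + 2 + m)) = 1 / (qpoch p p (2 * r + 2) * qpoch (p ^ (2 * r + 3)) p m)"
  unfolding rq_nat qpoch_add by (simp add: power_add power2_eq_square power3_eq_cube mult_ac)

lemma choose_2_add: "(r + m) choose 2 = (r choose 2) + (m choose 2) + r * m"
proof -
  have "int ((r + m) choose 2) = int ((r choose 2) + (m choose 2) + r * m)"
    using tri_add[of "int r" "int m"] tri_of_nat[of "r + m"] tri_of_nat[of r] tri_of_nat[of m] by simp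
  then show ?thesis by (simp only: of_nat_eq_iff)
qed

lemma choose_2_ge: "n \<le> Suc n choose 2"
  by (simp add: numeral_2_eq_2)

text \<open>The shape in which the constant leaves the 1phi1 summation; \<open>J12_eq_theta\<close>
  identifies it with j(p; p^2).\<close>

definition J12 where "J12 = qpoch_inf p p / qpoch_inf (- p) p"

lemma minus_p_ne_1: "p ^ i * (- (p ^ Suc k)) \<noteq> 1" "p ^ i * p ^ Suc k \<noteq> 1"
proof -
  have "norm (p ^ Suc k) < 1" unfolding norm_power by (rule power_Suc_less_one) (use p0 p1 in auto)
  then show "p ^ i * (- (p ^ Suc k)) \<noteq> 1" "p ^ i * p ^ Suc k \<noteq> 1"
    using power_mult_neq_1[OF p1] by (metis norm_minus_cancel)+
qed

lemma J12_nonzero: "J12 \<noteq> 0"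
  unfolding J12_def using qpoch_inf_nonzero'[OF p1 p1] qpoch_inf_nonzero'[OF p1, of "- p"] p1 by simp

lemma beta_eq: "qpoch p p n / qpoch p p (2 * n + 1) * qpoch (- p) p n = 1 / qpoch p (p ^ 2) (n + 1)"
proof -
  have "qpoch p p n \<noteq> 0" "qpoch (- p) p n \<noteq> 0"
    using qpoch_nonzero[OF p1 p1] qpoch_nonzero[OF p1, of "- p"] p1 by auto
  then show ?thesis unfolding qpoch_p_double by simp
qed

text \<open>The factor (-p;p)_n of the weight W cancels the one in beta_n. Its conjugate sequence is
  a 1phi1 with a = -p^(r+1) and x = -p^(r+2), whose lower parameter a x = p^(2r+3) is the one that
  \<open>rq_double\<close> asks for.\<close>

lemma mock_psi_sums:
  "(\<lambda>r. (- 1) ^ r * p ^ ((r + 1) ^ 2) * (1 - p ^ (r + 1)) * G p r) sums (J12 * mock_psi p)"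
proof -
  define W where "W n = p ^ ((n + 2) choose 2) * qpoch (- p) p n" for n
  define E where "E r = p ^ ((r + 2) choose 2) / (J12 * (1 + p ^ (r + 1)))" for r
  have ge: "n \<le> (n + 2) choose 2" for n using choose_2_ge[of "Suc n"] by simp
  have "W n = (- 1) ^ 0 * p ^ ((n + 2) choose 2) * qpoch (- p) p n" for n by (simp add: W_def)
  then obtain M where M: "\<And>n. norm (W n) \<le> M * norm p ^ n"
    by (rule qpoch_shift_bound[OF p1 ge]) blast
  have E: "(\<lambda>m. W (r + m) * rq p (int m) * rq p (int (2 * r + 2 + m))) sums E r" for r
  proof -
    define K where "K = p ^ ((r + 2) choose 2) * qpoch (- p) p r / qpoch p p (2 * r + 2)"
    have pw: "- (p ^ (r + 1)) * - (p ^ (r + 2)) = p ^ (2 * r + 3)"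
      unfolding minus_mult_minus power_add[symmetric] by (rule arg_cong[where f = "\<lambda>k. p ^ k"]) simp
    have c: "p ^ i * (- (p ^ (r + 1)) * - (p ^ (r + 2))) \<noteq> 1" for i
      unfolding pw using minus_p_ne_1(2)[of i "2 * r + 2"] by (simp add: eval_nat_numeral)
    have "(\<lambda>m. K * (qpoch (- (p ^ (r + 1))) p m * (- (- (p ^ (r + 2)))) ^ m * p ^ (m choose 2)
        / (qpoch p p m * qpoch (- (p ^ (r + 1)) * - (p ^ (r + 2))) p m))) sums
        (K * (qpoch_inf (- (p ^ (r + 2))) p / qpoch_inf (- (p ^ (r + 1)) * - (p ^ (r + 2))) p))"
      by (intro sums_mult phi_1_1_sums c)
    moreover have "K * (qpoch (- (p ^ (r + 1))) p m * (- (- (p ^ (r + 2)))) ^ m * p ^ (m choose 2)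
        / (qpoch p p m * qpoch (- (p ^ (r + 1)) * - (p ^ (r + 2))) p m))
        = W (r + m) * rq p (int m) * rq p (int (2 * r + 2 + m))" for m
    proof -
      have "(r + m + 2) choose 2 = ((r + 2) choose 2) + (m choose 2) + (r + 2) * m"
        using choose_2_add[of "r + 2" m] by (simp add: add.commute add.left_commute)
      then have w: "p ^ ((r + m + 2) choose 2) = p ^ ((r + 2) choose 2) * p ^ (m choose 2) * (p ^ (r + 2)) ^ m"
        by (simp only: power_add power_mult)
      have x: "p ^ r * - p = - (p ^ (r + 1))" by simp
      show ?thesis
        unfolding W_def w rq_double pw qpoch_add[of "- p"] x rq_nat[of m] K_def minus_minus by (simp add: mult_ac)
    qed
    moreover have "K * (qpoch_inf (- (p ^ (r + 2))) p / qpoch_inf (- (p ^ (r + 1)) * - (p ^ (r + 2))) p) = E r"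
    proof -
      have 1: "qpoch_inf p p = qpoch p p (2 * r + 2) * qpoch_inf (p ^ (2 * r + 3)) p"
        using qpoch_inf_split_first[OF p1, of p "2 * r + 2"] by (simp add: eval_nat_numeral mult_ac)
      have 2: "qpoch_inf (- p) p = qpoch (- p) p r * (1 + p ^ (r + 1)) * qpoch_inf (- (p ^ (r + 2))) p"
        using qpoch_inf_split_first[OF p1, of "- p" "Suc r"] by (simp add: qpoch_Suc mult_ac)
      have nz: "qpoch_inf p p \<noteq> 0" "qpoch_inf (- p) p \<noteq> 0" using J12_nonzero by (auto simp: J12_def)
      define d where "d = 1 + p ^ (r + 1)"
      show ?thesis
        unfolding E_def K_def pw J12_def using nz unfolding 1 2 d_def[symmetric] by (simp add: field_simps)
    qed
    ultimately show ?thesis by simp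
  qed
  note bt = bailey_transform[OF M norm_ge_zero p1 E]
  have "W n * (qpoch p p n / qpoch p p (2 * n + 1)) = p ^ ((n + 2) choose 2) / qpoch p (p ^ 2) (n + 1)" for n
  proof -
    have "W n * (qpoch p p n / qpoch p p (2 * n + 1))
        = p ^ ((n + 2) choose 2) * (qpoch p p n / qpoch p p (2 * n + 1) * qpoch (- p) p n)"
      by (simp only: W_def mult_ac)
    then show ?thesis unfolding beta_eq by simp
  qed
  then have "mock_psi p = (\<Sum>r. bailey_alpha r * E r)"
    using sums_unique[OF bt(1)] by (simp add: mock_psi_def)
  then have "(\<lambda>r. J12 * (bailey_alpha r * E r)) sums (J12 * mock_psi p)"
    using summable_sums[OF bt(2)] by (intro sums_mult) simp
  moreover have "J12 * (bailey_alpha r * E r) = (- 1) ^ r * p ^ ((r + 1) ^ 2) * (1 - p ^ (r + 1)) * G p r" for r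
  proof -
    have nz: "1 + p ^ (r + 1) \<noteq> 0"
    proof
      assume "1 + p ^ (r + 1) = 0"
      then have "1 = - (p ^ (r + 1))" by (simp only: eq_neg_iff_add_eq_0)
      with minus_p_ne_1(1)[of 0 r] show False by simp
    qed
    have f: "1 - p ^ (2 * r + 2) = (1 - p ^ (r + 1)) * (1 + p ^ (r + 1))"
      by (simp add: algebra_simps power_add mult_2 mult_2_right)
    have "int ((Suc r choose 2) + ((r + 2) choose 2)) = int ((r + 1) ^ 2)"
      using two_tri[of "int (Suc r)"] two_tri[of "int (r + 2)"] unfolding tri_of_nat
      by (simp add: algebra_simps power2_eq_square)
    then have "(Suc r choose 2) + ((r + 2) choose 2) = (r + 1) ^ 2" by (simp only: of_nat_eq_iff)
    then have "p ^ ((r + 1) ^ 2) = p ^ (Suc r choose 2) * p ^ ((r + 2) choose 2)"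
      by (simp only: power_add[symmetric])
    then show ?thesis
      unfolding bailey_alpha_def E_def f minus_tc_of_nat using nz J12_nonzero by simp
  qed
  ultimately show ?thesis by simp
qed

text \<open>Here the summable 1phi1, with a = x = -p^(r+1), has lower parameter p^(2r+2) and so
  yields \<open>rq\<close> at 2r + 1 + m, one step too low. \<open>E r\<close> is therefore
  recovered from the two neighbouring closed forms \<open>e r\<close> and
  \<open>e (r + 1)\<close>.\<close>

lemma mock_phi_sums:
  "(\<lambda>r. (- 1) ^ r * p ^ (r * (r + 1)) * (1 - p ^ (3 * r + 3)) * G p r) sums (J12 * mock_phi p)"
proof -
  define W where "W n = p ^ ((n + 1) choose 2) * qpoch (- p) p n" for n
  define e where "e r = p ^ ((r + 1) choose 2) / J12" for r
  define E where "E r = (e r - p ^ (2 * r + 2) * e (r + 1)) / (1 - p ^ (2 * r + 2))" for r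
  have ge: "n \<le> (n + 1) choose 2" for n using choose_2_ge[of n] by simp
  have "W n = (- 1) ^ 0 * p ^ ((n + 1) choose 2) * qpoch (- p) p n" for n by (simp add: W_def)
  then obtain M where M: "\<And>n. norm (W n) \<le> M * norm p ^ n"
    by (rule qpoch_shift_bound[OF p1 ge]) blast
  have e: "(\<lambda>m. W (r + m) * rq p (int m) * rq p (int (2 * r + 1 + m))) sums e r" for r
  proof -
    define K where "K = p ^ ((r + 1) choose 2) * qpoch (- p) p r / qpoch p p (2 * r + 1)"
    have pw: "- (p ^ (r + 1)) * - (p ^ (r + 1)) = p ^ (2 * r + 2)"
      unfolding minus_mult_minus power_add[symmetric] by (rule arg_cong[where f = "\<lambda>k. p ^ k"]) simp
    have c: "p ^ i * (- (p ^ (r + 1)) * - (p ^ (r + 1))) \<noteq> 1" for i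
      unfolding pw using minus_p_ne_1(2)[of i "2 * r + 1"] by (simp add: eval_nat_numeral)
    have "(\<lambda>m. K * (qpoch (- (p ^ (r + 1))) p m * (- (- (p ^ (r + 1)))) ^ m * p ^ (m choose 2)
        / (qpoch p p m * qpoch (- (p ^ (r + 1)) * - (p ^ (r + 1))) p m))) sums
        (K * (qpoch_inf (- (p ^ (r + 1))) p / qpoch_inf (- (p ^ (r + 1)) * - (p ^ (r + 1))) p))"
      by (intro sums_mult phi_1_1_sums c)
    moreover have "K * (qpoch (- (p ^ (r + 1))) p m * (- (- (p ^ (r + 1)))) ^ m * p ^ (m choose 2)
        / (qpoch p p m * qpoch (- (p ^ (r + 1)) * - (p ^ (r + 1))) p m))
        = W (r + m) * rq p (int m) * rq p (int (2 * r + 1 + m))" for m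
    proof -
      have "(r + m + 1) choose 2 = ((r + 1) choose 2) + (m choose 2) + (r + 1) * m"
        using choose_2_add[of "r + 1" m] by (simp add: add.commute add.left_commute)
      then have w: "p ^ ((r + m + 1) choose 2) = p ^ ((r + 1) choose 2) * p ^ (m choose 2) * (p ^ (r + 1)) ^ m"
        by (simp only: power_add power_mult)
      have x: "p ^ r * - p = - (p ^ (r + 1))" by simp
      have y: "rq p (int (2 * r + 1 + m)) = 1 / (qpoch p p (2 * r + 1) * qpoch (p ^ (2 * r + 2)) p m)"
        unfolding rq_nat qpoch_add by (simp add: power_add power2_eq_square mult_ac)
      show ?thesis
        unfolding W_def w y pw qpoch_add[of "- p"] x rq_nat[of m] K_def minus_minus by (simp add: mult_ac)
    qed
    moreover have "K * (qpoch_inf (- (p ^ (r + 1))) p / qpoch_inf (- (p ^ (r + 1)) * - (p ^ (r + 1))) p) = e r"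
    proof -
      have 1: "qpoch_inf p p = qpoch p p (2 * r + 1) * qpoch_inf (p ^ (2 * r + 2)) p"
        using qpoch_inf_split_first[OF p1, of p "2 * r + 1"] by (simp add: eval_nat_numeral mult_ac)
      have 2: "qpoch_inf (- p) p = qpoch (- p) p r * qpoch_inf (- (p ^ (r + 1))) p"
        using qpoch_inf_split_first[OF p1, of "- p" r] by (simp add: mult_ac)
      have nz: "qpoch_inf p p \<noteq> 0" "qpoch_inf (- p) p \<noteq> 0" using J12_nonzero by (auto simp: J12_def)
      show ?thesis
        unfolding e_def K_def pw J12_def using nz unfolding 1 2 by (simp add: field_simps)
    qed
    ultimately show ?thesis by simp
  qed
  have nz: "1 - p ^ (2 * r + 2) \<noteq> 0" for r using p_pow_neq_1[of "2 * r + 2"] by simp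
  have E: "(\<lambda>m. W (r + m) * rq p (int m) * rq p (int (2 * r + 2 + m))) sums E r" for r
  proof -
    \<comment> \<open>The series for \<open>e (r + 1)\<close> with its index raised by one; its new
      term at m = 0 is 0 because of \<open>rq p (- 1)\<close>. The combination works by (1 -
      p^(2r+2+m)) - p^(2r+2) (1 - p^m) = 1 - p^(2r+2).\<close>
    define g where "g m = W (r + m) * rq p (int m - 1) * rq p (int (2 * r + 2 + m))" for m
    have "(\<lambda>m. g (Suc m)) sums e (r + 1)"
      using e[of "r + 1"] by (simp add: g_def)
    then have "g sums e (r + 1)"
      by (subst (asm) sums_Suc_iff) (simp add: g_def rq_neg)
    then have "(\<lambda>m. (W (r + m) * rq p (int m) * rq p (int (2 * r + 1 + m)) - p ^ (2 * r + 2) * g m) / (1 - p ^ (2 * r + 2))) sums E r"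
      unfolding E_def by (intro sums_divide sums_diff sums_mult e)
    moreover have "(W (r + m) * rq p (int m) * rq p (int (2 * r + 1 + m)) - p ^ (2 * r + 2) * g m) / (1 - p ^ (2 * r + 2))
       = W (r + m) * rq p (int m) * rq p (int (2 * r + 2 + m))" for m
    proof -
      have "int (2 * r + 1 + m) = int (2 * r + 2 + m) - 1" by simp
      then have 1: "rq p (int (2 * r + 1 + m)) = (1 - p ^ (2 * r + 2 + m)) * rq p (int (2 * r + 2 + m))"
        using rq_pred[of "int (2 * r + 2 + m)"] by (simp only: power_int_of_nat)
      have 2: "rq p (int m - 1) = (1 - p ^ m) * rq p (int m)"
        using rq_pred[of "int m"] by (simp only: power_int_of_nat)
      have "W (r + m) * rq p (int m) * rq p (int (2 * r + 1 + m)) - p ^ (2 * r + 2) * g m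
        = (1 - p ^ (2 * r + 2)) * (W (r + m) * rq p (int m) * rq p (int (2 * r + 2 + m)))"
        unfolding g_def 1 2 power_add[of p "2 * r + 2" m] by (simp only: algebra_simps mult_1_left)
      then show ?thesis using nz[of r] by simp
    qed
    ultimately show ?thesis by simp
  qed
  note bt = bailey_transform[OF M norm_ge_zero p1 E]
  have "W n * (qpoch p p n / qpoch p p (2 * n + 1)) = p ^ ((n + 1) choose 2) / qpoch p (p ^ 2) (n + 1)" for n
  proof -
    have "W n * (qpoch p p n / qpoch p p (2 * n + 1))
        = p ^ ((n + 1) choose 2) * (qpoch p p n / qpoch p p (2 * n + 1) * qpoch (- p) p n)"
      by (simp only: W_def mult_ac)
    then show ?thesis unfolding beta_eq by simp
  qed
  then have "mock_phi p = (\<Sum>r. bailey_alpha r * E r)"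
    using sums_unique[OF bt(1)] by (simp add: mock_phi_def)
  then have "(\<lambda>r. J12 * (bailey_alpha r * E r)) sums (J12 * mock_phi p)"
    using summable_sums[OF bt(2)] by (intro sums_mult) simp
  moreover have "J12 * (bailey_alpha r * E r) = (- 1) ^ r * p ^ (r * (r + 1)) * (1 - p ^ (3 * r + 3)) * G p r" for r
  proof -
    have c: "(r + 1 + 1) choose 2 = ((r + 1) choose 2) + (r + 1)" by (simp add: numeral_2_eq_2)
    have "((r + 1) choose 2) + ((r + 1) choose 2) = r * (r + 1)"
    proof -
      have "int (((r + 1) choose 2) + ((r + 1) choose 2)) = int (r * (r + 1))"
        using two_tri[of "int (r + 1)"] unfolding tri_of_nat by (simp add: algebra_simps)
      then show ?thesis by (simp only: of_nat_eq_iff)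
    qed
    then have 1: "p ^ (r * (r + 1)) = p ^ ((r + 1) choose 2) * p ^ ((r + 1) choose 2)"
      by (simp only: power_add[symmetric])
    have 2: "p ^ (3 * r + 3) = p ^ (2 * r + 2) * p ^ (r + 1)"
      unfolding power_add[symmetric] by (rule arg_cong[where f = "\<lambda>k. p ^ k"]) simp
    have "e r - p ^ (2 * r + 2) * e (r + 1) = p ^ ((r + 1) choose 2) * (1 - p ^ (3 * r + 3)) / J12"
      unfolding e_def c 2 power_add[of p "(r + 1) choose 2"] by (simp add: algebra_simps diff_divide_distrib)
    then show ?thesis
      unfolding bailey_alpha_def E_def 1 minus_tc_of_nat using nz[of r] J12_nonzero by (simp add: mult_ac)
  qed
  ultimately show ?thesis by simp
qed

text \<open>Gauss's product for the theta function j(-p; p^4), in the form produced by the 1phi1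
  summation in base p^2.\<close>

definition J14 where "J14 = qpoch_inf (p ^ 2) (p ^ 2) / qpoch_inf p (p ^ 2)"

lemma qpoch_minus_odd: "qpoch (- p) p (2 * n + 1) = qpoch (- p) (p ^ 2) (n + 1) * qpoch (- (p ^ 2)) (p ^ 2) n"
proof (induction n)
  case (Suc n)
  have "qpoch (- p) p (2 * Suc n + 1) = qpoch (- p) p (2 * n + 1) * ((1 - p ^ (2 * n + 1) * (- p)) * (1 - p ^ (2 * n + 2) * (- p)))"
    by (simp add: qpoch_Suc)
  also have "\<dots> = (qpoch (- p) (p ^ 2) (n + 1) * (1 - (p ^ 2) ^ (n + 1) * (- p))) * (qpoch (- (p ^ 2)) (p ^ 2) n * (1 - (p ^ 2) ^ n * (- (p ^ 2))))"
  proof -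
    have "(p ^ 2) ^ (n + 1) = p ^ (2 * n + 2)" "(p ^ 2) ^ n * (- (p ^ 2)) = p ^ (2 * n + 1) * (- p)"
      by (simp_all add: power_mult power2_eq_square power_mult_distrib mult_ac)
    then show ?thesis unfolding Suc by (simp only: mult_ac)
  qed
  finally show ?case by (simp only: qpoch_Suc Suc_eq_plus1[symmetric])
qed (simp add: qpoch_Suc)

text \<open>The Bailey pair is taken in base p^2, where the weight (p;p^2)_{n+1} turns beta_n into
  1/(-p;p)_{2n+1}. The 1phi1 has a = x = p^(2r+3). The signs of \<open>bailey_alpha\<close> and of
  \<open>E\<close> cancel.\<close>

lemma mock_chi_sums:
  "(\<lambda>r. p ^ (r * (r + 1) + (r + 1) ^ 2) * (1 - p ^ (4 * r + 4)) * G (p ^ 2) r) sums (J14 * mock_chi p)"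
proof -
  interpret P: nome "p ^ 2" by (rule power_nome) simp
  define W where "W n = (- 1) ^ n * p ^ ((n + 1) ^ 2) * qpoch p (p ^ 2) (n + 1)" for n
  define E where "E r = (- 1) ^ r * p ^ ((r + 1) ^ 2) / J14" for r
  have ge: "n \<le> (n + 1) ^ 2" for n :: nat by (simp add: power2_eq_square)
  have "W n = (- 1) ^ n * p ^ ((n + 1) ^ 2) * qpoch p (p ^ 2) (n + 1)" for n by (simp add: W_def)
  then obtain M where M: "\<And>n. norm (W n) \<le> M * norm p ^ n"
    by (rule qpoch_shift_bound[OF P.p1 ge]) blast
  have nz1: "qpoch_inf p (p ^ 2) \<noteq> 0" by (rule qpoch_inf_nonzero'[OF P.p1 p1])
  have nz2: "qpoch_inf (p ^ 2) (p ^ 2) \<noteq> 0" by (rule qpoch_inf_nonzero'[OF P.p1 P.p1])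
  have E: "(\<lambda>m. W (r + m) * rq (p ^ 2) (int m) * rq (p ^ 2) (int (2 * r + 2 + m))) sums E r" for r
  proof -
    define K where "K = (- 1) ^ r * p ^ ((r + 1) ^ 2) * qpoch p (p ^ 2) (r + 1) / qpoch (p ^ 2) (p ^ 2) (2 * r + 2)"
    have pw: "p ^ (2 * r + 3) * p ^ (2 * r + 3) = (p ^ 2) ^ (2 * r + 3)"
      by (simp add: power2_eq_square power_mult_distrib)
    have c: "(p ^ 2) ^ i * (p ^ (2 * r + 3) * p ^ (2 * r + 3)) \<noteq> 1" for i
      unfolding pw using P.minus_p_ne_1(2)[of i "2 * r + 2"] by (simp add: eval_nat_numeral)
    have "(\<lambda>m. K * (qpoch (p ^ (2 * r + 3)) (p ^ 2) m * (- (p ^ (2 * r + 3))) ^ m * (p ^ 2) ^ (m choose 2)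
        / (qpoch (p ^ 2) (p ^ 2) m * qpoch (p ^ (2 * r + 3) * p ^ (2 * r + 3)) (p ^ 2) m))) sums
        (K * (qpoch_inf (p ^ (2 * r + 3)) (p ^ 2) / qpoch_inf (p ^ (2 * r + 3) * p ^ (2 * r + 3)) (p ^ 2)))"
      by (intro sums_mult P.phi_1_1_sums c)
    moreover have "K * (qpoch (p ^ (2 * r + 3)) (p ^ 2) m * (- (p ^ (2 * r + 3))) ^ m * (p ^ 2) ^ (m choose 2)
        / (qpoch (p ^ 2) (p ^ 2) m * qpoch (p ^ (2 * r + 3) * p ^ (2 * r + 3)) (p ^ 2) m))
        = W (r + m) * rq (p ^ 2) (int m) * rq (p ^ 2) (int (2 * r + 2 + m))" for m
    proof -
      have "int (2 * (m choose 2)) = int m * (int m - 1)"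
        using tri_of_nat[of m] two_tri[of "int m"] by simp
      then have "int ((r + m + 1) ^ 2) = int ((r + 1) ^ 2 + 2 * (m choose 2) + (2 * r + 3) * m)"
        by (simp add: power2_eq_square algebra_simps)
      then have "(r + m + 1) ^ 2 = (r + 1) ^ 2 + 2 * (m choose 2) + (2 * r + 3) * m" by (simp only: of_nat_eq_iff)
      then have w: "p ^ ((r + m + 1) ^ 2) = p ^ ((r + 1) ^ 2) * (p ^ 2) ^ (m choose 2) * (p ^ (2 * r + 3)) ^ m"
        by (simp only: power_add power_mult)
      have x: "qpoch p (p ^ 2) (r + m + 1) = qpoch p (p ^ 2) (r + 1) * qpoch (p ^ (2 * r + 3)) (p ^ 2) m"
      proof -
        have "(p ^ 2) ^ (r + 1) * p = p ^ (2 * r + 3)"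
          unfolding power_mult[symmetric] power_Suc2[symmetric] by (rule arg_cong[where f = "\<lambda>k. p ^ k"]) simp
        moreover have "r + m + 1 = r + 1 + m" by simp
        ultimately show ?thesis using qpoch_add[of p "p ^ 2" "r + 1" m] by (simp only:)
      qed
      show ?thesis
        unfolding W_def w P.rq_double pw x K_def P.rq_nat[of m] power_minus[of "p ^ (2 * r + 3)"] power_add[of "- 1"]
        by (simp only: mult_ac times_divide_eq_left times_divide_eq_right divide_divide_eq_left mult_1_left)
    qed
    moreover have "K * (qpoch_inf (p ^ (2 * r + 3)) (p ^ 2) / qpoch_inf (p ^ (2 * r + 3) * p ^ (2 * r + 3)) (p ^ 2)) = E r"
    proof -
      have 1: "qpoch_inf (p ^ 2) (p ^ 2) = qpoch (p ^ 2) (p ^ 2) (2 * r + 2) * qpoch_inf ((p ^ 2) ^ (2 * r + 3)) (p ^ 2)"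
      proof -
        have "(p ^ 2) ^ (2 * r + 2) * p ^ 2 = (p ^ 2) ^ (2 * r + 3)" by (simp add: eval_nat_numeral mult_ac)
        then show ?thesis using qpoch_inf_split_first[OF P.p1, of "p ^ 2" "2 * r + 2"] by simp
      qed
      have 2: "qpoch_inf p (p ^ 2) = qpoch p (p ^ 2) (r + 1) * qpoch_inf (p ^ (2 * r + 3)) (p ^ 2)"
      proof -
        have "(p ^ 2) ^ (r + 1) * p = p ^ (2 * r + 3)"
          unfolding power_mult[symmetric] power_Suc2[symmetric] by (rule arg_cong[where f = "\<lambda>k. p ^ k"]) simp
        then show ?thesis using qpoch_inf_split_first[OF P.p1, of p "r + 1"] by simp
      qed
      show ?thesis
        unfolding E_def K_def pw J14_def using nz1 nz2 unfolding 1 2 by (simp add: field_simps)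
    qed
    ultimately show ?thesis by simp
  qed
  note bt = P.bailey_transform[OF M norm_ge_zero p1 E]
  have "W n * (qpoch (p ^ 2) (p ^ 2) n / qpoch (p ^ 2) (p ^ 2) (2 * n + 1)) = (- 1) ^ n * p ^ ((n + 1) ^ 2) / qpoch (- p) p (2 * n + 1)" for n
  proof -
    have nz: "qpoch (p ^ 2) (p ^ 2) n \<noteq> 0" "qpoch p (p ^ 2) (n + 1) \<noteq> 0"
      using qpoch_nonzero[OF P.p1] P.p1 p1 by auto
    have h: "qpoch p (p ^ 2) (n + 1) * qpoch (- p) (p ^ 2) (n + 1) = qpoch (p ^ 2) ((p ^ 2) ^ 2) (n + 1)"
      by (rule qpoch_mult_minus)
    show ?thesis
      unfolding W_def P.qpoch_p_double qpoch_minus_odd h[symmetric] using nz by (simp add: field_simps)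
  qed
  then have "mock_chi p = (\<Sum>r. P.bailey_alpha r * E r)"
    using sums_unique[OF bt(1)] by (simp add: mock_chi_def)
  then have "(\<lambda>r. J14 * (P.bailey_alpha r * E r)) sums (J14 * mock_chi p)"
    using summable_sums[OF bt(2)] by (intro sums_mult) simp
  moreover have "J14 * (P.bailey_alpha r * E r) = p ^ (r * (r + 1) + (r + 1) ^ 2) * (1 - p ^ (4 * r + 4)) * G (p ^ 2) r" for r
  proof -
    have "2 * (Suc r choose 2) = r * (r + 1)"
    proof -
      have "int (2 * (Suc r choose 2)) = int (r * (r + 1))"
        using two_tri[of "int (Suc r)"] unfolding tri_of_nat by (simp add: algebra_simps)
      then show ?thesis by (simp only: of_nat_eq_iff)
    qed
    then have 1: "(p ^ 2) ^ (Suc r choose 2) = p ^ (r * (r + 1))" by (simp only: power_mult[symmetric])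
    have 2: "(p ^ 2) ^ (2 * r + 2) = p ^ (4 * r + 4)"
      unfolding power_mult[symmetric] by (rule arg_cong[where f = "\<lambda>k. p ^ k"]) simp
    have 3: "(- 1) ^ r * ((- 1) ^ r * z) = z" for z :: complex
      by (simp add: mult.assoc[symmetric] power_mult_distrib[symmetric])
    have nz: "J14 \<noteq> 0" using nz1 nz2 by (simp add: J14_def)
    show ?thesis
      unfolding P.bailey_alpha_def E_def P.minus_tc_of_nat 1 2 power_add[of p "r * (r + 1)"] using nz
      by (simp add: mult_ac 3)
  qed
  ultimately show ?thesis by simp
qed

section \<open>Appell-Lerch sums\<close>

lemma euler_laurent: "laurent (\<lambda>n. tc p n * rq p n) (\<lambda>x. qpoch_inf x p)"
proof -
  obtain C where C: "C > 0" "\<And>k. norm (rq p k) \<le> C" using rq_bounded by blast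
  have L: "laurent (\<lambda>n. tc p n * rq p n) (\<lambda>x. \<Sum>\<^sub>\<infinity>n. tc p n * rq p n * x powi n)"
  proof (rule laurent_I_bound)
    show "norm (tc p n * rq p n) \<le> C * (norm p powi tri n * 1 powi n)" for n
      using mult_left_mono[OF C(2)[of n], of "norm p powi tri n"] by (simp add: norm_mult norm_tc mult.commute)
  qed (use p1 in auto)
  then show ?thesis
  proof (rule laurent_cong)
    fix x :: complex assume x: "x \<noteq> 0"
    \<comment> \<open>Euler's expansion is the case a = 0 of the 1phi1 summation.\<close>
    have "(\<lambda>n. qpoch 0 p n * (- x) ^ n * p ^ (n choose 2) / (qpoch p p n * qpoch (0 * x) p n))
      sums (qpoch_inf x p / qpoch_inf (0 * x) p)"
      by (rule phi_1_1_sums) simp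
    moreover have "qpoch 0 p n = 1" for n by (simp add: qpoch_def)
    moreover have "qpoch_inf 0 p = 1" by (simp add: qpoch_inf_def)
    ultimately have "(\<lambda>n. (- x) ^ n * p ^ (n choose 2) / qpoch p p n) sums qpoch_inf x p" by simp
    moreover have "(- x) ^ n * p ^ (n choose 2) / qpoch p p n = tc p (int n) * rq p (int n) * x powi int n" for n
      by (simp add: tc_def tri_of_nat rq_nat power_minus[of x])
    ultimately have 1: "(\<lambda>n. tc p (int n) * rq p (int n) * x powi int n) sums qpoch_inf x p" by simp
    have "(\<lambda>n. tc p (int n) * rq p (int n) * x powi int n + tc p (- 1 - int n) * rq p (- 1 - int n) * x powi (- 1 - int n))
      sums (\<Sum>\<^sub>\<infinity>n. tc p n * rq p n * x powi n)"
      by (rule has_sum_int_imp_sums_pair[OF laurentD[OF L x]])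
    with 1 show "(\<Sum>\<^sub>\<infinity>n. tc p n * rq p n * x powi n) = qpoch_inf x p"
      using sums_unique2 by (fastforce simp: rq_neg)
  qed simp
qed

text \<open>The quasi-period is a first-order recurrence for the coefficients, so its solutions form
  a line. This takes the place of counting zeros of elliptic functions, both for the triple product
  and for the change of parameter in Appell sums.\<close>

lemma index_one_unique:
  assumes D: "laurent d D" and eq: "\<And>x. x \<noteq> 0 \<Longrightarrow> D (p * x) = \<kappa> * D x / x" and k: "\<kappa> \<noteq> 0" and x: "x \<noteq> 0"
  shows "D x = d 0 * theta p (- x / \<kappa>)"
proof -
  have "d n * p powi n = \<kappa> * d (n - (- 1))" for n
    by (rule laurent_unique[OF laurent_scale[OF D p0] laurent_cmult[OF laurent_shift[OF D]]])
      (subst eq, assumption, simp add: power_int_minus divide_inverse mult_ac)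
  then have rec: "d (n + 1) = p powi n * d n / \<kappa>" for n using k by (simp add: field_simps)
  have up: "d n = d 0 * (tc p n * (- 1 / \<kappa>) powi n)" for n
  proof (induction n rule: int_induct[of _ 0])
    case (step1 n)
    then show ?case unfolding rec using k by (simp add: tc_succ power_int_add)
  next
    case (step2 n)
    have "d n = p powi (n - 1) * d (n - 1) / \<kappa>" using rec[of "n - 1"] by simp
    then have "d (n - 1) = p powi (1 - n) * \<kappa> * d n" using p0 k by (simp add: power_int_diff field_simps)
    then show ?case unfolding step2 using k p0 by (simp add: tc_pred power_int_diff field_simps)
  qed simp
  have "laurent (\<lambda>n. d 0 * (tc p n * (- 1 / \<kappa>) powi n)) (\<lambda>x. d 0 * theta p (- 1 / \<kappa> * x))"
    by (intro laurent_cmult laurent_scale theta_laurent) (use k in auto)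
  from laurent_eqI[OF D this up x] show ?thesis by simp
qed

text \<open>By Euler the product D has a Laurent expansion, and it has the quasi-period of theta. The constant d 0 is found from
  the coefficients d (int N) = d 0 * tc p (int N) as N tends to infinity.\<close>

theorem theta_eq_jtheta:
  assumes x: "x \<noteq> 0"
  shows "theta p x = jtheta x p"
proof -
  define c where "c = (\<lambda>n. tc p n * rq p n)"
  define D where "D x = qpoch_inf x p * qpoch_inf (p * inverse x) p" for x
  define d where "d N = (\<Sum>\<^sub>\<infinity>n. c n * (c (- (N - n)) * p powi (- (N - n))))" for N
  have E: "laurent c (\<lambda>x. qpoch_inf x p)" using euler_laurent by (simp add: c_def)
  have dD: "laurent d D"
    unfolding d_def D_def by (rule laurent_mult[OF E laurent_inverse[OF laurent_scale[OF E p0]]])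
  have "D (p * x) = - 1 * D x / x" if "x \<noteq> 0" for x
  proof -
    have r: "(1 - y) * qpoch_inf (p * y) p = qpoch_inf y p" for y
      using qpoch_inf_split_first[OF p1, of y 1] by (simp add: qpoch_Suc)
    have e: "p * inverse (p * x) = inverse x" using p0 by simp
    define X where "X = qpoch_inf (p * x) p * qpoch_inf (p * inverse x) p"
    have 1: "D x = (1 - x) * X" unfolding D_def X_def r[of x, symmetric] by (simp only: mult.assoc)
    have 2: "D (p * x) = (1 - inverse x) * X"
      unfolding D_def X_def e r[of "inverse x", symmetric] by (simp only: mult_ac)
    show ?thesis unfolding 1 2 using that by (simp add: field_simps)
  qed
  from index_one_unique[OF dD this] have D: "D x = d 0 * theta p x" if "x \<noteq> 0" for x using that by simp
  \<comment> \<open>The m-th nonzero term of the convolution for \<open>d (int N)\<close>, divided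
    by \<open>tc p (int N)\<close>. For m > 0 the factor \<open>(p ^ m) ^ N\<close> tends to 0, and
    the term m = 0 tends to 1/(p;p)_infinity.\<close>
  define t where "t N m = tc p (int m) ^ 2 * p ^ m * (p ^ m) ^ N * (rq p (int (m + N)) * rq p (int m))" for N m
  obtain C where C: "C > 0" "\<And>k. norm (rq p k) \<le> C" using rq_bounded by blast
  have t_le: "norm (t N m) \<le> (C * C) * norm p ^ m * (norm p ^ m) ^ N" for N m
  proof -
    have "norm (tc p (int m)) ^ 2 \<le> 1"
      unfolding norm_tc by (intro power_le_one power_int_le_one) (use p1 tri_nonneg in auto)
    then have "norm (t N m) \<le> 1 * norm p ^ m * (norm p ^ m) ^ N * (C * C)"
      unfolding t_def norm_mult norm_power by (intro mult_mono C mult_nonneg_nonneg) (use C(1) in auto)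
    then show ?thesis by (simp add: mult_ac)
  qed
  have M_sum: "summable (\<lambda>m. (C * C) * norm p ^ m)"
    by (intro summable_mult summable_geometric) (use p1 in simp)
  have t_bd: "norm (t N m) \<le> (C * C) * norm p ^ m" for N m
  proof -
    have "(norm p ^ m) ^ N \<le> 1" by (intro power_le_one) (use p1 in auto)
    then have "(C * C) * norm p ^ m * (norm p ^ m) ^ N \<le> (C * C) * norm p ^ m"
      using C(1) by (intro mult_left_le) auto
    then show ?thesis using t_le[of N m] by linarith
  qed
  have t_sums: "t N sums d 0" for N
  proof -
    have "laurent (\<lambda>n. d 0 * tc p n) (\<lambda>x. d 0 * theta p x)" by (intro laurent_cmult theta_laurent)
    from laurent_unique[OF dD this D] have dN: "d (int N) = d 0 * tc p (int N)" .
    define F where "F n = c n * (c (- (int N - n)) * p powi (- (int N - n)))" for n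
    have F1: "F (int (m + N)) = tc p (int N) * t N m" for m
    proof -
      have "- (int N - int (m + N)) = int m" by simp
      moreover have "tc p (int (m + N)) = tc p (int m) * tc p (int N) * (p ^ m) ^ N"
        using tc_add[of "int m" "int N"] by (simp add: power_int_mult)
      ultimately show ?thesis
        unfolding F_def t_def c_def by (simp only: power_int_of_nat power2_eq_square mult_ac)
    qed
    have F2: "F n = 0" if "n \<notin> range (\<lambda>m. int (m + N))" for n
    proof -
      have "n < int N"
      proof (rule ccontr)
        assume "\<not> n < int N"
        then have "n = int (nat (n - int N) + N)" by simp
        with that show False by blast
      qed
      then show ?thesis by (simp add: F_def c_def rq_neg)
    qed
    have "summable (\<lambda>m. norm (t N m))" by (rule summable_comparison_test'[OF M_sum, of 0]) (use t_bd in simp)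
    then have hs: "(t N has_sum (\<Sum>m. t N m)) UNIV"
      using norm_summable_imp_has_sum summable_sums summable_norm_cancel by blast
    have "d (int N) = infsum F UNIV" unfolding d_def F_def ..
    also have "\<dots> = infsum F (range (\<lambda>m. int (m + N)))"
      by (rule infsum_cong_neutral) (use F2 in auto)
    also have "\<dots> = (\<Sum>\<^sub>\<infinity>m. tc p (int N) * t N m)"
      by (subst infsum_reindex) (auto simp: inj_on_def o_def F1[simplified])
    also have "\<dots> = tc p (int N) * (\<Sum>m. t N m)"
      unfolding infsum_cmult_right' infsumI[OF hs] ..
    finally have "d 0 = (\<Sum>m. t N m)"
      unfolding dN using tc_nonzero[of "int N"] by (simp add: mult.commute)
    then show ?thesis using has_sum_imp_sums[OF hs] by simp
  qed
  have "(\<lambda>N. \<Sum>m. t N m) \<longlonglongrightarrow> (\<Sum>m. if m = 0 then 1 / qpoch_inf p p else 0)"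
  proof (rule tannerys_theorem[where M = "\<lambda>m. (C * C) * norm p ^ m", THEN conjunct2, THEN conjunct2])
    fix m
    show "(\<lambda>N. t N m) \<longlonglongrightarrow> (if m = 0 then 1 / qpoch_inf p p else 0)"
    proof (cases "m = 0")
      case True
      have "(\<lambda>N. 1 / qpoch p p N) \<longlonglongrightarrow> 1 / qpoch_inf p p"
        by (intro tendsto_divide tendsto_const qpoch_tendsto p1 qpoch_inf_nonzero')
      with True show ?thesis by (simp add: t_def rq_nat)
    next
      case False
      have "(\<lambda>N. (C * C) * norm p ^ m * (norm p ^ m) ^ N) \<longlonglongrightarrow> (C * C) * norm p ^ m * 0"
        by (intro tendsto_mult tendsto_const LIMSEQ_power_zero) (use False p1 in \<open>auto simp: power_less_one_iff\<close>)
      then have lim: "(\<lambda>N. (C * C) * norm p ^ m * (norm p ^ m) ^ N) \<longlonglongrightarrow> 0" by simp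
      have "eventually (\<lambda>N. norm (t N m) \<le> (C * C) * norm p ^ m * (norm p ^ m) ^ N) sequentially"
        by (intro always_eventually allI t_le)
      then have "(\<lambda>N. t N m) \<longlonglongrightarrow> 0" using lim by (rule Lim_null_comparison)
      with False show ?thesis by simp
    qed
  qed (use M_sum t_bd in \<open>auto intro: always_eventually\<close>)
  moreover have "(\<Sum>m. t N m) = d 0" for N using t_sums[of N] by (simp add: sums_iff)
  moreover have "(\<Sum>m::nat. if m = 0 then 1 / qpoch_inf p p else 0) = 1 / qpoch_inf p p"
    by (rule sums_unique[symmetric], rule sums_single)
  ultimately have "d 0 = 1 / qpoch_inf p p" by (simp add: LIMSEQ_const_iff)
  then have "D x = theta p x / qpoch_inf p p" using D[OF x] by simp
  moreover have "jtheta x p = D x * qpoch_inf p p" by (simp add: D_def jtheta_def divide_inverse)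
  ultimately show ?thesis using qpoch_inf_nonzero'[OF p1 p1] by simp
qed

section \<open>Theta functions divided by one of their linear factors\<close>

text \<open>The Laurent coefficients of theta p y / (1 - y), whose singularity at y = 1 is removable.\<close>

definition sig :: "int \<Rightarrow> complex" where
  "sig i = (-1) powi i * (\<Sum>l. (-1) ^ l * p powi tri (\<bar>i\<bar> + int l + 1))"

lemma sig_aux_bound: "norm ((-1) ^ l * p powi tri (m + int l + 1)) \<le> norm p powi tri (m + 1) * norm p ^ l"
  if "m \<ge> 0"
proof -
  have "tri (m + int l + 1) = tri (m + 1) + tri (int l) + (m + 1) * int l"
    using tri_add[of "m + 1" "int l"] by (simp add: algebra_simps)
  moreover have "(m + 1) * int l \<ge> int l" using that by (simp add: algebra_simps)
  ultimately have "tri (m + int l + 1) \<ge> tri (m + 1) + int l" using tri_nonneg[of "int l"] by linarith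
  then have "norm p powi tri (m + int l + 1) \<le> norm p powi (tri (m + 1) + int l)"
    by (intro power_int_decreasing) (use p0 p1 in auto)
  also have "\<dots> = norm p powi tri (m + 1) * norm p ^ l" using p0 by (simp add: power_int_add)
  finally show ?thesis by (simp add: norm_mult norm_power norm_power_int)
qed

lemma sig_summable: "m \<ge> 0 \<Longrightarrow> summable (\<lambda>l. (-1) ^ l * p powi tri (m + int l + 1))"
proof (rule summable_comparison_test'[of "\<lambda>l. norm p powi tri (m + 1) * norm p ^ l" 0])
  show "summable (\<lambda>l. norm p powi tri (m + 1) * norm p ^ l)"
    by (intro summable_mult summable_geometric) (use p1 in auto)
qed (use sig_aux_bound in auto)

lemma tri_le_abs: "tri i \<le> tri (\<bar>i\<bar> + 1)"
  using two_tri[of i] two_tri[of "\<bar>i\<bar> + 1"] by (cases "i \<ge> 0") (auto simp: algebra_simps)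

lemma norm_sig_le: "norm (sig i) \<le> 1 / (1 - norm p) * norm p powi tri (\<bar>i\<bar> + 1)"
proof -
  have "norm (\<Sum>l. (-1) ^ l * p powi tri (\<bar>i\<bar> + int l + 1)) \<le> (\<Sum>l. norm p powi tri (\<bar>i\<bar> + 1) * norm p ^ l)"
    by (rule norm_suminf_le) (use sig_aux_bound p1 in \<open>auto intro!: summable_mult summable_geometric\<close>)
  also have "\<dots> = norm p powi tri (\<bar>i\<bar> + 1) * (1 / (1 - norm p))"
    by (subst suminf_mult) (use p1 in \<open>auto simp: suminf_geometric summable_geometric\<close>)
  finally show ?thesis by (simp add: sig_def norm_mult norm_power_int mult.commute)
qed

text \<open>\<open>sig i\<close> is the sum of \<open>tc p k\<close> over k at most i. All
  \<open>tc p k\<close> add up to \<open>theta p 1 = 0\<close>, so this is also minus the sum over k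
  > i; the symmetry of \<open>tri\<close> under i -> 1 - i lets one formula in the absolute value of
  i cover the fast converging version on both sides.\<close>

lemma sig_diff: "sig i - sig (i - 1) = tc p i"
proof -
  define T where "T m = (\<Sum>l. (-1) ^ l * p powi tri (m + int l + 1))" for m
  have T: "T m = p powi tri (m + 1) - T (m + 1)" if "m \<ge> 0" for m
  proof -
    have "T m = (\<Sum>l. (-1) ^ Suc l * p powi tri (m + int (Suc l) + 1)) + (-1) ^ 0 * p powi tri (m + int 0 + 1)"
      unfolding T_def using suminf_split_head[OF sig_summable[OF that]] by simp
    also have "(\<lambda>l. (-1) ^ Suc l * p powi tri (m + int (Suc l) + 1)) = (\<lambda>l. - ((-1) ^ l * p powi tri (m + 1 + int l + 1)))"
      by (simp add: fun_eq_iff add_ac)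
    also have "suminf \<dots> = - T (m + 1)"
      unfolding T_def by (rule suminf_minus[OF sig_summable]) (use that in auto)
    finally show ?thesis by simp
  qed
  have s: "sig i = (-1) powi i * T \<bar>i\<bar>" for i by (simp add: sig_def T_def)
  have e: "(-1) powi (i - 1) = - ((-1) powi i :: complex)" by (simp add: power_int_diff)
  show ?thesis
  proof (cases "i \<ge> 1")
    case True
    have "p powi tri i = T (i - 1) + T i" using T[of "i - 1"] True by simp
    with True show ?thesis unfolding s e tc_def by (simp add: algebra_simps)
  next
    case False
    have "tri (1 - i) = tri i" using tri_succ[of "- i"] tri_minus[of i] by simp
    then have "p powi tri i = T (- i) + T (1 - i)" using T[of "- i"] False by simp
    with False show ?thesis unfolding s e tc_def by (simp add: algebra_simps)
  qed
qed

definition rho :: "complex \<Rightarrow> complex" where "rho y = (\<Sum>\<^sub>\<infinity>i. sig i * y powi i)"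

lemma rho_laurent: "laurent sig rho"
  unfolding rho_def[abs_def]
proof (rule laurent_I_bound)
  fix i
  have "norm p powi tri (\<bar>i\<bar> + 1) \<le> norm p powi tri i"
    by (intro power_int_decreasing tri_le_abs) (use p0 p1 in auto)
  then have "1 / (1 - norm p) * norm p powi tri (\<bar>i\<bar> + 1) \<le> 1 / (1 - norm p) * norm p powi tri i"
    by (intro mult_left_mono) (use p1 in auto)
  then show "norm (sig i) \<le> 1 / (1 - norm p) * (norm p powi tri i * 1 powi i)"
    using norm_sig_le[of i] by simp
qed (use p1 in auto)

lemma rho_mult: "y \<noteq> 0 \<Longrightarrow> (1 - y) * rho y = theta p y"
proof -
  assume y: "y \<noteq> 0"
  have "rho y - y powi 1 * rho y = theta p y"
    by (rule laurent_eqI[OF laurent_diff[OF rho_laurent laurent_shift[OF rho_laurent]] theta_laurent _ y])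
      (rule sig_diff)
  then show ?thesis by (simp add: algebra_simps)
qed

text \<open>Off y = 1 the triple product gives \<open>rho\<close> as theta without its factor 1 - y.
  Both expressions are continuous at 1, and setting y = 1 leaves three equal products.\<close>

lemma rho_one: "rho 1 = qpoch_inf p p ^ 3"
proof -
  define R where "R y = qpoch_inf (p * y) p * qpoch_inf (p * inverse y) p * qpoch_inf p p" for y
  have c: "isCont (\<lambda>x. qpoch_inf x p) x" if "x \<noteq> 0" for x
    by (rule laurent_continuous[OF euler_laurent that])
  have "isCont (\<lambda>y. qpoch_inf (p * y) p) 1"
    by (rule isCont_o2[where g = "\<lambda>x. qpoch_inf x p"]) (use c p0 in \<open>auto intro!: continuous_intros\<close>)
  moreover have "isCont (\<lambda>y. qpoch_inf (p * inverse y) p) 1"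
    by (rule isCont_o2[where g = "\<lambda>x. qpoch_inf x p"]) (use c p0 in \<open>auto intro!: continuous_intros\<close>)
  ultimately have "isCont R 1" unfolding R_def[abs_def] by (intro continuous_intros)
  then have R: "(R \<longlongrightarrow> R 1) (at 1)" by (simp add: isCont_def)
  have "isCont rho 1" by (rule laurent_continuous[OF rho_laurent]) simp
  then have r: "(rho \<longlongrightarrow> rho 1) (at 1)" by (simp add: isCont_def)
  have eq: "R y = rho y" if "y \<noteq> 0" "y \<noteq> 1" for y
  proof -
    have "(1 - y) * rho y = qpoch_inf y p * qpoch_inf (p / y) p * qpoch_inf p p"
      using rho_mult[OF that(1)] theta_eq_jtheta[OF that(1)] by (simp add: jtheta_def)
    moreover have "qpoch_inf y p = (1 - y) * qpoch_inf (p * y) p"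
      using qpoch_inf_split_first[OF p1, of y 1] by (simp add: qpoch_Suc)
    ultimately show ?thesis using that by (simp add: R_def divide_inverse)
  qed
  have "eventually (\<lambda>y::complex. y \<noteq> 0) (at 1)"
    using t1_space_nhds[of "1::complex" 0] by (simp add: eventually_at_filter eventually_mono)
  moreover have "eventually (\<lambda>y::complex. y \<noteq> 1) (at 1)" by (simp add: eventually_at_filter)
  ultimately have "eventually (\<lambda>y. R y = rho y) (at 1)"
    by eventually_elim (rule eq)
  then have "(rho \<longlongrightarrow> R 1) (at 1)" by (rule Lim_transform_eventually[OF R])
  with r have "rho 1 = R 1" using tendsto_unique[of "at (1::complex)"] by auto
  then show ?thesis by (simp add: R_def power3_eq_cube)
qed

text \<open>The holomorphic continuation of theta p y / (1 - p powi n * y). Multiplying an Appell-Lerch sum by a theta function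
  therefore gives a Laurent series on the whole punctured plane, to which uniqueness of coefficients applies.\<close>

definition tfrac :: "int \<Rightarrow> complex \<Rightarrow> complex" where
  "tfrac n y = tc p n * y powi n * rho (p powi n * y)"

lemma tfrac_mult:
  assumes "y \<noteq> 0"
  shows "(1 - p powi n * y) * tfrac n y = theta p y"
proof -
  have "(1 - p powi n * y) * tfrac n y = tc p n * y powi n * ((1 - p powi n * y) * rho (p powi n * y))"
    by (simp add: tfrac_def mult_ac)
  also have "\<dots> = tc p n * y powi n * theta p (p powi n * y)"
    using rho_mult[of "p powi n * y"] p0 assms by simp
  also have "\<dots> = theta p y"
    unfolding theta_powi_mult[OF assms] using tc_nonzero[of n] assms by simp
  finally show ?thesis .
qed

lemma tfrac_eq: "y \<noteq> 0 \<Longrightarrow> p powi n * y \<noteq> 1 \<Longrightarrow> tfrac n y = theta p y / (1 - p powi n * y)"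
  using tfrac_mult[of y n] by (simp add: field_simps)

lemma tfrac_powi_mult: "y \<noteq> 0 \<Longrightarrow> tfrac n (p powi m * y) = tfrac (n + m) y / (tc p m * y powi m)"
proof -
  assume y: "y \<noteq> 0"
  have h1: "(p powi m * y) powi n = p powi (n * m) * y powi n"
    by (simp add: power_int_mult_distrib power_int_mult mult.commute[of n])
  have h2: "p powi n * (p powi m * y) = p powi (n + m) * y" using p0 by (simp add: power_int_add)
  have "tfrac n (p powi m * y) = tc p n * (p powi (n * m) * y powi n) * rho (p powi (n + m) * y)"
    unfolding tfrac_def h1 h2 ..
  then show ?thesis
    unfolding tfrac_def tc_add using y tc_nonzero[of m] by (simp add: power_int_add)
qed

definition tfrac_coeff where "tfrac_coeff n i = tc p n * (sig (i - n) * (p powi n) powi (i - n))"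

lemma tfrac_laurent: "laurent (tfrac_coeff n) (tfrac n)"
proof -
  have "laurent (tfrac_coeff n) (\<lambda>y. tc p n * (y powi n * rho (p powi n * y)))"
    unfolding tfrac_coeff_def[abs_def]
    by (intro laurent_cmult laurent_shift[where c = "\<lambda>i. sig i * (p powi n) powi i" for n] laurent_scale rho_laurent) (use p0 in auto)
  then show ?thesis unfolding tfrac_def[abs_def] by (simp add: mult.assoc)
qed

text \<open>The point is uniformity in n: wherever the removed pole lies, the coefficients obey the
  Gaussian bound of theta itself.\<close>

lemma norm_tfrac_coeff_le: "norm (tfrac_coeff n i) \<le> 1 / (1 - norm p) * norm p powi tri i"
proof -
  define d where "d = i - n"
  have "norm (tfrac_coeff n i) = norm p powi tri n * (norm (sig d) * norm p powi (n * d))"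
    by (simp add: tfrac_coeff_def d_def norm_mult norm_tc norm_power_int power_int_mult)
  also have "\<dots> \<le> norm p powi tri n * (1 / (1 - norm p) * norm p powi tri (\<bar>d\<bar> + 1) * norm p powi (n * d))"
    by (intro mult_left_mono mult_right_mono norm_sig_le) auto
  also have "\<dots> = 1 / (1 - norm p) * norm p powi (tri n + tri (\<bar>d\<bar> + 1) + n * d)"
    using p0 by (simp add: power_int_add)
  also have "\<dots> \<le> 1 / (1 - norm p) * norm p powi tri i"
  proof (intro mult_left_mono power_int_decreasing)
    have "tri i = tri n + tri d + n * d" using tri_add[of n d] by (simp add: d_def)
    then show "tri i \<le> tri n + tri (\<bar>d\<bar> + 1) + n * d" using tri_le_abs[of d] by linarith
  qed (use p0 p1 in auto)
  finally show ?thesis .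
qed

text \<open>Because the coefficient bound is uniform, the positions \<open>nk\<close> of the poles
  may be arbitrary. They are k - 1 for Appell sums, and 5 k - 8 + a where weights of base p^10 are
  combined with a theta function of base p^2.\<close>

lemma tfrac_sum:
  assumes w: "(\<lambda>k::int. norm (w k)) summable_on UNIV"
  shows "laurent (\<lambda>i. \<Sum>\<^sub>\<infinity>k. w k * tfrac_coeff (nk k) i) (\<lambda>y. \<Sum>\<^sub>\<infinity>k. w k * tfrac (nk k) y)"
    and "y \<noteq> 0 \<Longrightarrow> ((\<lambda>k. w k * tfrac (nk k) y) has_sum (\<Sum>\<^sub>\<infinity>k. w k * tfrac (nk k) y)) UNIV"
proof -
  have *: "((\<lambda>i. (\<Sum>\<^sub>\<infinity>k. w k * tfrac_coeff (nk k) i) * y powi i) has_sum (\<Sum>\<^sub>\<infinity>k. w k * tfrac (nk k) y)) UNIV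
    \<and> ((\<lambda>k. w k * tfrac (nk k) y) has_sum (\<Sum>\<^sub>\<infinity>k. w k * tfrac (nk k) y)) UNIV" if y: "y \<noteq> 0" for y
  proof -
    define C where "C = 1 / (1 - norm p)"
    define g where "g = (\<lambda>(k, i). w k * (tfrac_coeff (nk k) i * y powi i))"
    have b: "norm (g (k, i)) \<le> norm (w k) * (C * (norm p powi tri i * norm y powi i))" for k i
    proof -
      have "norm (tfrac_coeff (nk k) i) * norm y powi i \<le> C * norm p powi tri i * norm y powi i"
        unfolding C_def by (intro mult_right_mono norm_tfrac_coeff_le) auto
      then show ?thesis
        unfolding g_def prod.case norm_mult norm_power_int by (intro mult_left_mono) (auto simp: mult.assoc)
    qed
    have "(\<lambda>(k, i). norm (w k) * (C * (norm p powi tri i * norm y powi i))) summable_on UNIV \<times> UNIV"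
      by (intro summable_on_times_product w summable_on_cmult_right summable_tri)
        (use p1 y in \<open>auto simp: C_def\<close>)
    then have gs: "g summable_on UNIV \<times> UNIV"
      by (rule abs_summable_summable[OF summable_on_comparison_test]) (use b in auto)
    then obtain S where S: "(g has_sum S) (UNIV \<times> UNIV)" by (auto simp: summable_on_def)
    have 1: "((\<lambda>k. w k * tfrac (nk k) y) has_sum S) UNIV"
    proof (rule has_sum_SigmaD[OF S])
      show "((\<lambda>i. g (k, i)) has_sum (w k * tfrac (nk k) y)) UNIV" for k
        unfolding g_def prod.case by (intro has_sum_cmult_right laurentD[OF tfrac_laurent y])
    qed
    have S': "((\<lambda>(i, k). g (k, i)) has_sum S) (UNIV \<times> UNIV)"
      using S has_sum_swap[where f = g and S = S and A = UNIV and B = UNIV] by simp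
    have 2: "((\<lambda>i. (\<Sum>\<^sub>\<infinity>k. w k * tfrac_coeff (nk k) i) * y powi i) has_sum S) UNIV"
    proof (rule has_sum_SigmaD[OF S'])
      fix i :: int
      have "(\<lambda>k. norm (w k) * C * norm p powi tri i) summable_on UNIV"
        by (intro summable_on_cmult_left w)
      then have "(\<lambda>k. w k * tfrac_coeff (nk k) i) summable_on UNIV"
      proof (rule abs_summable_summable[OF summable_on_comparison_test])
        show "norm (w k * tfrac_coeff (nk k) i) \<le> norm (w k) * C * norm p powi tri i" for k
          using mult_left_mono[OF norm_tfrac_coeff_le[of "nk k" i], of "norm (w k)"] by (simp add: norm_mult C_def)
      qed auto
      then have "((\<lambda>k. w k * tfrac_coeff (nk k) i * y powi i) has_sum ((\<Sum>\<^sub>\<infinity>k. w k * tfrac_coeff (nk k) i) * y powi i)) UNIV"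
        by (intro has_sum_cmult_left has_sum_infsum)
      then show "((\<lambda>k. case (i, k) of (i, k) \<Rightarrow> g (k, i)) has_sum ((\<Sum>\<^sub>\<infinity>k. w k * tfrac_coeff (nk k) i) * y powi i)) UNIV"
        by (simp add: g_def mult.assoc)
    qed
    have "(\<Sum>\<^sub>\<infinity>k. w k * tfrac (nk k) y) = S" using 1 by (rule infsumI)
    with 1 2 show ?thesis by simp
  qed
  show "laurent (\<lambda>i. \<Sum>\<^sub>\<infinity>k. w k * tfrac_coeff (nk k) i) (\<lambda>y. \<Sum>\<^sub>\<infinity>k. w k * tfrac (nk k) y)"
    unfolding laurent_def using * by blast
  show "((\<lambda>k. w k * tfrac (nk k) y) has_sum (\<Sum>\<^sub>\<infinity>k. w k * tfrac (nk k) y)) UNIV" if "y \<noteq> 0"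
    using *[OF that] by blast
qed

section \<open>Appell sums and their quasi-period\<close>

lemma theta_has_sum: "z \<noteq> 0 \<Longrightarrow> ((\<lambda>k. tc p k * z powi k) has_sum theta p z) UNIV"
  by (rule laurentD[OF theta_laurent])

lemma theta_abs_summable: "z \<noteq> 0 \<Longrightarrow> (\<lambda>k. norm (tc p k * z powi k)) summable_on UNIV"
  using has_sum_imp_summable[OF theta_has_sum] by (simp add: summable_on_iff_abs_summable_on_complex)

definition appell_theta :: "complex \<Rightarrow> complex \<Rightarrow> complex" where
  "appell_theta z y = (\<Sum>\<^sub>\<infinity>k. tc p k * z powi k * tfrac (k - 1) y)"

text \<open>The series of m(u, p, z) before division by theta, with y standing for u z.\<close>

definition appell :: "complex \<Rightarrow> complex \<Rightarrow> complex" where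
  "appell z y = (\<Sum>\<^sub>\<infinity>k. tc p k * z powi k / (1 - p powi (k - 1) * y))"

lemma appell_theta_eq_appell:
  assumes "y \<noteq> 0" "\<And>k. p powi k * y \<noteq> 1"
  shows "appell_theta z y = theta p y * appell z y"
  unfolding appell_theta_def appell_def infsum_cmult_right'[symmetric]
  by (intro infsum_cong) (simp add: tfrac_eq assms)

text \<open>After shifting the summation index, the terms at p y and at y differ by w(k - 1) (1 -
  p^(k-1) y) \<open>tfrac (k - 1) y\<close>, up to the factor -1/y. There the denominator is gone,
  and the sum over k is a product of two theta functions.\<close>

lemma appell_theta_p_mult:
  assumes z: "z \<noteq> 0" and y: "y \<noteq> 0"
  shows "appell_theta z (p * y) = appell_theta z y / z - theta p y * theta p z / y"
proof -
  define w where "w k = tc p k * z powi k" for k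
  have s: "((\<lambda>k. w k * tfrac (k - 1) y) has_sum appell_theta z y) UNIV" if "y \<noteq> 0" for y
    using tfrac_sum(2)[OF theta_abs_summable[OF z] that, of "\<lambda>k. k - 1"] by (simp add: appell_theta_def w_def)
  have 1: "((\<lambda>k. w k * tfrac (k - 1) y / z) has_sum (appell_theta z y / z)) UNIV"
    using has_sum_cmult_left[OF s[OF y], of "1 / z"] by simp
  have "((\<lambda>k. w k) has_sum theta p z) UNIV" using theta_has_sum[OF z] by (simp add: w_def)
  then have "((\<lambda>k. theta p y / y * w k) has_sum (theta p y / y * theta p z)) UNIV"
    by (rule has_sum_cmult_right)
  then have "((\<lambda>k. theta p y / y * w (k - 1)) has_sum (theta p y / y * theta p z)) UNIV"
    using has_sum_reindex_bij_witness[of UNIV "\<lambda>k. k + 1" "\<lambda>k. k - 1" UNIV "\<lambda>k. theta p y / y * w k" "\<lambda>k. theta p y / y * w (k - 1)"]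
    by simp
  from has_sum_add[OF 1 has_sum_uminusI[OF this]]
  have 2: "((\<lambda>k. w k * tfrac (k - 1) y / z - theta p y / y * w (k - 1)) has_sum (appell_theta z y / z - theta p y / y * theta p z)) UNIV"
    by simp
  have "((\<lambda>k. w (k - 1) * tfrac (k - 2) (p * y)) has_sum appell_theta z (p * y)) UNIV"
    using s[of "p * y"] p0 y has_sum_reindex_bij_witness[of UNIV "\<lambda>k. k + 1" "\<lambda>k. k - 1" UNIV "\<lambda>k. w k * tfrac (k - 1) (p * y)" "\<lambda>k. w (k - 1) * tfrac (k - 2) (p * y)"]
    by (simp add: algebra_simps)
  moreover have "w (k - 1) * tfrac (k - 2) (p * y) = w k * tfrac (k - 1) y / z - theta p y / y * w (k - 1)" for k
  proof -
    have 1: "tfrac (k - 2) (p * y) = - tfrac (k - 1) y / y"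
      using tfrac_powi_mult[OF y, of "k - 2" 1] by simp
    have 2: "w k = - (p powi (k - 1)) * z * w (k - 1)"
      using tc_succ[of "k - 1"] z by (simp add: w_def power_int_diff)
    show ?thesis unfolding 1 2 tfrac_mult[OF y, of "k - 1", symmetric] using y z by (simp add: field_simps)
  qed
  ultimately have "((\<lambda>k. w k * tfrac (k - 1) y / z - theta p y / y * w (k - 1)) has_sum appell_theta z (p * y)) UNIV" by simp
  with 2 show ?thesis using has_sum_unique by fastforce
qed

text \<open>Theta vanishes at 1, so only the term whose own pole lies there survives, namely k = 1;
  its value is \<open>rho 1\<close>.\<close>

lemma appell_theta_one: assumes z: "z \<noteq> 0" shows "appell_theta z 1 = - z * qpoch_inf p p ^ 3"
proof -
  have "tfrac n 1 = 0" if "n \<noteq> 0" for n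
  proof -
    have "p powi n \<noteq> 1"
    proof (cases "n > 0")
      case True
      then show ?thesis using p_pow_neq_1[of "nat n"] by (simp add: power_int_def)
    next
      case False
      then show ?thesis using p_pow_neq_1[of "nat (- n)"] that by (simp add: power_int_def power_inverse)
    qed
    then show ?thesis using tfrac_mult[of 1 n] by simp
  qed
  then have "((\<lambda>k. tc p k * z powi k * tfrac (k - 1) 1) has_sum (tc p 1 * z powi 1 * tfrac (1 - 1) 1)) UNIV"
    by (intro has_sum_finite_neutralI[of "{1}"]) auto
  then have "appell_theta z 1 = tc p 1 * z powi 1 * tfrac (1 - 1) 1" unfolding appell_theta_def by (rule infsumI)
  then show ?thesis by (simp add: tfrac_def rho_one)
qed

end

text \<open>Folds a two-sided series along n -> - 2 - n, the symmetry of \<open>Gint\<close>. The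
  fixed point - 1 would be left over, whence the second assumption.\<close>

lemma has_sum_int_split:
  fixes f :: "int \<Rightarrow> complex"
  assumes "(f has_sum S) UNIV" "f (- 1) = 0"
  shows "(\<lambda>n. f (int n) + f (- 2 - int n)) sums S"
proof -
  have sm: "f summable_on X" for X
    using summable_on_subset_banach[OF has_sum_imp_summable[OF assms(1)]] by auto
  have "(f \<circ> int) summable_on UNIV" "(f \<circ> (\<lambda>n. - 1 - int n)) summable_on UNIV"
    by (auto simp: summable_on_reindex[symmetric] inj_def sm)
  then obtain a b where ab: "((\<lambda>n. f (int n)) has_sum a) UNIV" "((\<lambda>n. f (- 1 - int n)) has_sum b) UNIV"
    unfolding summable_on_def o_def by blast
  have S: "S = a + b" using has_sum_unique[OF assms(1) has_sum_int_nat[OF ab]] .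
  have "(\<lambda>n. f (- 1 - int (Suc n))) sums b"
    using has_sum_imp_sums[OF ab(2)] assms(2) sums_Suc_iff[of "\<lambda>n. f (- 1 - int n)" b] by simp
  moreover have "- 1 - int (Suc n) = - 2 - int n" for n by simp
  ultimately have "(\<lambda>n. f (- 2 - int n)) sums b" by (simp only:)
  then show ?thesis unfolding S by (rule sums_add[OF has_sum_imp_sums[OF ab(1)]])
qed

context nome
begin

lemma appell_theta_laurent: "z \<noteq> 0 \<Longrightarrow> \<exists>c. laurent c (appell_theta z)"
  using tfrac_sum(1)[OF theta_abs_summable, of z "\<lambda>k. k - 1"] unfolding appell_theta_def[abs_def] by blast

lemma theta_quotient_swap: "z0 \<noteq> 0 \<Longrightarrow> z1 \<noteq> 0 \<Longrightarrow> - z1 * theta p (z0 / z1) = z0 * theta p (z1 / z0)"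
  using theta_inverse[of "z1 / z0"] by simp

text \<open>Changing the parameter z of an Appell-Lerch sum: after clearing denominators the difference is a Laurent series
  with the quasi-period of a single theta function, hence a multiple of it; the factor is read off at x = 1 / z1.\<close>

lemma two_pole:
  assumes z0: "z0 \<noteq> 0" and z1: "z1 \<noteq> 0" and x: "x \<noteq> 0" and nz: "theta p z0 \<noteq> 0"
  shows "theta p z0 * theta p (x * z0) * appell_theta z1 (x * z1) - theta p z1 * theta p (x * z1) * appell_theta z0 (x * z0)
    = z0 * qpoch_inf p p ^ 3 * theta p (z1 / z0) * theta p (x * z0 * z1)"
proof -
  define D where "D x = theta p z0 * (theta p (z0 * x) * appell_theta z1 (z1 * x)) - theta p z1 * (theta p (z1 * x) * appell_theta z0 (z0 * x))" for x
  have "\<exists>d. laurent d D"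
  proof -
    obtain c0 c1 where c: "laurent c0 (appell_theta z0)" "laurent c1 (appell_theta z1)" using appell_theta_laurent z0 z1 by metis
    note a = laurent_mult[OF laurent_scale[OF theta_laurent z0] laurent_scale[OF c(2) z1]]
    note b = laurent_mult[OF laurent_scale[OF theta_laurent z1] laurent_scale[OF c(1) z0]]
    note ab = laurent_diff[OF laurent_cmult[OF a, of "theta p z0"] laurent_cmult[OF b, of "theta p z1"]]
    show ?thesis unfolding D_def[abs_def] by (intro exI) (rule ab)
  qed
  then obtain d where d: "laurent d D" ..
  have "D (p * x) = - 1 / (z0 * z1) * D x / x" if x: "x \<noteq> 0" for x
  proof -
    have t: "theta p (z * (p * x)) = - theta p (z * x) / (z * x)"
      "appell_theta z (z * (p * x)) = appell_theta z (z * x) / z - theta p (z * x) * theta p z / (z * x)" if "z \<noteq> 0" for z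
      using theta_p_mult[of "z * x"] appell_theta_p_mult[of z "z * x"] x that by (simp_all add: mult.left_commute)
    show ?thesis
      unfolding D_def t[OF z0] t[OF z1] using z0 z1 x by (simp add: field_simps)
  qed
  from index_one_unique[OF d this] have D: "D x = d 0 * theta p (z0 * z1 * x)" if "x \<noteq> 0" for x
    using z0 z1 that by (simp add: mult_ac)
  \<comment> \<open>At this point \<open>theta p (z1 * x)\<close> vanishes and
    \<open>appell_theta z1\<close> is evaluated at 1, where it is explicit.\<close>
  have "D (1 / z1) = theta p z0 * theta p (z0 / z1) * (- z1 * qpoch_inf p p ^ 3)"
    using z1 z0 by (simp add: D_def appell_theta_one)
  moreover have "D (1 / z1) = d 0 * theta p z0" using D[of "1 / z1"] z1 z0 by simp
  ultimately have "d 0 * theta p z0 = ((- z1 * theta p (z0 / z1)) * qpoch_inf p p ^ 3) * theta p z0"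
    by (simp add: mult_ac)
  then have "d 0 = (- z1 * theta p (z0 / z1)) * qpoch_inf p p ^ 3"
    using nz by (subst (asm) mult_right_cancel)
  then have "d 0 = z0 * theta p (z1 / z0) * qpoch_inf p p ^ 3" by (simp only: theta_quotient_swap[OF z0 z1])
  then show ?thesis using D[OF x] by (simp add: D_def mult_ac)
qed

text \<open>G extended to negative indices so that its recurrence persists.\<close>

definition Gint :: "int \<Rightarrow> complex" where
  "Gint N = (if N \<ge> 0 then G p (nat N) else if N = - 1 then 0 else - (p powi (- N - 1)) * G p (nat (- N - 2)))"

lemma Gint_nat: "Gint (int n) = G p n"
  and Gint_minus_one [simp]: "Gint (- 1) = 0"
  and Gint_neg_nat: "Gint (- 2 - int n) = - (p ^ (n + 1)) * G p n"
proof -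
  show "Gint (int n) = G p n" "Gint (- 1) = 0" by (simp_all add: Gint_def)
  have "p powi (2 + int n - 1) = p ^ (n + 1)" using power_int_of_nat[of p "n + 1"] by (simp add: add.commute)
  then show "Gint (- 2 - int n) = - (p ^ (n + 1)) * G p n" by (simp add: Gint_def)
qed

lemma Gint_rec: "Gint (N + 2) = 2 + p powi (N + 1) * Gint N"
proof -
  consider n where "N = int n" | "N = - 1" | "N = - 2" | "N = - 3" | n where "N = - 4 - int n"
  proof -
    have "N = int (nat N)" if "N \<ge> 0" using that by simp
    moreover have "N = - 4 - int (nat (- N - 4))" if "N \<le> - 4" using that by simp
    moreover have "N \<ge> 0 \<or> N = - 1 \<or> N = - 2 \<or> N = - 3 \<or> N \<le> - 4" by linarith
    ultimately show ?thesis using that by metis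
  qed
  then show ?thesis
  proof cases
    case (1 n)
    have "Gint (N + 2) = G p (n + 2)" using Gint_nat[of "n + 2"] by (simp add: 1 add.commute)
    moreover have "p powi (N + 1) = p ^ (n + 1)" using power_int_of_nat[of p "n + 1"] by (simp add: 1 add.commute)
    ultimately show ?thesis using 1 by (simp only: G_rec Gint_nat)
  next
    case 2
    then show ?thesis using Gint_nat[of 1] by simp
  next
    case 3
    then show ?thesis using Gint_nat[of 0] Gint_neg_nat[of 0] p0 by (simp add: power_int_minus)
  next
    case 4
    then show ?thesis using Gint_neg_nat[of 1] p0 by (simp add: power_int_minus power2_eq_square field_simps)
  next
    case (5 n)
    have "Gint (N + 2) = - (p ^ (n + 1)) * G p n" using Gint_neg_nat[of n] by (simp add: 5)
    moreover have "Gint N = - (p ^ (n + 3)) * (2 + p ^ (n + 1) * G p n)"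
    proof -
      have i: "N = - 2 - int (n + 2)" "n + 2 + 1 = n + 3" by (simp_all add: 5)
      show ?thesis unfolding i(1) Gint_neg_nat G_rec i(2) ..
    qed
    moreover have "p powi (N + 1) = 1 / p ^ (n + 3)"
    proof -
      have "N + 1 = - int (n + 3)" by (simp add: 5)
      then show ?thesis by (simp only: power_int_minus power_int_of_nat inverse_eq_divide)
    qed
    ultimately show ?thesis using p0 by simp
  qed
qed

text \<open>The source of \<open>hecke_reflect\<close>: the index symmetry N -> - 2 - N becomes x ->
  p^3 / x for the generating series.\<close>

lemma Gint_reflect: "Gint (- 2 - N) = - (p powi (N + 1)) * Gint N"
proof -
  consider n where "N = int n" | "N = - 1" | n where "N = - 2 - int n"
  proof -
    have "N = int (nat N)" if "N \<ge> 0" using that by simp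
    moreover have "N = - 2 - int (nat (- N - 2))" if "N \<le> - 2" using that by simp
    moreover have "N \<ge> 0 \<or> N = - 1 \<or> N \<le> - 2" by linarith
    ultimately show ?thesis using that by metis
  qed
  then show ?thesis
  proof cases
    case (1 n)
    have "p powi (N + 1) = p ^ (n + 1)" using power_int_of_nat[of p "n + 1"] by (simp add: 1 add.commute)
    then show ?thesis unfolding 1 Gint_nat Gint_neg_nat by simp
  next
    case (3 n)
    have e: "- 2 - (- 2 - int n) = int n" "N + 1 = - int (n + 1)" by (simp_all add: 3)
    have "p powi (N + 1) = 1 / p ^ (n + 1)"
      unfolding e by (simp only: power_int_minus power_int_of_nat inverse_eq_divide)
    then show ?thesis using p0 unfolding 3 e Gint_nat Gint_neg_nat by simp
  qed simp
qed

section \<open>The Hecke-type series: quasi-period, reflection and uniqueness\<close>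

definition hecke_coeff where "hecke_coeff N = (-1) powi N * p powi (N * N + N) * Gint N"

definition hecke where "hecke x = (\<Sum>\<^sub>\<infinity>N. hecke_coeff N * x powi N)"

lemma sq_tri: "N * N + N = 2 * tri N + 2 * N"
  using two_tri[of N] by (simp add: algebra_simps)

lemma hecke_laurent: "laurent hecke_coeff hecke"
  unfolding hecke_def[abs_def]
proof (rule laurent_I_bound)
  define C where "C = 2 / (1 - norm p)"
  fix N
  have pos: "0 < norm p" "C \<ge> 0" using p0 p1 by (simp_all add: C_def)
  have e: "(norm p ^ 2) powi tri N * norm p powi (N + k) = norm p powi (2 * tri N + N + k)" for k
  proof -
    have "(norm p ^ 2) powi tri N = norm p powi (2 * tri N)" using power_int_power[of "norm p" 2 "tri N"] by simp
    then show ?thesis using pos by (simp add: power_int_add)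
  qed
  \<comment> \<open>The negative half gives precisely this exponent; for N at least 0 the true
    exponent \<open>2 * tri N + 2 * N\<close> is larger.\<close>
  have "norm (hecke_coeff N) \<le> C * norm p powi (2 * tri N + N - 1)"
  proof (cases "N \<ge> 0")
    case True
    then have g: "norm (Gint N) \<le> C" using norm_G_le[of "nat N"] by (simp add: Gint_def C_def)
    have "norm (hecke_coeff N) = norm p powi (2 * tri N + 2 * N) * norm (Gint N)"
      by (simp add: hecke_coeff_def sq_tri norm_mult norm_power_int)
    also have "\<dots> \<le> norm p powi (2 * tri N + N - 1) * C"
      by (intro mult_mono g power_int_decreasing) (use True pos p1 in auto)
    finally show ?thesis by (simp add: mult.commute)
  next
    case False
    have "norm (G p (nat (- N - 2))) \<le> C" unfolding C_def by (rule norm_G_le)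
    then have g: "norm (Gint N) \<le> norm p powi (- N - 1) * C"
      using False pos by (auto simp: Gint_def norm_mult norm_power_int intro!: mult_left_mono)
    have "norm (hecke_coeff N) = norm p powi (2 * tri N + 2 * N) * norm (Gint N)"
      by (simp add: hecke_coeff_def sq_tri norm_mult norm_power_int)
    also have "\<dots> \<le> norm p powi (2 * tri N + 2 * N) * (norm p powi (- N - 1) * C)"
      by (intro mult_left_mono g) auto
    also have "\<dots> = C * norm p powi (2 * tri N + 2 * N + (- N - 1))"
      using pos power_int_add[of "norm p" "2 * tri N + 2 * N" "- N - 1"] by (simp add: mult_ac)
    also have "2 * tri N + 2 * N + (- N - 1) = 2 * tri N + N - 1" by simp
    finally show ?thesis .
  qed
  also have "\<dots> = C / norm p * ((norm p ^ 2) powi tri N * norm p powi N)"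
    using e[of 0] e[of "-1"] pos by (simp add: power_int_diff)
  finally show "norm (hecke_coeff N) \<le> C / norm p * ((norm p ^ 2) powi tri N * norm p powi N)" .
qed (use p0 p1 in \<open>auto simp: power_less_one_iff\<close>)

lemma tc_p2: "tc (p ^ 2) N * (p ^ 2) powi N = (-1) powi N * p powi (N * N + N)"
proof -
  have "(p ^ 2) powi k = p powi (2 * k)" for k using power_int_power[of p 2 k] by simp
  then show ?thesis using p0 by (simp add: tc_def sq_tri power_int_add)
qed

text \<open>In \<open>Gint_rec\<close> the constant 2 contributes the theta function, and the change
  of N^2 + N under N -> N - 2, together with the factor p^(N-1), is the scaling by p^5.\<close>

lemma hecke_rec:
  assumes x: "x \<noteq> 0"
  shows "hecke x = 2 * theta (p ^ 2) (p ^ 2 * x) + p ^ 7 * x ^ 2 * hecke (p ^ 5 * x)"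
proof -
  interpret Q: nome "p ^ 2" by (rule power_nome) simp
  have "hecke x = 2 * theta (p ^ 2) (p ^ 2 * x) + p ^ 7 * (x powi 2 * hecke (p ^ 5 * x))"
  proof (rule laurent_eqI[OF hecke_laurent laurent_add[OF laurent_cmult[OF laurent_scale[OF Q.theta_laurent]]
          laurent_cmult[OF laurent_shift[OF laurent_scale[OF hecke_laurent]]]] _ x])
    fix N
    have "hecke_coeff N = 2 * ((-1) powi N * p powi (N * N + N)) + (-1) powi N * p powi (N * N + N) * (p powi (N - 1) * Gint (N - 2))"
      using Gint_rec[of "N - 2"] by (simp add: hecke_coeff_def algebra_simps)
    moreover have "p ^ 7 * (hecke_coeff (N - 2) * (p ^ 5) powi (N - 2)) = (-1) powi N * p powi (N * N + N) * (p powi (N - 1) * Gint (N - 2))"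
    proof -
      have 1: "(-1) powi (N - 2) = ((-1) powi N :: complex)" by (simp add: power_int_diff)
      have 2: "p ^ 7 * p powi ((N - 2) * (N - 2) + (N - 2)) * (p ^ 5) powi (N - 2) = p powi (N * N + N) * p powi (N - 1)"
      proof -
        have "(p ^ 5) powi (N - 2) = p powi (5 * (N - 2))" using power_int_power[of p 5 "N - 2"] by simp
        moreover have "p ^ 7 = p powi 7" by simp
        ultimately have "p ^ 7 * p powi ((N - 2) * (N - 2) + (N - 2)) * (p ^ 5) powi (N - 2)
          = p powi (7 + ((N - 2) * (N - 2) + (N - 2)) + 5 * (N - 2))"
          using p0 by (simp only: power_int_add simp_thms)
        also have "7 + ((N - 2) * (N - 2) + (N - 2)) + 5 * (N - 2) = (N * N + N) + (N - 1)"
          by (simp add: algebra_simps)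
        also have "p powi \<dots> = p powi (N * N + N) * p powi (N - 1)" using p0 by (simp only: power_int_add simp_thms)
        finally show ?thesis .
      qed
      have "p ^ 7 * (hecke_coeff (N - 2) * (p ^ 5) powi (N - 2))
        = (-1) powi (N - 2) * (p ^ 7 * p powi ((N - 2) * (N - 2) + (N - 2)) * (p ^ 5) powi (N - 2)) * Gint (N - 2)"
        by (simp only: hecke_coeff_def mult_ac)
      then show ?thesis unfolding 1 2 by (simp only: mult_ac)
    qed
    ultimately show "hecke_coeff N = 2 * (tc (p ^ 2) N * (p ^ 2) powi N) + p ^ 7 * (hecke_coeff (N - 2) * (p ^ 5) powi (N - 2))"
      unfolding tc_p2 by simp
  qed (use p0 in auto)
  then show ?thesis by (simp add: mult.assoc)
qed

lemma hecke_reflect: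
  assumes x: "x \<noteq> 0"
  shows "hecke x = - (p ^ 3) / x ^ 2 * hecke (p ^ 3 / x)"
proof -
  have "hecke x = - (p ^ 3) * (x powi (- 2) * hecke (p ^ 3 * inverse x))"
  proof (rule laurent_eqI[OF hecke_laurent laurent_cmult[OF laurent_shift[OF laurent_inverse[OF laurent_scale[OF hecke_laurent]]]] _ x])
    fix N :: int
    define M where "M = - 2 - N"
    have N: "N = - 2 - M" "- (N - - 2) = M" by (simp_all add: M_def)
    have 1: "(-1) powi (- 2 - M) = ((-1) powi M :: complex)"
      by (cases "even M") (simp_all add: power_int_diff power_int_minus)
    have 2: "p powi (N * N + N) * p powi (M + 1) = p ^ 3 * (p powi (M * M + M) * (p ^ 3) powi M)"
    proof -
      have "(p ^ 3) powi M = p powi (3 * M)" using power_int_power[of p 3 M] by simp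
      moreover have "p ^ 3 = p powi 3" by simp
      ultimately have "p ^ 3 * (p powi (M * M + M) * (p ^ 3) powi M) = p powi (3 + ((M * M + M) + 3 * M))"
        using p0 by (simp only: power_int_add simp_thms)
      also have "3 + ((M * M + M) + 3 * M) = (N * N + N) + (M + 1)" unfolding N(1) by (simp add: algebra_simps)
      also have "p powi \<dots> = p powi (N * N + N) * p powi (M + 1)" using p0 by (simp only: power_int_add simp_thms)
      finally show ?thesis by simp
    qed
    have "hecke_coeff N = - ((-1) powi M * (p powi (N * N + N) * p powi (M + 1)) * Gint M)"
      unfolding hecke_coeff_def using Gint_reflect[of M] 1 N(1) by (simp add: mult_ac)
    then show "hecke_coeff N = - (p ^ 3) * (hecke_coeff (- (N - - 2)) * (p ^ 3) powi (- (N - - 2)))"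
      unfolding N(2) 2 hecke_coeff_def by (simp add: mult_ac)
  qed (use p0 in auto)
  then show ?thesis by (simp add: power_int_minus divide_inverse mult_ac)
qed

text \<open>The folded form, in which the Bailey sums are recognised: x = 1 gives phi, x = p^2 gives
  psi, and x = -p in nome p^2 gives chi.\<close>

lemma hecke_sums:
  assumes x: "x \<noteq> 0"
  shows "(\<lambda>n. (-1) ^ n * p ^ (n * (n + 1)) * G p n * (x ^ n - p ^ (3 * n + 3) * x powi (- 2 - int n))) sums hecke x"
proof -
  have "(\<lambda>n. hecke_coeff (int n) * x powi int n + hecke_coeff (- 2 - int n) * x powi (- 2 - int n)) sums hecke x"
    by (rule has_sum_int_split[OF laurentD[OF hecke_laurent x]]) (simp add: hecke_coeff_def)
  moreover have "hecke_coeff (int n) * x powi int n + hecke_coeff (- 2 - int n) * x powi (- 2 - int n)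
      = (-1) ^ n * p ^ (n * (n + 1)) * G p n * (x ^ n - p ^ (3 * n + 3) * x powi (- 2 - int n))" for n
  proof -
    have e1: "int n * int n + int n = int (n * (n + 1))" by (simp add: algebra_simps)
    have e2: "(- 2 - int n) * (- 2 - int n) + (- 2 - int n) = int (n * (n + 1) + (2 * n + 2))" by (simp add: algebra_simps)
    have e3: "(-1) powi (- 2 - int n) = ((-1) ^ n :: complex)"
      by (cases "even n") (simp_all add: power_int_diff power_int_minus)
    have 1: "hecke_coeff (int n) = (-1) ^ n * p ^ (n * (n + 1)) * G p n"
      unfolding hecke_coeff_def e1 Gint_nat power_int_of_nat ..
    have "p ^ (3 * n + 3) = p ^ (2 * n + 2) * p ^ (n + 1)"
      unfolding power_add[symmetric] by (rule arg_cong[where f = "\<lambda>k. p ^ k"]) simp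
    then have 2: "hecke_coeff (- 2 - int n) = - ((-1) ^ n * p ^ (n * (n + 1)) * G p n * p ^ (3 * n + 3))"
      unfolding hecke_coeff_def e2 e3 Gint_neg_nat power_int_of_nat power_add[of p "n * (n + 1)"] by (simp only: mult_ac mult_minus_left mult_minus_right)
    show ?thesis unfolding 1 2 power_int_of_nat by (simp add: algebra_simps)
  qed
  ultimately show ?thesis by simp
qed

text \<open>The first equation links d(N) with d(N - 2), so only d(0) and d(-1) are free. The
  reflection fixes the index -1 with a sign change, so d(-1) = 0; for d(-2) the two equations give
  p^3 d(0) and - p^3 d(0), so d(0) = 0.\<close>

lemma hecke_unique:
  assumes D: "laurent d D" and 1: "\<And>x. x \<noteq> 0 \<Longrightarrow> D x = p ^ 7 * x ^ 2 * D (p ^ 5 * x)"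
    and 2: "\<And>x. x \<noteq> 0 \<Longrightarrow> D x = - (p ^ 3) / x ^ 2 * D (p ^ 3 / x)" and x: "x \<noteq> 0"
  shows "D x = 0"
proof -
  have r1: "d N = p ^ 7 * (d (N - 2) * (p ^ 5) powi (N - 2))" for N
  proof (rule laurent_unique[OF D laurent_cmult[OF laurent_shift[OF laurent_scale[OF D]]]])
    show "D x = p ^ 7 * (x powi 2 * D (p ^ 5 * x))" if "x \<noteq> 0" for x using 1[OF that] by (simp add: mult.assoc)
  qed (use p0 in auto)
  have r2: "d N = - (p ^ 3) * (d (- (N - - 2)) * (p ^ 3) powi (- (N - - 2)))" for N
  proof (rule laurent_unique[OF D laurent_cmult[OF laurent_shift[OF laurent_inverse[OF laurent_scale[OF D]]]]])
    show "D x = - (p ^ 3) * (x powi (- 2) * D (p ^ 3 * inverse x))" if "x \<noteq> 0" for x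
      using 2[OF that] by (simp add: power_int_minus divide_inverse mult_ac)
  qed (use p0 in auto)
  have up: "d (N + 2) = 0 \<longleftrightarrow> d N = 0" for N using r1[of "N + 2"] p0 by simp
  have "d (- 1) = - (p ^ 3) * (d (- (- 1 - - 2)) * (p ^ 3) powi (- (- 1 - - 2)))" by (rule r2)
  also have "\<dots> = - d (- 1)" using p0 by (simp add: power_int_minus)
  finally have "d (- 1) = - d (- 1)" .
  then have m1: "d (- 1) = 0" by simp
  have "d (- 2) = - (p ^ 3) * d 0" using r2[of "- 2"] by simp
  moreover have "d 0 = d (- 2) / p ^ 3"
  proof -
    have "(p ^ 5) powi (0 - 2) = inverse (p ^ 7 * p ^ 3)"
      by (simp add: power_int_minus flip: power_mult power_add)
    then show ?thesis using r1[of 0] p0 by (simp add: field_simps)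
  qed
  ultimately have "d 0 = - d 0" using p0 by simp
  then have z: "d 0 = 0" by simp
  have "d N = 0 \<and> d (N - 1) = 0" for N
  proof (induction N rule: int_induct[of _ 0])
    case base
    show ?case using z m1 by simp
  next
    case (step1 i)
    then show ?case using up[of "i - 1"] by (simp add: add.commute)
  next
    case (step2 i)
    then show ?case using up[of "i - 2"] by simp
  qed
  then have "((\<lambda>_. 0) has_sum D x) (UNIV :: int set)" using laurentD[OF D x] by simp
  then show ?thesis using has_sum_unique has_sum_0_simp by blast
qed

end

section \<open>Splitting infinite products, and the zeros of theta\<close>

lemma qpoch_inf_mult_minus:
  assumes "norm p < 1"
  shows "qpoch_inf x p * qpoch_inf (- x) p = qpoch_inf (x ^ 2) (p ^ 2)"
proof -
  have "norm (p ^ 2) < 1" using assms by (simp add: norm_power power_less_one_iff)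
  then have "(\<lambda>n. qpoch (x ^ 2) (p ^ 2) n) \<longlonglongrightarrow> qpoch_inf (x ^ 2) (p ^ 2)" by (rule qpoch_tendsto)
  moreover have "(\<lambda>n. qpoch x p n * qpoch (- x) p n) \<longlonglongrightarrow> qpoch_inf x p * qpoch_inf (- x) p"
    by (intro tendsto_mult qpoch_tendsto assms)
  ultimately show ?thesis unfolding qpoch_mult_minus by (rule LIMSEQ_unique[symmetric])
qed

lemma qpoch_split: "qpoch x p (n * m) = (\<Prod>i<m. qpoch (p ^ i * x) (p ^ m) n)"
proof (induction n)
  case (Suc n)
  have "qpoch x p (Suc n * m) = qpoch x p (n * m) * qpoch (p ^ (n * m) * x) p m"
  proof -
    have "Suc n * m = n * m + m" by simp
    then show ?thesis by (simp only: qpoch_add)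
  qed
  also have "qpoch (p ^ (n * m) * x) p m = (\<Prod>i<m. 1 - (p ^ m) ^ n * (p ^ i * x))"
    unfolding qpoch_def by (intro prod.cong refl) (simp add: mult_ac power_mult[symmetric])
  finally show ?case unfolding Suc by (simp add: qpoch_Suc prod.distrib)
qed simp

lemma qpoch_inf_split:
  assumes "norm p < 1" "m > 0"
  shows "qpoch_inf x p = (\<Prod>i<m. qpoch_inf (p ^ i * x) (p ^ m))"
proof -
  have "norm (p ^ m) < 1" using assms by (simp add: norm_power power_less_one_iff)
  then have "(\<lambda>n. \<Prod>i<m. qpoch (p ^ i * x) (p ^ m) n) \<longlonglongrightarrow> (\<Prod>i<m. qpoch_inf (p ^ i * x) (p ^ m))"
    by (intro tendsto_prod qpoch_tendsto)
  moreover have "(\<lambda>n. qpoch x p (n * m)) \<longlonglongrightarrow> qpoch_inf x p"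
    by (rule filterlim_compose[OF qpoch_tendsto[OF assms(1)]])
      (use assms(2) in \<open>simp add: filterlim_subseq strict_mono_def\<close>)
  ultimately show ?thesis unfolding qpoch_split by (rule LIMSEQ_unique[symmetric])
qed

lemma qpoch_inf_split_2:
  assumes "norm p < 1"
  shows "qpoch_inf x p = qpoch_inf x (p ^ 2) * qpoch_inf (p * x) (p ^ 2)"
  using qpoch_inf_split[OF assms, of 2 x] by (simp add: lessThan_Suc numeral_2_eq_2 mult.commute)

context nome
begin

lemma powi_eq_1_iff: "p powi k = 1 \<longleftrightarrow> k = 0"
proof
  assume *: "p powi k = 1"
  show "k = 0"
  proof (rule ccontr)
    assume "k \<noteq> 0"
    then consider "k > 0" | "- k > 0" by linarith
    then show False
    proof cases
      case 1
      then show ?thesis using p_pow_neq_1[of "nat k"] * by (simp add: power_int_def)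
    next
      case 2
      have "p powi (- k) = 1" using * by (simp add: power_int_minus)
      with 2 show ?thesis using p_pow_neq_1[of "nat (- k)"] by (simp add: power_int_def split: if_splits)
    qed
  qed
qed simp

lemma powi_neq_minus_1: "p powi k \<noteq> - 1"
proof
  assume *: "p powi k = - 1"
  have "p powi (k + k) = p powi k * p powi k" by (rule power_int_add) (use p0 in simp)
  then have "p powi (k + k) = 1" using * by simp
  then have "k = 0" by (simp add: powi_eq_1_iff)
  with * show False by simp
qed

lemma theta_nonzero:
  assumes x: "x \<noteq> 0" and nz: "\<And>k. p powi k * x \<noteq> 1"
  shows "theta p x \<noteq> 0"
proof -
  have "p ^ i * x \<noteq> 1" for i using nz[of "int i"] by simp
  moreover have "p ^ i * (p / x) \<noteq> 1" for i
  proof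
    assume "p ^ i * (p / x) = 1"
    then have "p powi (int i + 1) = x" using x p0 by (simp add: power_int_add field_simps)
    then have "p powi (- (int i + 1)) = inverse x" by (simp only: power_int_minus)
    with x have "p powi (- (int i + 1)) * x = 1" by simp
    then show False using nz by blast
  qed
  ultimately show ?thesis
    unfolding theta_eq_jtheta[OF x] jtheta_def using p1 by (simp add: qpoch_inf_nonzero qpoch_inf_nonzero')
qed

text \<open>The Appell-Lerch sum m(u, p, z).\<close>

definition lerch :: "complex \<Rightarrow> complex \<Rightarrow> complex" where
  "lerch z u = appell z (u * z) / theta p z"

text \<open>A solution of f x = theta (p ^ 2) (p ^ 2 * x) + p ^ 24 * x ^ 4 * f (p ^ 10 * x). Half the equation for hecke
  reads g x = theta (p ^ 2) (p ^ 2 * x) + p ^ 7 * x ^ 2 * g (p ^ 5 * x), and g0 solves its second iterate.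
  The exponent a is free as long as the theta constant in the denominator does not vanish.\<close>

definition g0 :: "int \<Rightarrow> complex \<Rightarrow> complex" where
  "g0 a x = x / p ^ 4 / theta (p ^ 10) (p powi (2 * a)) *
     (\<Sum>\<^sub>\<infinity>k. tc (p ^ 10) k * (p powi (2 * a)) powi k * nome.tfrac (p ^ 2) (5 * k - 8 + a) (p ^ 2 * x))"

section \<open>Appell-Lerch solutions of the Hecke equations\<close>

definition g where "g a x = g0 a x + p ^ 7 * x ^ 2 * g0 a (p ^ 5 * x)"

lemma g0_laurent: "\<exists>c. laurent c (g0 a)"
proof -
  interpret P: nome "p ^ 10" by (rule power_nome) simp
  interpret Q: nome "p ^ 2" by (rule power_nome) simp
  define z where "z = p powi (2 * a)"
  have z: "z \<noteq> 0" using p0 by (simp add: z_def)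
  have p2: "p ^ 2 \<noteq> 0" using p0 by simp
  note L = laurent_cmult[OF laurent_shift[OF laurent_scale[OF Q.tfrac_sum(1)[OF P.theta_abs_summable[OF z], of "\<lambda>k. 5 * k - 8 + a"] p2], of 1],
      of "1 / p ^ 4 / theta (p ^ 10) z"]
  have "g0 a = (\<lambda>x. 1 / p ^ 4 / theta (p ^ 10) z * (x powi 1 * (\<Sum>\<^sub>\<infinity>k. tc (p ^ 10) k * z powi k * Q.tfrac (5 * k - 8 + a) (p ^ 2 * x))))"
    by (simp add: g0_def z_def fun_eq_iff)
  then show ?thesis using L by metis
qed

lemma g0_rec:
  assumes x: "x \<noteq> 0" and nz: "theta (p ^ 10) (p powi (2 * a)) \<noteq> 0"
  shows "g0 a x = theta (p ^ 2) (p ^ 2 * x) + p ^ 24 * x ^ 4 * g0 a (p ^ 10 * x)"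
proof -
  interpret P: nome "p ^ 10" by (rule power_nome) simp
  interpret Q: nome "p ^ 2" by (rule power_nome) simp
  define z where "z = p powi (2 * a)"
  have z: "z \<noteq> 0" using p0 by (simp add: z_def)
  define y where "y = p ^ 2 * x"
  have y: "y \<noteq> 0" using x p0 by (simp add: y_def)
  define w where "w k = tc (p ^ 10) k * z powi k" for k
  define f where "f k = Q.tfrac (5 * k - 8 + a)" for k
  define T where "T = theta (p ^ 10) z"
  have T: "T \<noteq> 0" using nz by (simp add: T_def z_def)
  define S where "S y = (\<Sum>\<^sub>\<infinity>k. w k * f k y)" for y
  have S: "((\<lambda>k. w k * f k y) has_sum S y) UNIV" if "y \<noteq> 0" for y
    using Q.tfrac_sum(2)[OF P.theta_abs_summable[OF z] that, of "\<lambda>k. 5 * k - 8 + a"] by (simp add: S_def w_def f_def)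
  have g0: "g0 a x = x / p ^ 4 / T * S (p ^ 2 * x)" for x
    by (simp add: g0_def S_def w_def f_def T_def z_def)
  have w_rec: "w k = - ((p ^ 10) powi (k - 1)) * z * w (k - 1)" for k
    using P.tc_succ[of "k - 1"] z by (simp add: w_def power_int_diff)
  have f_shift: "f k (p ^ 10 * y) = - f (k + 1) y / (p ^ 20 * y ^ 5)" for k
  proof -
    have 1: "(p ^ 2) powi 5 = p ^ 10" by (simp flip: power_mult)
    have "tri 5 = 10" by (simp add: tri_def)
    then have 2: "tc (p ^ 2) 5 = - (p ^ 20)" by (simp add: tc_def flip: power_mult)
    have 3: "5 * k - 8 + a + 5 = 5 * (k + 1) - 8 + a" by simp
    show ?thesis
      using Q.tfrac_powi_mult[OF y, of "5 * k - 8 + a" 5] unfolding f_def 1 2 3 by simp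
  qed
  \<comment> \<open>The offset - 8 in \<open>g0\<close> is chosen for this: the denominator becomes
    that of an Appell-Lerch sum of base p^10 with u = x / p^4 and parameter z = p^(2a).\<close>
  have f_mult: "(1 - (p ^ 10) powi (k - 1) * z * x / p ^ 4) * f k y = theta (p ^ 2) y" for k
  proof -
    have "(p ^ 2) powi (5 * k - 8 + a) * y = (p ^ 10) powi (k - 1) * z * x / p ^ 4"
    proof -
      have "(p ^ 2) powi (5 * k - 8 + a) = p powi (2 * (5 * k - 8 + a))"
        using power_int_power[of p 2 "5 * k - 8 + a"] by simp
      moreover have "(p ^ 10) powi (k - 1) = p powi (10 * (k - 1))"
        using power_int_power[of p 10 "k - 1"] by simp
      moreover have "p powi (2 * (5 * k - 8 + a)) * p ^ 2 * p ^ 4 = p powi (10 * (k - 1)) * z"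
      proof -
        have "p powi (2 * (5 * k - 8 + a)) * p powi 2 * p powi 4 = p powi (2 * (5 * k - 8 + a) + 2 + 4)"
          using p0 by (simp only: power_int_add simp_thms)
        also have "2 * (5 * k - 8 + a) + 2 + 4 = 10 * (k - 1) + 2 * a" by simp
        also have "p powi \<dots> = p powi (10 * (k - 1)) * z" using p0 by (simp only: power_int_add simp_thms z_def)
        finally show ?thesis by simp
      qed
      ultimately show ?thesis using p0 by (simp add: y_def field_simps)
    qed
    then show ?thesis using Q.tfrac_mult[OF y, of "5 * k - 8 + a"] by (simp add: f_def)
  qed
  have 1: "((\<lambda>k. w (k - 1) * f k y) has_sum (- (p ^ 20 * y ^ 5) * S (p ^ 10 * y))) UNIV"
  proof -
    have "((\<lambda>k. w k * f k (p ^ 10 * y)) has_sum S (p ^ 10 * y)) UNIV" by (rule S) (use y p0 in simp)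
    then have "((\<lambda>k. - (p ^ 20 * y ^ 5) * (w k * f k (p ^ 10 * y))) has_sum (- (p ^ 20 * y ^ 5) * S (p ^ 10 * y))) UNIV"
      by (rule has_sum_cmult_right)
    moreover have "- (p ^ 20 * y ^ 5) * (w k * f k (p ^ 10 * y)) = w k * f (k + 1) y" for k
      unfolding f_shift using y p0 by simp
    ultimately have *: "((\<lambda>k. w k * f (k + 1) y) has_sum (- (p ^ 20 * y ^ 5) * S (p ^ 10 * y))) UNIV" by simp
    have "((\<lambda>k. w (k - 1) * f k y) has_sum (- (p ^ 20 * y ^ 5) * S (p ^ 10 * y))) UNIV
      \<longleftrightarrow> ((\<lambda>k. w k * f (k + 1) y) has_sum (- (p ^ 20 * y ^ 5) * S (p ^ 10 * y))) UNIV"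
      by (rule has_sum_reindex_bij_witness[where i = "\<lambda>k. k + 1" and j = "\<lambda>k. k - 1"]) auto
    with * show ?thesis by blast
  qed
  have 2: "((\<lambda>k. w (k - 1) * theta (p ^ 2) y) has_sum (T * theta (p ^ 2) y)) UNIV"
  proof -
    have "(w has_sum T) UNIV" using P.theta_has_sum[OF z] by (simp add: w_def[abs_def] T_def)
    moreover have "((\<lambda>k. w (k - 1)) has_sum T) UNIV \<longleftrightarrow> (w has_sum T) UNIV"
      by (rule has_sum_reindex_bij_witness[where i = "\<lambda>k. k + 1" and j = "\<lambda>k. k - 1"]) auto
    ultimately show ?thesis by (intro has_sum_cmult_left) blast
  qed
  \<comment> \<open>As for \<open>appell_theta_p_mult\<close>: the original and the index-shifted
    series add up termwise to \<open>w (k - 1)\<close> times (1 - pole factor) times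
    \<open>tfrac\<close>, which is theta, so the poles disappear from the sum.\<close>
  have "((\<lambda>k. x / p ^ 4 * (w k * f k y) + w (k - 1) * f k y) has_sum (x / p ^ 4 * S y + - (p ^ 20 * y ^ 5) * S (p ^ 10 * y))) UNIV"
    by (intro has_sum_add has_sum_cmult_right S y 1)
  moreover have "x / p ^ 4 * (w k * f k y) + w (k - 1) * f k y = w (k - 1) * theta (p ^ 2) y" for k
    unfolding w_rec[of k] f_mult[of k, symmetric] by (simp add: algebra_simps)
  ultimately have "((\<lambda>k. w (k - 1) * theta (p ^ 2) y) has_sum (x / p ^ 4 * S y + - (p ^ 20 * y ^ 5) * S (p ^ 10 * y))) UNIV" by simp
  from has_sum_unique[OF this 2] have "x / p ^ 4 * S y = T * theta (p ^ 2) y + p ^ 20 * y ^ 5 * S (p ^ 10 * y)"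
    by (simp add: diff_eq_eq)
  then have "x / p ^ 4 * S y / T = theta (p ^ 2) y + p ^ 20 * y ^ 5 * S (p ^ 10 * y) / T"
    using T by (simp add: field_simps)
  moreover have "p ^ 20 * y ^ 5 * S (p ^ 10 * y) / T = p ^ 24 * x ^ 4 * g0 a (p ^ 10 * x)"
  proof -
    have a: "p ^ 2 * (p ^ 10 * x) = p ^ 10 * y" by (simp add: y_def)
    have b: "p ^ 24 * x ^ 4 * (p ^ 10 * x / p ^ 4 / T) = p ^ 20 * y ^ 5 / T"
    proof -
      have e: "y ^ 5 = p ^ 10 * (x ^ 4 * x)"
        by (simp add: y_def power_mult_distrib flip: power_mult power_Suc2)
      have f: "p ^ 24 * p ^ 10 = p ^ 20 * p ^ 10 * p ^ 4" by (simp flip: power_add)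
      have "p ^ 24 * x ^ 4 * (p ^ 10 * x / p ^ 4 / T) = (p ^ 24 * p ^ 10) * (x ^ 4 * x) / p ^ 4 / T" by (simp add: mult_ac)
      also have "\<dots> = (p ^ 20 * p ^ 10 * p ^ 4) * (x ^ 4 * x) / p ^ 4 / T" unfolding f ..
      also have "\<dots> = p ^ 20 * p ^ 10 * (x ^ 4 * x) / T"
      proof -
        have gen: "c \<noteq> 0 \<Longrightarrow> (b * c) * d / c / T = b * d / T" for b c d by simp
        show ?thesis by (rule gen) (use p0 in simp)
      qed
      finally show ?thesis unfolding e by (simp only: mult.assoc)
    qed
    have "p ^ 24 * x ^ 4 * g0 a (p ^ 10 * x) = (p ^ 24 * x ^ 4 * (p ^ 10 * x / p ^ 4 / T)) * S (p ^ 10 * y)"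
      unfolding g0 a by (simp only: mult.assoc)
    then show ?thesis unfolding b by simp
  qed
  ultimately show ?thesis unfolding g0[of x] y_def[symmetric] by simp
qed

text \<open>Both g and its reflection - p^3 / x^2 g(p^3 / x) solve the equation with one copy of
  theta. Their sum therefore solves the full equation, and it is invariant under the reflection by
  construction, so \<open>hecke_unique\<close> applies to the difference.\<close>

lemma hecke_eq_lerch:
  assumes x: "x \<noteq> 0" and nz: "theta (p ^ 10) (p powi (2 * a)) \<noteq> 0"
  shows "hecke x = g a x - p ^ 3 / x ^ 2 * g a (p ^ 3 / x)"
proof -
  interpret Q: nome "p ^ 2" by (rule power_nome) simp
  have g_rec: "g a x = theta (p ^ 2) (p ^ 2 * x) + p ^ 7 * x ^ 2 * g a (p ^ 5 * x)" if "x \<noteq> 0" for x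
  proof -
    have "p ^ 5 * (p ^ 5 * x) = p ^ 10 * x" by (simp add: mult.assoc[symmetric] flip: power_add)
    moreover have "p ^ 7 * x ^ 2 * (p ^ 7 * (p ^ 5 * x) ^ 2) = p ^ 24 * x ^ 4"
      by (simp add: power_mult_distrib mult_ac flip: power_add power_mult)
    ultimately show ?thesis
      using g0_rec[OF that nz] unfolding g_def by (simp add: distrib_left mult.assoc[symmetric])
  qed
  have gs: "theta (p ^ 2) (p ^ 2 * x) + p ^ 7 * x ^ 2 * (- (p ^ 3) / (p ^ 5 * x) ^ 2 * g a (p ^ 3 / (p ^ 5 * x)))
      = - (p ^ 3) / x ^ 2 * g a (p ^ 3 / x)" if x: "x \<noteq> 0" for x
  proof -
    define X where "X = 1 / (p ^ 2 * x)"
    have X: "X \<noteq> 0" "p ^ 2 * X = inverse x" "p ^ 5 * X = p ^ 3 / x" "p ^ 3 / (p ^ 5 * x) = X"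
      using p0 x by (simp_all add: X_def field_simps flip: power_add)
    have t: "theta (p ^ 2) (inverse x) = theta (p ^ 2) (p ^ 2 * x)"
      using Q.theta_inverse[OF x] Q.theta_p_mult[OF x] by simp
    have c: "p ^ 7 * x ^ 2 * (- (p ^ 3) / (p ^ 5 * x) ^ 2) = - 1" "p ^ 7 * X ^ 2 = p ^ 3 / x ^ 2"
      using p0 x by (simp_all add: X_def field_simps power_mult_distrib flip: power_add power_mult)
    have "g a X = theta (p ^ 2) (p ^ 2 * x) + p ^ 3 / x ^ 2 * g a (p ^ 3 / x)"
      using g_rec[OF X(1)] unfolding X(2,3) c t .
    then show ?thesis unfolding X(4) mult.assoc[symmetric] c by simp
  qed
  define D where "D x = hecke x - (g a x - p ^ 3 * (x powi (- 2) * g a (p ^ 3 * inverse x)))" for x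
  have D: "D x = hecke x - g a x + p ^ 3 / x ^ 2 * g a (p ^ 3 / x)" for x
    by (simp add: D_def power_int_minus divide_inverse)
  have "\<exists>d. laurent d D"
  proof -
    obtain c where c: "laurent c (g0 a)" using g0_laurent by blast
    have p5: "p ^ 5 \<noteq> 0" "p ^ 3 \<noteq> 0" using p0 by simp_all
    note 1 = laurent_add[OF c laurent_cmult[OF laurent_shift[OF laurent_scale[OF c p5(1)], of 2], of "p ^ 7"]]
    have "g a = (\<lambda>x. g0 a x + p ^ 7 * (x powi 2 * g0 a (p ^ 5 * x)))" by (simp add: g_def fun_eq_iff)
    with 1 obtain c' where c': "laurent c' (g a)" by metis
    note 2 = laurent_diff[OF hecke_laurent laurent_diff[OF c' laurent_cmult[OF laurent_shift[OF laurent_inverse[OF laurent_scale[OF c' p5(2)]], of "- 2"], of "p ^ 3"]]]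
    show ?thesis unfolding D_def[abs_def] by (intro exI) (rule 2)
  qed
  then obtain d where d: "laurent d D" ..
  have "D x = 0"
  proof (rule hecke_unique[OF d _ _ x])
    fix x :: complex assume x: "x \<noteq> 0"
    show "D x = p ^ 7 * x ^ 2 * D (p ^ 5 * x)"
      using hecke_rec[OF x] g_rec[OF x] gs[OF x] unfolding D by (simp add: algebra_simps)
    have "g a x = - (p ^ 3) / x ^ 2 * (- (p ^ 3) / (p ^ 3 / x) ^ 2 * g a (p ^ 3 / (p ^ 3 / x)))"
      using x p0 by (simp add: field_simps power_divide flip: power_mult power_add)
    then show "D x = - (p ^ 3) / x ^ 2 * D (p ^ 3 / x)"
      using hecke_reflect[OF x] unfolding D by (simp add: algebra_simps)
  qed
  then show ?thesis unfolding D by (simp add: algebra_simps)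
qed

section \<open>Values at signed powers of the nome, and the three mock theta functions\<close>

lemma minus_one_powi_p: "s \<in> {1, - 1} \<Longrightarrow> k \<noteq> 0 \<Longrightarrow> s * p powi k \<noteq> 1"
proof -
  have "- (p powi k) \<noteq> 1" using powi_neq_minus_1[of k] by (metis minus_minus)
  then show "s \<in> {1, - 1} \<Longrightarrow> k \<noteq> 0 \<Longrightarrow> s * p powi k \<noteq> 1"
    using powi_eq_1_iff[of k] by auto
qed

text \<open>Once no denominator vanishes, which the congruence ensures, each \<open>tfrac\<close> is
  a genuine quotient; the common theta factor comes out and m(x / p^4, p^10, p^(2a))
  remains.\<close>

lemma g0_eval:
  assumes s: "s \<in> {1, - 1}" and e: "\<not> 10 dvd e - 4 + 2 * a"
  shows "g0 a (s * p powi e) = s * p powi (e - 4) * theta (p ^ 2) (s * p powi (e + 2)) * nome.lerch (p ^ 10) (p powi (2 * a)) (s * p powi (e - 4))"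
proof -
  interpret P: nome "p ^ 10" by (rule power_nome) simp
  interpret Q: nome "p ^ 2" by (rule power_nome) simp
  have pw: "p ^ n = p powi int n" for n by simp
  define x z where "x = s * p powi e" and "z = p powi (2 * a)"
  have nz: "s \<noteq> 0" "x \<noteq> 0" "z \<noteq> 0" using s p0 by (auto simp: x_def z_def)
  have y: "p ^ 2 * x = s * p powi (e + 2)" using p0 by (simp add: x_def power_int_add)
  have u: "x / p ^ 4 = s * p powi (e - 4)" using p0 by (simp add: x_def power_int_diff)
  have eq: "(p ^ 2) powi (5 * k - 8 + a) * (p ^ 2 * x) = s * p powi (10 * (k - 1) + (e - 4 + 2 * a))"
    "(p ^ 10) powi (k - 1) * (s * p powi (e - 4) * z) = s * p powi (10 * (k - 1) + (e - 4 + 2 * a))" for k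
  proof -
    have "(p ^ 2) powi (5 * k - 8 + a) = p powi (2 * (5 * k - 8 + a))"
      using power_int_power[of p 2 "5 * k - 8 + a"] by simp
    then have "(p ^ 2) powi (5 * k - 8 + a) * (p ^ 2 * x) = s * p powi (2 * (5 * k - 8 + a) + (e + 2))"
      unfolding y power_int_add[OF disjI1[OF p0]] by (simp only: mult_ac)
    also have "2 * (5 * k - 8 + a) + (e + 2) = 10 * (k - 1) + (e - 4 + 2 * a)" by simp
    finally show "(p ^ 2) powi (5 * k - 8 + a) * (p ^ 2 * x) = s * p powi (10 * (k - 1) + (e - 4 + 2 * a))" .
    have "(p ^ 10) powi (k - 1) = p powi (10 * (k - 1))"
      using power_int_power[of p 10 "k - 1"] by simp
    then show "(p ^ 10) powi (k - 1) * (s * p powi (e - 4) * z) = s * p powi (10 * (k - 1) + (e - 4 + 2 * a))"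
      unfolding z_def using p0 power_int_add[of p "10 * (k - 1)" "e - 4 + 2 * a"] power_int_add[of p "e - 4" "2 * a"]
      by (simp add: mult_ac)
  qed
  have ne: "s * p powi (10 * (k - 1) + (e - 4 + 2 * a)) \<noteq> 1" for k
  proof (rule minus_one_powi_p[OF s])
    show "10 * (k - 1) + (e - 4 + 2 * a) \<noteq> 0"
    proof
      assume "10 * (k - 1) + (e - 4 + 2 * a) = 0"
      then have "e - 4 + 2 * a = 10 * (1 - k)" by simp
      then have "10 dvd e - 4 + 2 * a" by (rule dvdI)
      with e show False ..
    qed
  qed
  have tfrac: "Q.tfrac (5 * k - 8 + a) (p ^ 2 * x) = theta (p ^ 2) (p ^ 2 * x) * (1 / (1 - (p ^ 10) powi (k - 1) * (s * p powi (e - 4) * z)))" for k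
    unfolding eq(2) by (subst Q.tfrac_eq) (use nz p0 ne in \<open>simp_all add: eq\<close>)
  have "(\<Sum>\<^sub>\<infinity>k. tc (p ^ 10) k * z powi k * Q.tfrac (5 * k - 8 + a) (p ^ 2 * x))
      = theta (p ^ 2) (p ^ 2 * x) * P.appell z (s * p powi (e - 4) * z)"
    unfolding P.appell_def infsum_cmult_right'[symmetric] tfrac by (intro infsum_cong) simp
  then show ?thesis
    unfolding g0_def x_def[symmetric] z_def[symmetric] P.lerch_def u y by (simp add: mult_ac)
qed

lemma theta_p2_shift:
  assumes s: "s \<in> {1, - 1}"
  shows "theta (p ^ 2) (s * p powi (e + 2)) = - s * theta (p ^ 2) (s * p powi e) / p powi e"
proof -
  interpret Q: nome "p ^ 2" by (rule power_nome) simp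
  have "s * p powi (e + 2) = p ^ 2 * (s * p powi e)" using p0 by (simp add: power_int_add)
  then show ?thesis using Q.theta_p_mult[of "s * p powi e"] s p0 by auto
qed

text \<open>Two terms come from g at x and two from g at p^3 / x. The condition on a keeps the theta
  constant in the denominator nonzero; the four conditions on e exclude the poles of the four
  sums.\<close>

lemma hecke_eval:
  assumes s: "s \<in> {1, - 1}" and a: "\<not> 5 dvd a"
    and e: "\<not> 10 dvd e - 4 + 2 * a" "\<not> 10 dvd e + 1 + 2 * a" "\<not> 10 dvd - e - 1 + 2 * a" "\<not> 10 dvd 4 - e + 2 * a"
  shows "hecke (s * p powi e) =
      s * p powi (e - 4) * theta (p ^ 2) (s * p powi (e + 2)) * nome.lerch (p ^ 10) (p powi (2 * a)) (s * p powi (e - 4))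
    + s * p powi (3 * e + 8) * theta (p ^ 2) (s * p powi (e + 7)) * nome.lerch (p ^ 10) (p powi (2 * a)) (s * p powi (e + 1))
    - s * p powi (2 - 3 * e) * theta (p ^ 2) (s * p powi (5 - e)) * nome.lerch (p ^ 10) (p powi (2 * a)) (s * p powi (- e - 1))
    - s * p powi (20 - 5 * e) * theta (p ^ 2) (s * p powi (10 - e)) * nome.lerch (p ^ 10) (p powi (2 * a)) (s * p powi (4 - e))"
proof -
  interpret P: nome "p ^ 10" by (rule power_nome) simp
  have s2: "s * s = 1" "1 / s = s" "s ^ 2 = 1" "s \<noteq> 0" using s by auto
  have T: "theta (p ^ 10) (p powi (2 * a)) \<noteq> 0"
  proof (rule P.theta_nonzero)
    fix k
    have "(p ^ 10) powi k * p powi (2 * a) = p powi (10 * k + 2 * a)"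
      using power_int_power[of p 10 k] p0 by (simp add: power_int_add)
    moreover have "10 * k + 2 * a \<noteq> 0"
    proof
      assume "10 * k + 2 * a = 0"
      then have "a = 5 * (- k)" by simp
      with a show False by simp
    qed
    ultimately show "(p ^ 10) powi k * p powi (2 * a) \<noteq> 1" by (simp add: powi_eq_1_iff)
  qed (use p0 in simp)
  have x: "s * p powi e \<noteq> 0" using s2 p0 by simp
  have c1: "p ^ 5 * (s * p powi i) = s * p powi (i + 5)" for i
    unfolding powi_add by simp
  have c2: "p ^ 3 / (s * p powi e) = s * p powi (3 - e)"
    using p0 s by (auto simp: power_int_diff)
  have c3: "p ^ 7 * (s * p powi i) ^ 2 = p powi (2 * i + 7)" for i
  proof -
    have "(p powi i) ^ 2 = p powi (2 * i)" using power_int_power'[of p i 2] by (simp add: mult.commute)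
    then show ?thesis unfolding powi_add power_mult_distrib s2 by simp
  qed
  have c4: "p ^ 3 / (s * p powi e) ^ 2 = p powi (3 - 2 * e)"
  proof -
    have "(p powi e) ^ 2 = p powi (2 * e)" using power_int_power'[of p e 2] by (simp add: mult.commute)
    then show ?thesis using p0 unfolding power_mult_distrib s2 by (simp add: power_int_diff)
  qed
  have G1: "g a (s * p powi i) = s * p powi (i - 4) * theta (p ^ 2) (s * p powi (i + 2)) * P.lerch (p powi (2 * a)) (s * p powi (i - 4))
     + s * p powi (3 * i + 8) * theta (p ^ 2) (s * p powi (i + 7)) * P.lerch (p powi (2 * a)) (s * p powi (i + 1))"
    if "\<not> 10 dvd i - 4 + 2 * a" "\<not> 10 dvd i + 1 + 2 * a" for i
  proof -
    have q: "i + 5 - 4 + 2 * a = i + 1 + 2 * a" by simp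
    have "\<not> 10 dvd i + 5 - 4 + 2 * a" unfolding q by (rule that(2))
    note E = g0_eval[OF s that(1)] g0_eval[OF s this]
    have i: "i + 5 + 2 = i + 7" "i + 5 - 4 = i + 1" "3 * i + 8 = (2 * i + 7) + (i + 1)" by simp_all
    show ?thesis unfolding g_def c1 c3 E i powi_add[of "2 * i + 7" "i + 1"] by (simp add: mult_ac)
  qed
  have "\<not> 10 dvd 3 - e - 4 + 2 * a" "\<not> 10 dvd 3 - e + 1 + 2 * a"
    using e(3,4) by (simp_all add: algebra_simps)
  note G2 = G1[OF this]
  have i: "3 - e - 4 = - e - 1" "3 - e + 2 = 5 - e" "3 - e + 7 = 10 - e" "3 - e + 1 = 4 - e" by simp_all
  have j: "2 - 3 * e = (3 - 2 * e) + (- e - 1)" "20 - 5 * e = (3 - 2 * e) + (3 * (3 - e) + 8)" by simp_all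
  show ?thesis
    unfolding hecke_eq_lerch[OF x T] c2 c4 G1[OF e(1,2)] G2 i j powi_add[of "3 - 2 * e"] by (simp add: algebra_simps)
qed

lemma theta_p2_values:
  assumes s: "s \<in> {1, - 1}"
  defines "t \<equiv> theta (p ^ 2) (s * p)"
  shows "theta (p ^ 2) (s * p powi 3) = - s * t / p" "theta (p ^ 2) (s * p powi 5) = t / p ^ 4"
    "theta (p ^ 2) (s * p powi 7) = - s * t / p ^ 9" "theta (p ^ 2) (s * p powi 9) = t / p ^ 16"
proof -
  have s2: "s * s = 1" using s by auto
  show 3: "theta (p ^ 2) (s * p powi 3) = - s * t / p"
    using theta_p2_shift[OF s, of 1] by (simp add: t_def)
  show 5: "theta (p ^ 2) (s * p powi 5) = t / p ^ 4"
    using theta_p2_shift[OF s, of 3] 3 s2 by (simp add: mult.assoc[symmetric] flip: power_Suc)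
  show 7: "theta (p ^ 2) (s * p powi 7) = - s * t / p ^ 9"
    using theta_p2_shift[OF s, of 5] 5 by (simp flip: power_add)
  show "theta (p ^ 2) (s * p powi 9) = t / p ^ 16"
    using theta_p2_shift[OF s, of 7] 7 s2 by (simp add: mult.assoc[symmetric] flip: power_add)
qed

text \<open>For s = 1 all these values are 0 since \<open>theta (p ^ 2) 1 = 0\<close>; this removes
  two of the four terms of \<open>hecke_eval\<close> for phi and psi.\<close>

lemma theta_p2_values_even:
  assumes s: "s \<in> {1, - 1}"
  defines "t \<equiv> theta (p ^ 2) s"
  shows "theta (p ^ 2) (s * p powi 2) = - s * t" "theta (p ^ 2) (s * p powi 4) = t / p ^ 2"
    "theta (p ^ 2) (s * p powi 6) = - s * t / p ^ 6" "theta (p ^ 2) (s * p powi 8) = t / p ^ 12"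
    "theta (p ^ 2) (s * p powi 10) = - s * t / p ^ 20"
proof -
  have s2: "s * s = 1" using s by auto
  show 2: "theta (p ^ 2) (s * p powi 2) = - s * t"
    using theta_p2_shift[OF s, of 0] by (simp add: t_def)
  show 4: "theta (p ^ 2) (s * p powi 4) = t / p ^ 2"
    using theta_p2_shift[OF s, of 2] 2 s2 by (simp add: mult.assoc[symmetric])
  show 6: "theta (p ^ 2) (s * p powi 6) = - s * t / p ^ 6"
    using theta_p2_shift[OF s, of 4] 4 by (simp flip: power_add)
  show 8: "theta (p ^ 2) (s * p powi 8) = t / p ^ 12"
    using theta_p2_shift[OF s, of 6] 6 s2 by (simp add: mult.assoc[symmetric] flip: power_add)
  show "theta (p ^ 2) (s * p powi 10) = - s * t / p ^ 20"
    using theta_p2_shift[OF s, of 8] 8 by (simp flip: power_add)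
qed

lemma J12_eq_theta: "J12 = theta (p ^ 2) p"
proof -
  interpret Q: nome "p ^ 2" by (rule power_nome) simp
  have s: "qpoch_inf p p = qpoch_inf p (p ^ 2) * qpoch_inf (p ^ 2) (p ^ 2)"
    using qpoch_inf_split_2[OF p1, of p] by (simp add: power2_eq_square)
  have m: "qpoch_inf p p * qpoch_inf (- p) p = qpoch_inf (p ^ 2) (p ^ 2)" by (rule qpoch_inf_mult_minus[OF p1])
  have nz: "qpoch_inf p p \<noteq> 0" "qpoch_inf (- p) p \<noteq> 0" using J12_nonzero by (auto simp: J12_def)
  have "theta (p ^ 2) p = qpoch_inf p (p ^ 2) * qpoch_inf p (p ^ 2) * qpoch_inf (p ^ 2) (p ^ 2)"
    using Q.theta_eq_jtheta[OF p0] p0 by (simp add: jtheta_def power2_eq_square)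
  moreover have "qpoch_inf p (p ^ 2) * qpoch_inf (- p) p = 1"
  proof -
    have "qpoch_inf (p ^ 2) (p ^ 2) \<noteq> 0" using s nz(1) by auto
    moreover have "(qpoch_inf p (p ^ 2) * qpoch_inf (- p) p) * qpoch_inf (p ^ 2) (p ^ 2) = 1 * qpoch_inf (p ^ 2) (p ^ 2)"
      using m unfolding s by (simp add: mult_ac)
    ultimately show ?thesis by (metis mult_right_cancel)
  qed
  then have "qpoch_inf p (p ^ 2) = 1 / qpoch_inf (- p) p" using nz by (simp add: field_simps)
  ultimately show ?thesis unfolding J12_def s by (simp add: mult_ac)
qed

lemma power_div_cancel: "p ^ a * (t / p ^ (a + b)) = t / p ^ b" "1 / p ^ a * (t / p ^ b) = t / p ^ (a + b)"
  using p0 by (simp_all add: power_add)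

text \<open>At x = 1 the two surviving theta factors sit at odd powers of p, hence are monomial
  multiples of \<open>theta (p ^ 2) p\<close>, which is \<open>J12\<close> and cancels. The sums
  have a = 1, that is z = p^2.\<close>

theorem mock_phi_appell:
  "mock_phi p = - nome.lerch (p ^ 10) (p ^ 2) p / p - nome.lerch (p ^ 10) (p ^ 2) (1 / p) / p ^ 2"
proof -
  interpret P: nome "p ^ 10" by (rule power_nome) simp
  interpret Q: nome "p ^ 2" by (rule power_nome) simp
  have "(\<lambda>n. (-1) ^ n * p ^ (n * (n + 1)) * G p n * (1 ^ n - p ^ (3 * n + 3) * 1 powi (- 2 - int n))) sums hecke 1"
    by (rule hecke_sums) simp
  then have "hecke 1 = J12 * mock_phi p"
    using mock_phi_sums by (simp add: sums_iff mult_ac)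
  moreover have "hecke 1 = - (P.lerch (p ^ 2) p / p + P.lerch (p ^ 2) (1 / p) / p ^ 2) * J12"
  proof -
    have "hecke 1 = p ^ 8 * (- theta (p ^ 2) p / p ^ 9) * P.lerch (p ^ 2) p - p ^ 2 * (theta (p ^ 2) p / p ^ 4) * P.lerch (p ^ 2) (1 / p)"
      using hecke_eval[of 1 1 0] theta_p2_values[of 1] theta_p2_values_even[of 1]
      by (simp add: power_int_minus_divide)
    also have "p ^ 8 * (- theta (p ^ 2) p / p ^ 9) = - theta (p ^ 2) p / p"
      using power_div_cancel(1)[of 8 _ 1] by simp
    also have "p ^ 2 * (theta (p ^ 2) p / p ^ 4) = theta (p ^ 2) p / p ^ 2"
      using power_div_cancel(1)[of 2 _ 2] by simp
    finally show ?thesis unfolding J12_eq_theta by (simp add: algebra_simps)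
  qed
  ultimately have "J12 * mock_phi p = J12 * (- (P.lerch (p ^ 2) p / p + P.lerch (p ^ 2) (1 / p) / p ^ 2))"
    by (metis mult.commute)
  then have "mock_phi p = - (P.lerch (p ^ 2) p / p + P.lerch (p ^ 2) (1 / p) / p ^ 2)"
    by (simp only: mult_left_cancel[OF J12_nonzero])
  then show ?thesis by simp
qed

lemma mock_psi_hecke: "J12 * mock_psi p = - (p ^ 2) * hecke (p ^ 2)"
proof -
  have "(\<lambda>n. - (p ^ 2) * ((-1) ^ n * p ^ (n * (n + 1)) * G p n * ((p ^ 2) ^ n - p ^ (3 * n + 3) * (p ^ 2) powi (- 2 - int n)))) sums (- (p ^ 2) * hecke (p ^ 2))"
    by (intro sums_mult hecke_sums) (use p0 in simp)
  moreover have "- (p ^ 2) * ((-1) ^ n * p ^ (n * (n + 1)) * G p n * ((p ^ 2) ^ n - p ^ (3 * n + 3) * (p ^ 2) powi (- 2 - int n)))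
     = (- 1) ^ n * p ^ ((n + 1) ^ 2) * (1 - p ^ (n + 1)) * G p n" for n
  proof -
    have 1: "(p ^ 2) powi (- 2 - int n) = 1 / p ^ (2 * n + 4)"
    proof -
      have "- 2 - int n = - int (n + 2)" by simp
      then have "(p ^ 2) powi (- 2 - int n) = inverse ((p ^ 2) ^ (n + 2))" by (simp only: power_int_minus power_int_of_nat)
      also have "(p ^ 2) ^ (n + 2) = p ^ (2 * n + 4)"
        unfolding power_mult[symmetric] by (rule arg_cong[where f = "\<lambda>k. p ^ k"]) simp
      finally show ?thesis by (simp add: inverse_eq_divide)
    qed
    have 2: "p ^ 2 * p ^ (n * (n + 1)) * (p ^ 2) ^ n = p ^ ((n + 1) ^ 2) * p ^ (n + 1)"
      unfolding power_mult[symmetric] power_add[symmetric]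
      by (rule arg_cong[where f = "\<lambda>k. p ^ k"]) (simp add: power2_eq_square algebra_simps)
    have 3: "p ^ 2 * p ^ (n * (n + 1)) * p ^ (3 * n + 3) = p ^ ((n + 1) ^ 2) * p ^ (2 * n + 4)"
      unfolding power_mult[symmetric] power_add[symmetric]
      by (rule arg_cong[where f = "\<lambda>k. p ^ k"]) (simp add: power2_eq_square algebra_simps)
    have "- (p ^ 2) * ((-1) ^ n * p ^ (n * (n + 1)) * G p n * ((p ^ 2) ^ n - p ^ (3 * n + 3) * (1 / p ^ (2 * n + 4))))
      = (-1) ^ n * ((p ^ 2 * p ^ (n * (n + 1)) * p ^ (3 * n + 3)) / p ^ (2 * n + 4) - p ^ 2 * p ^ (n * (n + 1)) * (p ^ 2) ^ n) * G p n"
      by (simp add: right_diff_distrib left_diff_distrib mult_ac)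
    then show ?thesis unfolding 1 2 3 using p0 by (simp add: right_diff_distrib)
  qed
  ultimately show ?thesis using mock_psi_sums by (simp only: sums_iff)
qed

text \<open>The mechanism is that of phi, now at x = p^2. The choice a = 3, that is z = p^6,
  anticipates the parameter that dissecting the sums for phi will produce.\<close>

theorem mock_psi_appell:
  "mock_psi p = - nome.lerch (p ^ 10) (p ^ 6) (p ^ 3) - nome.lerch (p ^ 10) (p ^ 6) (1 / p ^ 3) / p ^ 3"
proof -
  interpret P: nome "p ^ 10" by (rule power_nome) simp
  interpret Q: nome "p ^ 2" by (rule power_nome) simp
  have "hecke (p ^ 2) = 1 / p ^ 2 * (J12 * P.lerch (p ^ 6) (p ^ 3)) + 1 / p ^ 5 * (J12 * P.lerch (p ^ 6) (1 / p ^ 3))"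
  proof -
    have "hecke (p ^ 2) = p ^ 14 * (theta (p ^ 2) p / p ^ 16) * P.lerch (p ^ 6) (p ^ 3) - 1 / p ^ 4 * (- theta (p ^ 2) p / p) * P.lerch (p ^ 6) (1 / p ^ 3)"
      using hecke_eval[of 1 3 2] theta_p2_values[of 1] theta_p2_values_even[of 1]
      by (simp add: power_int_minus_divide mult_ac)
    also have "p ^ 14 * (theta (p ^ 2) p / p ^ 16) = 1 / p ^ 2 * theta (p ^ 2) p"
      using power_div_cancel(1)[of 14 _ 2] by simp
    also have "1 / p ^ 4 * (- theta (p ^ 2) p / p) = - (1 / p ^ 5 * theta (p ^ 2) p)"
      using power_div_cancel(2)[of 4 _ 1] by simp
    finally show ?thesis unfolding J12_eq_theta by (simp add: mult_ac)
  qed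
  then have "J12 * mock_psi p = - (p ^ 2) * (1 / p ^ 2 * (J12 * P.lerch (p ^ 6) (p ^ 3)) + 1 / p ^ 5 * (J12 * P.lerch (p ^ 6) (1 / p ^ 3)))"
    by (simp only: mock_psi_hecke)
  also have "\<dots> = J12 * (- P.lerch (p ^ 6) (p ^ 3) - P.lerch (p ^ 6) (1 / p ^ 3) / p ^ 3)"
    using p0 by (simp add: algebra_simps) (simp add: field_simps)
  finally show ?thesis by (simp only: mult_left_cancel[OF J12_nonzero])
qed

text \<open>Averaging over p and -p keeps the even exponents. In G(2M) the exponent i (2M - i) is
  even exactly for i = 2j, where it is 4 j (M - j); in G(2M + 1) every exponent is even. The
  recurrences carry both facts to negative indices.\<close>

lemma Gint_even: "Gint (2 * M) + nome.Gint (- p) (2 * M) = 2 * nome.Gint (p ^ 4) M"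
  and Gint_odd: "Gint (2 * M + 1) - nome.Gint (- p) (2 * M + 1) = 0"
proof -
  interpret N: nome "- p" by (rule minus_nome)
  interpret P4: nome "p ^ 4" by (rule power_nome) simp
  have neg: "(- p) powi k = (-1) powi k * p powi k" for k
    using power_int_mult_distrib[of "-1" p k] by simp
  have Ne: "N.Gint (2 * M + 2) = 2 - p powi (2 * M + 1) * N.Gint (2 * M)" for M
    using N.Gint_rec[of "2 * M"] by (simp add: neg)
  have No: "N.Gint (2 * M + 1 + 2) = 2 + p powi (2 * M + 2) * N.Gint (2 * M + 1)" for M
  proof -
    have i: "2 * M + 1 + 1 = 2 * M + 2" by simp
    have ev: "(- p) powi (2 * M + 2) = p powi (2 * M + 2)" by (rule power_int_minus_left_even) simp
    show ?thesis by (simp only: N.Gint_rec[of "2 * M + 1"] i ev)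
  qed
  have Ge: "Gint (2 * M + 2) = 2 + p powi (2 * M + 1) * Gint (2 * M)" for M
    using Gint_rec[of "2 * M"] by simp
  have Go: "Gint (2 * M + 1 + 2) = 2 + p powi (2 * M + 2) * Gint (2 * M + 1)" for M
  proof -
    have i: "2 * M + 1 + 1 = 2 * M + 2" by simp
    show ?thesis by (simp only: Gint_rec[of "2 * M + 1"] i)
  qed
  define Od where "Od M = Gint (2 * M + 1) - N.Gint (2 * M + 1)" for M
  have O_rec: "Od (M + 1) = p powi (2 * M + 2) * Od M" for M
  proof -
    have i: "2 * (M + 1) + 1 = 2 * M + 1 + 2" by simp
    show ?thesis unfolding Od_def i Go No by (simp add: algebra_simps)
  qed
  have "Od M = 0" for M
  proof (induction M rule: int_induct[of _ 0])
    case base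
    show ?case using Gint_nat[of 1] N.Gint_nat[of 1] by (simp add: Od_def)
  next
    case (step1 i)
    then show ?case using O_rec[of i] by simp
  next
    case (step2 i)
    then show ?case using O_rec[of "i - 1"] p0 by simp
  qed
  then show "Gint (2 * M + 1) - N.Gint (2 * M + 1) = 0" by (simp add: Od_def)
  define E where "E M = Gint (2 * M) + N.Gint (2 * M) - 2 * P4.Gint M" for M
  have E_rec: "E (M + 2) = p powi (4 * M + 4) * E M" for M
  proof -
    have i: "2 * (M + 2) = 2 * (M + 1) + 2" "2 * (M + 1) = 2 * M + 2" by simp_all
    have e: "2 * (M + 1) + 1 = 2 * M + 3" by simp
    have P4: "P4.Gint (M + 2) = 2 + p powi (4 * M + 4) * P4.Gint M"
      using P4.Gint_rec[of M] power_int_power[of p 4 "M + 1"] by (simp add: algebra_simps)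
    have pw: "p powi (2 * M + 3) * p powi (2 * M + 1) = p powi (4 * M + 4)"
    proof -
      have "p powi (2 * M + 3) * p powi (2 * M + 1) = p powi ((2 * M + 3) + (2 * M + 1))"
        by (rule power_int_add[OF disjI1[OF p0], symmetric])
      also have "(2 * M + 3) + (2 * M + 1) = 4 * M + 4" by simp
      finally show ?thesis .
    qed
    have "Gint (2 * (M + 2)) + N.Gint (2 * (M + 2)) = 4 + p powi (2 * M + 3) * (Gint (2 * M + 2) - N.Gint (2 * M + 2))"
      unfolding i(1) Ge[of "M + 1"] Ne[of "M + 1"] e unfolding i(2) by (simp add: algebra_simps)
    also have "\<dots> = 4 + (p powi (2 * M + 3) * p powi (2 * M + 1)) * (Gint (2 * M) + N.Gint (2 * M))"
      unfolding Ge Ne by (simp add: algebra_simps)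
    finally show ?thesis unfolding E_def pw P4 by (simp add: algebra_simps)
  qed
  have "E M = 0 \<and> E (M + 1) = 0" for M
  proof (induction M rule: int_induct[of _ 0])
    case base
    show ?case
      using Gint_nat[of 0] N.Gint_nat[of 0] P4.Gint_nat[of 0] P4.Gint_nat[of 1] Ge[of 0] Ne[of 0] by (simp add: E_def)
  next
    case (step1 i)
    then show ?case using E_rec[of i] by (simp add: add.assoc)
  next
    case (step2 i)
    then show ?case using E_rec[of "i - 1"] p0 by (simp add: algebra_simps)
  qed
  then show "Gint (2 * M) + N.Gint (2 * M) = 2 * P4.Gint M" by (simp add: E_def)
qed

text \<open>The arguments are chosen so that the signs of the nome and of x combine: odd indices
  cancel by \<open>Gint_odd\<close>, even ones are doubled by \<open>Gint_even\<close>. Read from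
  right to left, it lowers the nome from p^4 to p.\<close>

lemma hecke_even_part: "hecke (- (p ^ 2)) + nome.hecke (- p) (p ^ 2) = 2 * nome.hecke (p ^ 4) (- (p ^ 2))"
proof -
  interpret N: nome "- p" by (rule minus_nome)
  interpret P4: nome "p ^ 4" by (rule power_nome) simp
  have nz: "- (p ^ 2) \<noteq> 0" "p ^ 2 \<noteq> 0" using p0 by simp_all
  define F where "F k = hecke_coeff k * (- (p ^ 2)) powi k + N.hecke_coeff k * (p ^ 2) powi k" for k
  have F: "(F has_sum (hecke (- (p ^ 2)) + N.hecke (p ^ 2))) UNIV"
    unfolding F_def by (intro has_sum_add laurentD[OF hecke_laurent nz(1)] laurentD[OF N.hecke_laurent nz(2)])
  have F_eq: "F k = p powi (k * k + k) * (p ^ 2) powi k * (Gint k + (-1) powi k * N.Gint k)" for k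
  proof -
    have "(- (p ^ 2)) powi k = (-1) powi k * (p ^ 2) powi k"
      using power_int_mult_distrib[of "-1" "p ^ 2" k] by simp
    moreover have "(- p) powi (k * k + k) = p powi (k * k + k)"
      by (rule power_int_minus_left_even) simp
    moreover have "(-1) powi k * ((-1) powi k * c) = c" for c :: complex
      by (cases "even k") simp_all
    ultimately show ?thesis
      unfolding F_def hecke_coeff_def N.hecke_coeff_def by (simp add: algebra_simps)
  qed
  have "F k = 0" if odd: "odd k" for k
  proof -
    obtain M where k: "k = 2 * M + 1" using odd by (rule oddE)
    have "Gint k + (-1) powi k * N.Gint k = 0" using Gint_odd[of M] by (simp add: k)
    then show ?thesis unfolding F_eq by simp
  qed
  then have "(F has_sum (hecke (- (p ^ 2)) + N.hecke (p ^ 2))) (range (\<lambda>M. 2 * M)) \<longleftrightarrow> (F has_sum (hecke (- (p ^ 2)) + N.hecke (p ^ 2))) UNIV"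
    by (intro has_sum_cong_neutral) (auto elim!: evenE)
  with F have "(F has_sum (hecke (- (p ^ 2)) + N.hecke (p ^ 2))) (range (\<lambda>M. 2 * M))" by blast
  then have "((F \<circ> (\<lambda>M. 2 * M)) has_sum (hecke (- (p ^ 2)) + N.hecke (p ^ 2))) UNIV"
    by (subst (asm) has_sum_reindex) (auto simp: inj_on_def)
  moreover have "(F \<circ> (\<lambda>M. 2 * M)) = (\<lambda>M. 2 * (P4.hecke_coeff M * (- (p ^ 2)) powi M))"
  proof
    fix M :: int
    have 1: "(- (p ^ 2)) powi M = (-1) powi M * p powi (2 * M)"
      using power_int_mult_distrib[of "-1" "p ^ 2" M] power_int_power[of p 2 M] by simp
    have 2: "(p ^ 4) powi (M * M + M) = p powi (4 * (M * M + M))" using power_int_power[of p 4 "M * M + M"] by simp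
    have 3: "(p ^ 2) powi (2 * M) = p powi (4 * M)" using power_int_power[of p 2 "2 * M"] by simp
    have 4: "(-1) powi M * ((-1) powi M * c) = c" for c :: complex by (cases "even M") simp_all
    have e: "2 * M * (2 * M) + 2 * M + 4 * M = 4 * (M * M + M) + 2 * M" by (simp add: algebra_simps)
    have "(F \<circ> (\<lambda>M. 2 * M)) M = p powi (2 * M * (2 * M) + 2 * M) * p powi (4 * M) * (Gint (2 * M) + N.Gint (2 * M))"
      unfolding o_def F_eq 3 by simp
    also have "\<dots> = p powi (4 * (M * M + M)) * p powi (2 * M) * (2 * P4.Gint M)"
      unfolding Gint_even powi_add[symmetric] e ..
    also have "\<dots> = 2 * (P4.hecke_coeff M * (- (p ^ 2)) powi M)"
      unfolding P4.hecke_coeff_def 1 2 by (simp add: mult_ac 4)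
    finally show "(F \<circ> (\<lambda>M. 2 * M)) M = 2 * (P4.hecke_coeff M * (- (p ^ 2)) powi M)" .
  qed
  ultimately have "((\<lambda>M. 2 * (P4.hecke_coeff M * (- (p ^ 2)) powi M)) has_sum (hecke (- (p ^ 2)) + N.hecke (p ^ 2))) UNIV" by simp
  moreover have "((\<lambda>M. 2 * (P4.hecke_coeff M * (- (p ^ 2)) powi M)) has_sum (2 * P4.hecke (- (p ^ 2)))) UNIV"
    by (intro has_sum_cmult_right laurentD[OF P4.hecke_laurent nz(1)])
  ultimately show ?thesis by (rule has_sum_unique)
qed

text \<open>Since -p is only a square root of the nome p^2 up to sign, \<open>hecke_eval\<close>
  cannot be used on the right-hand side directly; \<open>hecke_even_part\<close> is the way
  around.\<close>

lemma mock_chi_hecke: "J14 * mock_chi p = p * nome.hecke (p ^ 2) (- p)"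
proof -
  interpret Q: nome "p ^ 2" by (rule power_nome) simp
  have "(\<lambda>n. p * ((-1) ^ n * (p ^ 2) ^ (n * (n + 1)) * G (p ^ 2) n * ((- p) ^ n - (p ^ 2) ^ (3 * n + 3) * (- p) powi (- 2 - int n)))) sums (p * Q.hecke (- p))"
    by (intro sums_mult Q.hecke_sums) (use p0 in simp)
  moreover have "p * ((-1) ^ n * (p ^ 2) ^ (n * (n + 1)) * G (p ^ 2) n * ((- p) ^ n - (p ^ 2) ^ (3 * n + 3) * (- p) powi (- 2 - int n)))
     = p ^ (n * (n + 1) + (n + 1) ^ 2) * (1 - p ^ (4 * n + 4)) * G (p ^ 2) n" for n
  proof -
    have 1: "(- p) powi (- 2 - int n) = (-1) ^ n / p ^ (n + 2)"
    proof -
      have "- 2 - int n = - int (n + 2)" by simp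
      then have "(- p) powi (- 2 - int n) = inverse ((- p) ^ (n + 2))" by (simp only: power_int_minus power_int_of_nat)
      also have "(- p) ^ (n + 2) = (-1) ^ n * p ^ (n + 2)" by (simp add: power_minus[of p])
      finally show ?thesis by (cases "even n") (simp_all add: divide_inverse)
    qed
    have 2: "p * (p ^ 2) ^ (n * (n + 1)) * p ^ n = p ^ (n * (n + 1) + (n + 1) ^ 2)"
      unfolding power_mult[symmetric] power_add[symmetric] power_Suc[symmetric]
      by (rule arg_cong[where f = "\<lambda>k. p ^ k"]) (simp add: power2_eq_square algebra_simps)
    have 3: "p * (p ^ 2) ^ (n * (n + 1)) * (p ^ 2) ^ (3 * n + 3) = p ^ (n * (n + 1) + (n + 1) ^ 2) * p ^ (4 * n + 4) * p ^ (n + 2)"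
      unfolding power_mult[symmetric] power_add[symmetric] power_Suc[symmetric]
      by (rule arg_cong[where f = "\<lambda>k. p ^ k"]) (simp add: power2_eq_square algebra_simps)
    have 4: "(-1) ^ n * ((-1) ^ n * c) = c" for c :: complex by (cases "even n") simp_all
    have "p * ((-1) ^ n * (p ^ 2) ^ (n * (n + 1)) * G (p ^ 2) n * ((- p) ^ n - (p ^ 2) ^ (3 * n + 3) * ((-1) ^ n / p ^ (n + 2))))
      = (p * (p ^ 2) ^ (n * (n + 1)) * p ^ n - p * (p ^ 2) ^ (n * (n + 1)) * (p ^ 2) ^ (3 * n + 3) / p ^ (n + 2)) * G (p ^ 2) n"
      unfolding power_minus[of p n] by (cases "even n") (simp_all add: algebra_simps)
    then show ?thesis unfolding 1 2 3 using p0 by (simp add: right_diff_distrib)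
  qed
  ultimately show ?thesis using mock_chi_sums by (simp only: sums_iff)
qed

lemma J14_p2_eq_theta: "2 * nome.J14 (p ^ 2) = theta (p ^ 2) (- 1)"
proof -
  interpret Q: nome "p ^ 2" by (rule power_nome) simp
  interpret P4: nome "p ^ 4" by (rule power_nome) simp
  have pp: "(p ^ 2) ^ 2 = p ^ 4" by simp
  define a b c where "a = qpoch_inf (p ^ 2) (p ^ 4)" and "b = qpoch_inf (p ^ 4) (p ^ 4)" and "c = qpoch_inf (- (p ^ 2)) (p ^ 2)"
  have ab: "qpoch_inf (p ^ 2) (p ^ 2) = a * b"
    using qpoch_inf_split_2[OF Q.p1, of "p ^ 2"] unfolding pp by (simp add: a_def b_def flip: power_add)
  have "a * b * c = b"
    using qpoch_inf_mult_minus[OF Q.p1, of "p ^ 2"] unfolding pp ab c_def[symmetric] b_def by simp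
  moreover have b: "b \<noteq> 0" unfolding b_def by (rule qpoch_inf_nonzero'[OF P4.p1 P4.p1])
  ultimately have ac: "a * c = 1" by (simp add: mult.assoc mult.left_commute[of a b])
  then have "a \<noteq> 0" by auto
  have "theta (p ^ 2) (- 1) = qpoch_inf (- 1) (p ^ 2) * c * (a * b)"
    using Q.theta_eq_jtheta[of "- 1"] by (simp add: jtheta_def c_def ab)
  also have "qpoch_inf (- 1) (p ^ 2) = 2 * c"
    using qpoch_inf_split_first[OF Q.p1, of "- 1" 1] by (simp add: qpoch_Suc c_def)
  also have "2 * c * c * (a * b) = 2 * ((a * c) * c * b)" by (simp only: mult_ac)
  also have "\<dots> = 2 * (b / a)" using ac \<open>a \<noteq> 0\<close> by (simp add: field_simps)
  also have "b / a = nome.J14 (p ^ 2)" unfolding Q.J14_def pp a_def b_def ..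
  finally show ?thesis by simp
qed

text \<open>With s = -1 all four terms of \<open>hecke_eval\<close> are present. Those called C and
  D are multiples of \<open>theta (p ^ 2) (- p)\<close> and cancel against the value for nome -p;
  the other two carry \<open>theta (p ^ 2) (- 1)\<close>, which is twice \<open>J14\<close> at
  p^2.\<close>

theorem mock_chi_appell:
  "mock_chi (p ^ 2) = nome.lerch (p ^ 10) (p ^ 6) (- (p ^ 2)) - nome.lerch (p ^ 10) (p ^ 6) (- 1 / p ^ 2) / p ^ 2"
proof -
  interpret P: nome "p ^ 10" by (rule power_nome) simp
  interpret N: nome "- p" by (rule minus_nome)
  interpret Q: nome "p ^ 2" by (rule power_nome) simp
  define t u where "t = theta (p ^ 2) (- 1)" and "u = theta (p ^ 2) (- p)"
  define A B C D where "A = P.lerch (p ^ 6) (- (p ^ 2))" and "B = P.lerch (p ^ 6) (- 1 / p ^ 2)"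
    and "C = P.lerch (p ^ 6) (- (p ^ 3))" and "D = P.lerch (p ^ 6) (- 1 / p ^ 3)"
  have e: "p ^ 14 * (u / p ^ 16) = u / p ^ 2" "p ^ 10 * (t / p ^ 12) = t / p ^ 2"
    "1 / p ^ 2 * (t / p ^ 2) = t / p ^ 4" "1 / p ^ 4 * (u / p ^ 1) = u / p ^ 5"
    using power_div_cancel(1)[of 14 u 2] power_div_cancel(1)[of 10 t 2] power_div_cancel(2)[of 2 t 2]
      power_div_cancel(2)[of 4 u 1] by simp_all
  have 1: "hecke (- (p ^ 2)) = - (t / p ^ 4) * B - (u / p ^ 2) * C + (u / p ^ 5) * D + (t / p ^ 2) * A"
  proof -
    have "hecke (- (p ^ 2)) = - (1 / p ^ 2 * (t / p ^ 2)) * B - (p ^ 14 * (u / p ^ 16)) * C + (1 / p ^ 4 * (u / p ^ 1)) * D + (p ^ 10 * (t / p ^ 12)) * A"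
      using hecke_eval[of "- 1" 3 2] theta_p2_values[of "- 1"] theta_p2_values_even[of "- 1"]
      by (simp add: power_int_minus_divide t_def u_def A_def B_def C_def D_def)
    then show ?thesis unfolding e by simp
  qed
  have 2: "N.hecke (p ^ 2) = (u / p ^ 2) * C - (u / p ^ 5) * D"
  proof -
    have "N.hecke (p ^ 2) = (p ^ 14 * (u / p ^ 16)) * C - (1 / p ^ 4 * (u / p ^ 1)) * D"
      using N.hecke_eval[of 1 3 2] N.theta_p2_values[of 1] N.theta_p2_values_even[of 1]
      by (simp add: power_int_minus_divide u_def C_def D_def)
    then show ?thesis unfolding e by simp
  qed
  have "2 * (Q.J14 * mock_chi (p ^ 2)) = p ^ 2 * (hecke (- (p ^ 2)) + N.hecke (p ^ 2))"
    unfolding hecke_even_part Q.mock_chi_hecke by simp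
  also have "\<dots> = p ^ 2 * ((t / p ^ 2) * A - (t / p ^ 4) * B)" unfolding 1 2 by simp
  also have "\<dots> = t * (A - B / p ^ 2)" using p0 by (simp add: field_simps)
  finally have "t * mock_chi (p ^ 2) = t * (A - B / p ^ 2)"
    unfolding t_def J14_p2_eq_theta[symmetric] by simp
  moreover have "t \<noteq> 0"
    unfolding t_def
  proof (rule Q.theta_nonzero)
    show "(p ^ 2) powi k * - 1 \<noteq> 1" for k
      using Q.powi_neq_minus_1[of k] by (metis minus_minus mult_minus1_right)
  qed simp
  ultimately show ?thesis unfolding A_def B_def by (metis mult_left_cancel)
qed

end

section \<open>Dissection of Appell-Lerch sums\<close>

lemma infsum_int_parity:
  fixes f :: "int \<Rightarrow> complex"
  assumes "(f has_sum S) UNIV"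
  shows "S = (\<Sum>\<^sub>\<infinity>l. f (2 * l)) + (\<Sum>\<^sub>\<infinity>l. f (2 * l + 1))"
proof -
  define X Y where "X = range (\<lambda>l::int. 2 * l)" and "Y = range (\<lambda>l::int. 2 * l + 1)"
  have "k \<in> X \<union> Y" for k by (cases "even k") (auto simp: X_def Y_def elim!: evenE oddE)
  then have "X \<union> Y = UNIV" by blast
  moreover have "X \<inter> Y = {}" unfolding X_def Y_def by (auto; presburger)
  moreover have "f summable_on A" for A
    using summable_on_subset_banach[OF has_sum_imp_summable[OF assms]] by auto
  ultimately have "infsum f UNIV = infsum f X + infsum f Y"
    using infsum_Un_disjoint[of f X Y] by simp
  moreover have "infsum f X = (\<Sum>\<^sub>\<infinity>l. f (2 * l))" "infsum f Y = (\<Sum>\<^sub>\<infinity>l. f (2 * l + 1))"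
    unfolding X_def Y_def by (subst infsum_reindex; simp add: inj_on_def o_def)+
  ultimately show ?thesis using infsumI[OF assms] by simp
qed

context nome
begin

abbreviation eu :: "nat \<Rightarrow> complex" where "eu n \<equiv> qpoch_inf (p ^ n) (p ^ n)"

section \<open>Two-term dissections of theta functions and of their products\<close>

lemma tc_p4: "tc (p ^ 4) l = (-1) powi l * p powi (2 * l * l - 2 * l)"
proof -
  have "4 * tri l = 2 * l * l - 2 * l" using two_tri[of l] by (simp add: algebra_simps)
  then show ?thesis using power_int_power[of p 4 "tri l"] by (simp add: tc_def)
qed

lemma tc_even: "tc p (2 * l) = p powi (2 * l * l - l)" and tc_odd: "tc p (2 * l + 1) = - (p powi (2 * l * l + l))"
proof -
  have "tri (2 * l) = 2 * l * l - l" "tri (2 * l + 1) = 2 * l * l + l"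
    using two_tri[of "2 * l"] two_tri[of "2 * l + 1"] by (simp_all add: algebra_simps)
  then show "tc p (2 * l) = p powi (2 * l * l - l)" "tc p (2 * l + 1) = - (p powi (2 * l * l + l))"
    by (simp_all add: tc_def power_int_add)
qed

lemma theta_dissect:
  assumes x: "x \<noteq> 0"
  shows "theta p x = theta (p ^ 4) (- (p * x ^ 2)) - x * theta (p ^ 4) (- (p ^ 3 * x ^ 2))"
proof -
  have sq: "x powi (2 * l) = (x ^ 2) powi l" for l using power_int_power[of x 2 l] by simp
  have m: "(- c) powi l = (-1) powi l * c powi l" for c :: complex and l
    using power_int_mult_distrib[of "-1" c l] by simp
  have mm: "(-1) powi l * ((-1) powi l * c) = c" for c :: complex and l :: int by (cases "even l") simp_all
  have e1: "tc p (2 * l) * x powi (2 * l) = tc (p ^ 4) l * (- (p * x ^ 2)) powi l" for l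
  proof -
    have "p powi (2 * l * l - l) = p powi (2 * l * l - 2 * l) * p powi l" unfolding powi_add[symmetric] by simp
    then show ?thesis unfolding tc_even tc_p4 sq m[of "p * x ^ 2"] power_int_mult_distrib by (simp add: mult_ac mm)
  qed
  have e2: "tc p (2 * l + 1) * x powi (2 * l + 1) = - x * (tc (p ^ 4) l * (- (p ^ 3 * x ^ 2)) powi l)" for l
  proof -
    have "(p ^ 3) powi l = p powi (3 * l)" using power_int_power[of p 3 l] by simp
    moreover have "p powi (2 * l * l + l) = p powi (2 * l * l - 2 * l) * p powi (3 * l)"
      unfolding powi_add[symmetric] by (simp add: algebra_simps)
    moreover have "x powi (2 * l + 1) = x * (x ^ 2) powi l" using x sq[of l] by (simp add: power_int_add)
    ultimately show ?thesis unfolding tc_odd tc_p4 m[of "p ^ 3 * x ^ 2"] power_int_mult_distrib by (simp add: mult_ac mm)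
  qed
  have "theta p x = (\<Sum>\<^sub>\<infinity>l. tc p (2 * l) * x powi (2 * l)) + (\<Sum>\<^sub>\<infinity>l. tc p (2 * l + 1) * x powi (2 * l + 1))"
    by (rule infsum_int_parity[OF theta_has_sum[OF x]])
  also have "\<dots> = theta (p ^ 4) (- (p * x ^ 2)) + - x * theta (p ^ 4) (- (p ^ 3 * x ^ 2))"
    unfolding e1 e2 infsum_cmult_right' theta_def ..
  finally show ?thesis by simp
qed

text \<open>The double series is grouped by the parity of the sum of the two indices, written as l -
  j and l + j in the even case and l + 1 - j and l + j in the odd case; the quadratic form is then
  diagonal in l and j.\<close>

lemma theta_mult:
  assumes a: "a \<noteq> 0" and b: "b \<noteq> 0"
  shows "theta p a * theta p b = theta (p ^ 2) (- (a * b)) * theta (p ^ 2) (- (p * b / a))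
    - a * (theta (p ^ 2) (- (p * a * b)) * theta (p ^ 2) (- (b / a)))"
proof -
  define c where "c = b / a"
  have c: "c \<noteq> 0" "b = c * a" using a b by (simp_all add: c_def)
  define F where "F N = (\<Sum>\<^sub>\<infinity>n. tc p n * (tc p (N - n) * c powi (N - n))) * a powi N" for N
  have hs: "(F has_sum (theta p a * theta p b)) UNIV"
    using laurentD[OF laurent_mult[OF theta_laurent laurent_scale[OF theta_laurent c(1)]] a]
    by (simp add: F_def[abs_def] c(2))
  have m: "(- y) powi l = (-1) powi l * y powi l" for y :: complex and l
    using power_int_mult_distrib[of "-1" y l] by simp
  have tq: "tc (p ^ 2) l = (-1) powi l * p powi (2 * tri l)" for l
    using power_int_power[of p 2 "tri l"] by (simp add: tc_def)
  have mm: "(-1) powi l * ((-1) powi l * y) = y" for y :: complex and l :: int by (cases "even l") simp_all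
  have sq: "a powi (2 * l) = a powi l * a powi l" for l unfolding mult_2 by (rule power_int_add) (use a in simp)
  have reindex: "(\<Sum>\<^sub>\<infinity>n. f n) = (\<Sum>\<^sub>\<infinity>j. f (l - j))" for f :: "int \<Rightarrow> complex" and l
    by (rule infsum_reindex_bij_betw[symmetric], rule bij_betwI[where g = "\<lambda>n. l - n"]) auto
  have e: "F (2 * l) = tc (p ^ 2) l * (- (a * b)) powi l * theta (p ^ 2) (- (p * c))" for l
  proof -
    have K: "tc p (l - j) * (tc p (2 * l - (l - j)) * c powi (2 * l - (l - j)))
      = p powi (2 * tri l) * c powi l * (tc (p ^ 2) j * (- (p * c)) powi j)" for j
    proof -
      have i: "2 * l - (l - j) = l + j" by simp
      have t: "tri (l - j) + tri (l + j) = 2 * tri l + (2 * tri j + j)"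
        using two_tri[of "l - j"] two_tri[of "l + j"] two_tri[of l] two_tri[of j] by (simp add: algebra_simps)
      have sg: "(-1) powi (l - j) * (-1) powi (l + j) = (1::complex)"
        by (cases "even l"; cases "even j") (simp_all add: power_int_diff power_int_add)
      have "tc p (l - j) * (tc p (l + j) * c powi (l + j))
        = ((-1) powi (l - j) * (-1) powi (l + j)) * (p powi tri (l - j) * p powi tri (l + j)) * c powi (l + j)"
        unfolding tc_def by (simp only: mult_ac)
      also have "\<dots> = p powi (2 * tri l) * c powi l * (tc (p ^ 2) j * (- (p * c)) powi j)"
        unfolding sg powi_add[symmetric] t tq m[of "p * c"] power_int_mult_distrib[of p] unfolding powi_add
        using c(1) by (simp add: power_int_add mult_ac mm)
      finally show ?thesis unfolding i .
    qed
    have "F (2 * l) = (\<Sum>\<^sub>\<infinity>j. tc p (l - j) * (tc p (2 * l - (l - j)) * c powi (2 * l - (l - j)))) * a powi (2 * l)"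
      unfolding F_def by (subst reindex[of _ l]) (rule refl)
    then show ?thesis
      unfolding K infsum_cmult_right' theta_def sq tq m[of "a * b"]
      by (simp add: c(2) power_int_mult_distrib mult_ac mm)
  qed
  have o: "F (2 * l + 1) = - a * (tc (p ^ 2) l * (- (p * a * b)) powi l * theta (p ^ 2) (- c))" for l
  proof -
    have K: "tc p (l + 1 - j) * (tc p (2 * l + 1 - (l + 1 - j)) * c powi (2 * l + 1 - (l + 1 - j)))
      = - (p powi (2 * tri l) * p powi l * c powi l) * (tc (p ^ 2) j * (- c) powi j)" for j
    proof -
      have i: "2 * l + 1 - (l + 1 - j) = l + j" by simp
      have t: "tri (l + 1 - j) + tri (l + j) = 2 * tri l + l + 2 * tri j"
        using two_tri[of "l + 1 - j"] two_tri[of "l + j"] two_tri[of l] two_tri[of j] by (simp add: algebra_simps)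
      have sg: "(-1) powi (l + 1 - j) * (-1) powi (l + j) = (- 1::complex)"
        by (cases "even l"; cases "even j") (simp_all add: power_int_diff power_int_add)
      have "tc p (l + 1 - j) * (tc p (l + j) * c powi (l + j))
        = ((-1) powi (l + 1 - j) * (-1) powi (l + j)) * (p powi tri (l + 1 - j) * p powi tri (l + j)) * c powi (l + j)"
        unfolding tc_def by (simp only: mult_ac)
      also have "\<dots> = - (p powi (2 * tri l) * p powi l * c powi l) * (tc (p ^ 2) j * (- c) powi j)"
        unfolding sg powi_add[symmetric] t tq m[of c] unfolding powi_add
        using c(1) by (simp add: power_int_add mult_ac mm)
      finally show ?thesis unfolding i .
    qed
    have "F (2 * l + 1) = (\<Sum>\<^sub>\<infinity>j. tc p (l + 1 - j) * (tc p (2 * l + 1 - (l + 1 - j)) * c powi (2 * l + 1 - (l + 1 - j)))) * a powi (2 * l + 1)"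
      unfolding F_def by (subst reindex[of _ "l + 1"]) (rule refl)
    then show ?thesis
      unfolding K infsum_cmult_right' theta_def power_int_add[OF disjI1[OF a]] sq tq
        m[of "p * a * b"]
      by (simp add: c(2) power_int_mult_distrib mult_ac mm)
  qed
  have ab: "p * b / a = p * c" "b / a = c" by (simp_all add: c_def)
  have "theta p a * theta p b = (\<Sum>\<^sub>\<infinity>l. F (2 * l)) + (\<Sum>\<^sub>\<infinity>l. F (2 * l + 1))"
    by (rule infsum_int_parity[OF hs])
  then show ?thesis
    unfolding e o infsum_cmult_right' infsum_cmult_left' ab theta_def[of _ "- (a * b)"] theta_def[of _ "- (p * a * b)"]
    by simp
qed

lemma theta_split_2: "x \<noteq> 0 \<Longrightarrow> theta p x * eu 2 ^ 2 = theta (p ^ 2) x * theta (p ^ 2) (p * x) * eu 1"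
proof -
  assume x: "x \<noteq> 0"
  interpret Q: nome "p ^ 2" by (rule power_nome) simp
  have e: "p * (p / x) = p ^ 2 / x" "p ^ 2 / (p * x) = p / x" using p0 by (simp_all add: power2_eq_square)
  have px: "p * x \<noteq> 0" using x p0 by simp
  show ?thesis
    unfolding theta_eq_jtheta[OF x] Q.theta_eq_jtheta[OF x] Q.theta_eq_jtheta[OF px] jtheta_def e
      qpoch_inf_split_2[OF p1, of x] qpoch_inf_split_2[OF p1, of "p / x"]
    by (simp add: power2_eq_square mult_ac)
qed

lemma theta_mult_minus: "x \<noteq> 0 \<Longrightarrow> theta p x * theta p (- x) * eu 2 = theta (p ^ 2) (x ^ 2) * eu 1 ^ 2"
proof -
  assume x: "x \<noteq> 0"
  interpret Q: nome "p ^ 2" by (rule power_nome) simp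
  have x2: "x ^ 2 \<noteq> 0" "- x \<noteq> 0" using x by simp_all
  have "qpoch_inf (p / x) p * qpoch_inf (- (p / x)) p = qpoch_inf (p ^ 2 / x ^ 2) (p ^ 2)"
    using qpoch_inf_mult_minus[OF p1, of "p / x"] by (simp add: power_divide)
  then have "theta p x * theta p (- x) * eu 2 = (qpoch_inf x p * qpoch_inf (- x) p) * qpoch_inf (p ^ 2 / x ^ 2) (p ^ 2) * eu 2 * eu 1 ^ 2"
    unfolding theta_eq_jtheta[OF x] theta_eq_jtheta[OF x2(2)] jtheta_def
    by (simp add: power2_eq_square mult_ac)
  also have "\<dots> = theta (p ^ 2) (x ^ 2) * eu 1 ^ 2"
    unfolding Q.theta_eq_jtheta[OF x2(1)] jtheta_def qpoch_inf_mult_minus[OF p1] ..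
  finally show ?thesis .
qed

section \<open>Dissection of one Appell-Lerch sum into two of fourfold base\<close>

lemma appell_has_sum:
  assumes z: "z \<noteq> 0" and y: "y \<noteq> 0" and ne: "\<And>k. p powi k * y \<noteq> 1"
  shows "((\<lambda>k. tc p k * z powi k / (1 - p powi (k - 1) * y)) has_sum appell z y) UNIV"
proof -
  have t: "theta p y \<noteq> 0" by (rule theta_nonzero[OF y ne])
  have "((\<lambda>k. tc p k * z powi k * tfrac (k - 1) y) has_sum appell_theta z y) UNIV"
    using tfrac_sum(2)[OF theta_abs_summable[OF z] y, of "\<lambda>k. k - 1"] by (simp add: appell_theta_def)
  then have "((\<lambda>k. 1 / theta p y * (tc p k * z powi k * tfrac (k - 1) y)) has_sum (1 / theta p y * appell_theta z y)) UNIV"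
    by (rule has_sum_cmult_right)
  moreover have "1 / theta p y * (tc p k * z powi k * tfrac (k - 1) y) = tc p k * z powi k / (1 - p powi (k - 1) * y)" for k
    using t by (simp add: tfrac_eq[OF y ne])
  moreover have "1 / theta p y * appell_theta z y = appell z y" using t by (simp add: appell_theta_eq_appell[OF y ne])
  ultimately show ?thesis by simp
qed

text \<open>The condition on s makes the terms at s * z and - s * z combine so that every second term
  is again a term of a sum of base p ^ 4.\<close>

lemma appell_dissect:
  assumes s: "s ^ 2 * p = - 1" and z: "z \<noteq> 0" and u: "u \<noteq> 0"
    and ne: "\<And>k. p powi k * (s * u * z) \<noteq> 1" "\<And>k. p powi k * (- (s * u * z)) \<noteq> 1"
  defines "w \<equiv> p ^ 2 * z ^ 2"
  shows "appell (s * z) (s * u * z) - appell (- (s * z)) (- (s * u * z))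
     = - 2 * s * z * (nome.appell (p ^ 4) w (- (p * u ^ 2) * w) - u / p * nome.appell (p ^ 4) w (- (u ^ 2 / p) * w))"
proof -
  interpret P4: nome "p ^ 4" by (rule power_nome) simp
  have s0: "s \<noteq> 0" using s by auto
  define y where "y = s * u * z"
  have y: "y \<noteq> 0" "- y \<noteq> 0" using s0 u z by (simp_all add: y_def)
  define d where "d k = tc p k * (s * z) powi k / (1 - p powi (k - 1) * y) - tc p k * (- (s * z)) powi k / (1 - p powi (k - 1) * (- y))" for k
  have ne': "\<And>k. p powi k * y \<noteq> 1" "\<And>k. p powi k * (- y) \<noteq> 1" using ne by (simp_all add: y_def)
  have "(d has_sum (appell (s * z) y + - appell (- (s * z)) (- y))) UNIV"
    unfolding d_def diff_conv_add_uminus[of "_ / _"]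
    by (intro has_sum_add has_sum_uminusI appell_has_sum) (use y ne' s0 z in auto)
  then have L: "appell (s * z) y - appell (- (s * z)) (- y) = (\<Sum>\<^sub>\<infinity>l. d (2 * l)) + (\<Sum>\<^sub>\<infinity>l. d (2 * l + 1))"
    using infsum_int_parity by fastforce
  have s2: "s ^ 2 = - (1 / p)" using s p0 by (simp add: field_simps)
  have sz: "(s * z) powi (2 * l) = (-1) powi l * p powi (- l) * (z ^ 2) powi l" for l
  proof -
    have "(s * z) powi (2 * l) = ((s * z) ^ 2) powi l" using power_int_power[of "s * z" 2 l] by simp
    also have "(s * z) ^ 2 = (- 1) * (inverse p * z ^ 2)" using s2 by (simp add: power_mult_distrib divide_inverse)
    finally show ?thesis by (simp only: power_int_mult_distrib power_int_inverse power_int_minus mult.assoc)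
  qed
  have y2: "y ^ 2 = - (1 / p) * u ^ 2 * z ^ 2" unfolding y_def power_mult_distrib s2 ..
  have w: "tc (p ^ 4) l * w powi l = (-1) powi l * p powi (2 * l * l) * (z ^ 2) powi l" for l
  proof -
    have "(p ^ 2) powi l = p powi (2 * l)" using power_int_power[of p 2 l] by simp
    moreover have "p powi (2 * l * l) = p powi (2 * l * l - 2 * l) * p powi (2 * l)" unfolding powi_add[symmetric] by simp
    ultimately show ?thesis unfolding tc_p4 w_def power_int_mult_distrib by (simp add: mult_ac)
  qed
  \<comment> \<open>The poles at a and -a merge into one in a^2. Even indices see the difference of
    the two fractions, odd indices their sum, because of the sign of
    \<open>(- (s * z)) powi k\<close>.\<close>
  have frac: "1 / (1 - a) - 1 / (1 + a) = 2 * a / (1 - a ^ 2)" "1 / (1 - a) + 1 / (1 + a) = 2 / (1 - a ^ 2)"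
    if "a \<noteq> 1" "- a \<noteq> 1" for a :: complex
  proof -
    have "1 - a \<noteq> 0" "1 + a \<noteq> 0" using that by (auto simp: add_eq_0_iff)
    moreover have "1 - a ^ 2 = (1 - a) * (1 + a)" by (simp add: algebra_simps power2_eq_square)
    ultimately show "1 / (1 - a) - 1 / (1 + a) = 2 * a / (1 - a ^ 2)" "1 / (1 - a) + 1 / (1 + a) = 2 / (1 - a ^ 2)"
      by (simp_all add: field_simps)
  qed
  have a2: "(p powi k * y) ^ 2 = p powi (2 * k) * y ^ 2" for k
    using power_int_power'[of p k 2] by (simp add: power_mult_distrib mult.commute[of k])
  have p4: "(p ^ 4) powi (l - 1) = p powi (4 * l - 4)" for l
    using power_int_power[of p 4 "l - 1"] by simp
  have ev: "d (2 * l) = 2 * s * z * (u / p) * (tc (p ^ 4) l * w powi l / (1 - (p ^ 4) powi (l - 1) * (- (u ^ 2 / p) * w)))" for l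
  proof -
    define a where "a = p powi (2 * l - 1) * y"
    have "(- (s * z)) powi (2 * l) = (s * z) powi (2 * l)" by (rule power_int_minus_left_even) simp
    then have "d (2 * l) = tc p (2 * l) * (s * z) powi (2 * l) * (1 / (1 - a) - 1 / (1 + a))"
      by (simp add: d_def a_def right_diff_distrib)
    also have "1 / (1 - a) - 1 / (1 + a) = 2 * a / (1 - a ^ 2)"
      by (rule frac) (use ne'[of "2 * l - 1"] in \<open>simp_all add: a_def\<close>)
    also have "a ^ 2 = (p ^ 4) powi (l - 1) * (- (u ^ 2 / p) * w)"
    proof -
      have "2 * (2 * l - 1) = (4 * l - 4) + 2" by simp
      then show ?thesis unfolding a_def a2 y2 p4 w_def by (simp only: powi_add) (simp add: mult_ac)
    qed
    also have "tc p (2 * l) * (s * z) powi (2 * l) * (2 * a / (1 - (p ^ 4) powi (l - 1) * (- (u ^ 2 / p) * w)))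
      = 2 * s * z * u * (p powi (2 * l * l - l) * p powi (- l) * p powi (2 * l - 1)) * ((-1) powi l * (z ^ 2) powi l) / (1 - (p ^ 4) powi (l - 1) * (- (u ^ 2 / p) * w))"
      unfolding tc_even sz a_def y_def by (simp add: mult_ac)
    also have "p powi (2 * l * l - l) * p powi (- l) * p powi (2 * l - 1) = p powi (2 * l * l) / p"
    proof -
      have "p powi (2 * l * l - l) * p powi (- l) * p powi (2 * l - 1) = p powi (2 * l * l + (- 1))"
        unfolding powi_add[symmetric] by simp
      then show ?thesis unfolding powi_add by (simp add: divide_inverse)
    qed
    finally show ?thesis unfolding w by (simp add: mult_ac)
  qed
  have od: "d (2 * l + 1) = - 2 * s * z * (tc (p ^ 4) l * w powi l / (1 - (p ^ 4) powi (l - 1) * (- (p * u ^ 2) * w)))" for l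
  proof -
    define a where "a = p powi (2 * l) * y"
    have "(- (s * z)) powi (2 * l + 1) = - ((s * z) powi (2 * l + 1))" by (rule power_int_minus_left_odd) simp
    then have "d (2 * l + 1) = tc p (2 * l + 1) * (s * z) powi (2 * l + 1) * (1 / (1 - a) + 1 / (1 + a))"
      by (simp add: d_def a_def distrib_left)
    also have "1 / (1 - a) + 1 / (1 + a) = 2 / (1 - a ^ 2)"
      by (rule frac) (use ne'[of "2 * l"] in \<open>simp_all add: a_def\<close>)
    also have "a ^ 2 = (p ^ 4) powi (l - 1) * (- (p * u ^ 2) * w)"
    proof -
      have "2 * (2 * l) = (4 * l - 4) + 4" by simp
      then show ?thesis unfolding a_def a2 y2 p4 w_def using p0 by (simp only: powi_add) (simp add: eval_nat_numeral)
    qed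
    also have "(s * z) powi (2 * l + 1) = (s * z) powi (2 * l) * (s * z)"
      using s0 z by (simp add: power_int_add)
    also have "tc p (2 * l + 1) * ((s * z) powi (2 * l) * (s * z)) * (2 / (1 - (p ^ 4) powi (l - 1) * (- (p * u ^ 2) * w)))
      = - 2 * s * z * (p powi (2 * l * l + l) * p powi (- l)) * ((-1) powi l * (z ^ 2) powi l) / (1 - (p ^ 4) powi (l - 1) * (- (p * u ^ 2) * w))"
      unfolding tc_odd sz by (simp add: mult_ac)
    also have "p powi (2 * l * l + l) * p powi (- l) = p powi (2 * l * l)" unfolding powi_add[symmetric] by simp
    finally show ?thesis unfolding w by (simp add: mult_ac)
  qed
  show ?thesis
    unfolding y_def[symmetric] L ev od infsum_cmult_right' P4.appell_def by (simp add: algebra_simps)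
qed

lemma eta_nonzero: "n > 0 \<Longrightarrow> eu n \<noteq> 0"
proof -
  assume "n > 0"
  then interpret P: nome "p ^ n" by (rule power_nome)
  show ?thesis by (rule qpoch_inf_nonzero'[OF P.p1 P.p1])
qed

lemma two_pole_lerch:
  assumes z: "z0 \<noteq> 0" "z1 \<noteq> 0" "u \<noteq> 0" and t: "theta p z0 \<noteq> 0" "theta p z1 \<noteq> 0"
    and ne: "\<And>k. p powi k * (u * z0) \<noteq> 1" "\<And>k. p powi k * (u * z1) \<noteq> 1"
  shows "theta p z0 * (lerch z1 u - lerch z0 u)
    = z0 * qpoch_inf p p ^ 3 * theta p (z1 / z0) * theta p (u * z0 * z1) / (theta p z1 * theta p (u * z0) * theta p (u * z1))"
proof -
  have uz: "u * z0 \<noteq> 0" "u * z1 \<noteq> 0" using z by simp_all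
  have nz: "theta p (u * z0) \<noteq> 0" "theta p (u * z1) \<noteq> 0"
    by (rule theta_nonzero[OF uz(1) ne(1)], rule theta_nonzero[OF uz(2) ne(2)])
  have "theta p z0 * theta p (u * z0) * (theta p (u * z1) * appell z1 (u * z1))
      - theta p z1 * theta p (u * z1) * (theta p (u * z0) * appell z0 (u * z0))
    = z0 * qpoch_inf p p ^ 3 * theta p (z1 / z0) * theta p (u * z0 * z1)"
    using two_pole[OF z t(1)] unfolding appell_theta_eq_appell[OF uz(1) ne(1)] appell_theta_eq_appell[OF uz(2) ne(2)] .
  then show ?thesis unfolding lerch_def using t nz by (simp add: field_simps)
qed

text \<open>The parameter z is moved to s z and to -(s z). Weighted by their theta constants, the
  two new sums combine exactly by \<open>appell_dissect\<close>, and the difference of the weights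
  is the theta constant of the base p^4 sums by \<open>theta_dissect\<close>. The costs of the two
  moves, given by \<open>two_pole_lerch\<close>, add up to a single theta quotient.\<close>

theorem lerch_dissect:
  assumes s: "s ^ 2 * p = - 1" and z: "z \<noteq> 0" and u: "u \<noteq> 0"
    and ne: "\<And>k. p powi k * (u * z) \<noteq> 1" "\<And>k. p powi k * (s * u * z) \<noteq> 1" "\<And>k. p powi k * (- (s * u * z)) \<noteq> 1"
    and t: "theta p z \<noteq> 0" "theta p (s * z) \<noteq> 0" "theta p (- (s * z)) \<noteq> 0" "theta (p ^ 4) (p ^ 2 * z ^ 2) \<noteq> 0"
  shows "lerch z u - (nome.lerch (p ^ 4) (p ^ 2 * z ^ 2) (- (p * u ^ 2)) - u / p * nome.lerch (p ^ 4) (p ^ 2 * z ^ 2) (- (u ^ 2 / p)))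
    = - (eu 2 ^ 3 * theta p (1 / s) * theta (p ^ 2) (- (z * (u * z) ^ 2 / p))
       / (theta (p ^ 4) (p ^ 2 * z ^ 2) * theta (p ^ 2) z * theta p (u * z) * theta (p ^ 2) (- ((u * z) ^ 2 / p))))"
proof -
  interpret Q: nome "p ^ 2" by (rule power_nome) simp
  interpret P4: nome "p ^ 4" by (rule power_nome) simp
  have s0: "s \<noteq> 0" using s by auto
  define y w where "y = u * z" and "w = p ^ 2 * z ^ 2"
  have y: "y \<noteq> 0" using u z by (simp add: y_def)
  define W where "W = theta (p ^ 4) w"
  define tp tm where "tp = theta p (s * z)" and "tm = theta p (- (s * z))"
  define M where "M = P4.lerch w (- (p * u ^ 2)) - u / p * P4.lerch w (- (u ^ 2 / p))"
  have nz: "W \<noteq> 0" "tp \<noteq> 0" "tm \<noteq> 0" "theta p z \<noteq> 0" using t by (simp_all add: W_def w_def tp_def tm_def)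
  have ny: "theta p y \<noteq> 0" "theta p (s * y) \<noteq> 0" "theta p (- (s * y)) \<noteq> 0"
    using theta_nonzero[OF y] theta_nonzero[of "s * y"] theta_nonzero[of "- (s * y)"] ne y s0
    by (simp_all add: y_def mult.assoc)
  have s2: "s ^ 2 = - (1 / p)" using s p0 by (simp add: field_simps)
  have wz: "p ^ 3 * (s * z) ^ 2 = - w"
  proof -
    have "p ^ 3 * (s * z) ^ 2 = p ^ 2 * z ^ 2 * (s ^ 2 * p)" by (simp add: power_mult_distrib power2_eq_square power3_eq_cube mult_ac)
    then show ?thesis unfolding s w_def by simp
  qed
  have d: "tp - tm = - 2 * s * z * W"
  proof -
    have sz: "s * z \<noteq> 0" "- (s * z) \<noteq> 0" using s0 z by simp_all
    show ?thesis
      unfolding tp_def tm_def theta_dissect[OF sz(1)] theta_dissect[OF sz(2)] W_def by (simp add: wz)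
  qed
  have dM: "tp * lerch (s * z) u - tm * lerch (- (s * z)) u = - 2 * s * z * W * M"
  proof -
    have "tp * lerch (s * z) u - tm * lerch (- (s * z)) u = appell (s * z) (s * u * z) - appell (- (s * z)) (- (s * u * z))"
      unfolding lerch_def using nz by (simp add: tp_def tm_def mult_ac)
    also have "\<dots> = - 2 * s * z * (P4.appell w (- (p * u ^ 2) * w) - u / p * P4.appell w (- (u ^ 2 / p) * w))"
      unfolding w_def by (rule appell_dissect[OF s z u ne(2,3)])
    also have "\<dots> = - 2 * s * z * W * M"
      unfolding M_def P4.lerch_def using nz(1) by (simp add: W_def right_diff_distrib)
    finally show ?thesis .
  qed
  define J T where "J = qpoch_inf p p" and "T = theta p (1 / s)"
  \<comment> \<open>From s^2 p = -1 follows p s = -1/s, so the two changes of parameter cost the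
    same theta factor.\<close>
  have T: "theta p (- (1 / s)) = T"
  proof -
    have "p / (1 / s) = - (1 / s)" using s2 s0 p0 s by (simp add: field_simps power2_eq_square)
    then show ?thesis using theta_p_divide[of "1 / s"] s0 by (simp add: T_def)
  qed
  have p1: "tp * (lerch z u - lerch (s * z) u) = s * z * J ^ 3 * T * theta p (s * z * y) / (theta p z * theta p (s * y) * theta p y)"
  proof -
    have e: "z / (s * z) = 1 / s" "u * (s * z) = s * y" "s * y * z = s * z * y" using z by (simp_all add: y_def)
    have "\<And>k. p powi k * (u * (s * z)) \<noteq> 1" using ne(2) by (simp add: mult_ac)
    from two_pole_lerch[OF _ z u _ t(1) this ne(1)] show ?thesis
      using s0 z nz unfolding e J_def T_def tp_def y_def[symmetric] by simp
  qed
  have p2: "tm * (lerch z u - lerch (- (s * z)) u) = - (s * z) * J ^ 3 * T * theta p (- (s * z * y)) / (theta p z * theta p (- (s * y)) * theta p y)"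
  proof -
    have e: "z / (- (s * z)) = - (1 / s)" "u * (- (s * z)) = - (s * y)" "- (s * y) * z = - (s * z * y)" using z by (simp_all add: y_def)
    have "\<And>k. p powi k * (u * (- (s * z))) \<noteq> 1" using ne(3) by (simp add: mult_ac)
    from two_pole_lerch[OF _ z u _ t(1) this ne(1)] show ?thesis
      using s0 z nz unfolding e T J_def tm_def y_def[symmetric] by simp
  qed
  define R where "R = theta p (s * z * y) * theta p (- (s * y)) + theta p (- (s * z * y)) * theta p (s * y)"
  have "- 2 * s * z * W * (lerch z u - M) = (tp - tm) * lerch z u - (tp * lerch (s * z) u - tm * lerch (- (s * z)) u)"
    unfolding d dM by (simp add: algebra_simps)
  also have "\<dots> = tp * (lerch z u - lerch (s * z) u) - tm * (lerch z u - lerch (- (s * z)) u)" by (simp add: algebra_simps)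
  also have "\<dots> = s * z * J ^ 3 * T * R / (theta p z * theta p y * (theta p (s * y) * theta p (- (s * y))))"
    unfolding p1 p2 R_def using nz ny by (simp add: field_simps)
  finally have main: "- 2 * s * z * W * (lerch z u - M) = s * z * J ^ 3 * T * R / (theta p z * theta p y * (theta p (s * y) * theta p (- (s * y))))" .
  define A B where "A = theta (p ^ 2) (- (z * y ^ 2 / p))" and "B = theta (p ^ 2) (- (y ^ 2 / p))"
  \<comment> \<open>In the two expansions by \<open>theta_mult\<close> the first products agree,
    while the second ones carry the opposite prefactors s z y and -(s z y) and cancel.\<close>
  have R: "R = 2 * A * theta (p ^ 2) (p * z)"
  proof -
    have n: "s * z * y \<noteq> 0" "- (s * y) \<noteq> 0" "- (s * z * y) \<noteq> 0" "s * y \<noteq> 0" using s0 z y by simp_all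
    have e1: "- (s * z * y * - (s * y)) = - (z * y ^ 2 / p)" "- (- (s * z * y) * (s * y)) = - (z * y ^ 2 / p)"
    proof -
      have "s * z * y * (s * y) = s ^ 2 * (z * y ^ 2)" by (simp add: power2_eq_square mult_ac)
      then show "- (s * z * y * - (s * y)) = - (z * y ^ 2 / p)" "- (- (s * z * y) * (s * y)) = - (z * y ^ 2 / p)"
        unfolding s2 by simp_all
    qed
    have e2: "- (p * - (s * y) / (s * z * y)) = p / z" "- (p * (s * y) / (- (s * z * y))) = p / z"
      using s0 y by simp_all
    have e3: "p * - (s * z * y) * (s * y) = p * (s * z * y) * - (s * y)" "s * y / - (s * z * y) = - (s * y) / (s * z * y)"
      by simp_all
    have "p ^ 2 / (p * z) = p / z" using p0 by (simp add: power2_eq_square)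
    then have e4: "theta (p ^ 2) (p / z) = theta (p ^ 2) (p * z)"
      using Q.theta_p_divide[of "p * z"] p0 z by simp
    show ?thesis
      unfolding R_def theta_mult[OF n(1,2)] theta_mult[OF n(3,4)] e1 e2 e3 e4 A_def by (simp add: algebra_simps)
  qed
  have B: "theta p (s * y) * theta p (- (s * y)) * eu 2 = B * J ^ 2"
  proof -
    have "(s * y) ^ 2 = - (y ^ 2 / p)" unfolding power_mult_distrib s2 by simp
    then show ?thesis using theta_mult_minus[of "s * y"] s0 y by (simp add: B_def J_def)
  qed
  have Z: "theta p z * eu 2 ^ 2 = theta (p ^ 2) z * theta (p ^ 2) (p * z) * J"
    using theta_split_2[OF z] by (simp add: J_def)
  have J: "J \<noteq> 0" "eu 2 \<noteq> 0" using eta_nonzero[of 1] eta_nonzero[of 2] by (simp_all add: J_def)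
  define K where "K = theta (p ^ 2) (p * z)"
  have nzz: "theta (p ^ 2) z \<noteq> 0" "K \<noteq> 0" using Z nz(4) J by (auto simp: K_def)
  have Bnz: "B \<noteq> 0" using B ny J by auto
  have Zv: "theta p z = theta (p ^ 2) z * K * J / eu 2 ^ 2" using Z J by (simp add: field_simps K_def)
  have Bv: "theta p (s * y) * theta p (- (s * y)) = B * J ^ 2 / eu 2" using B J by (simp add: field_simps)
  have "lerch z u - M = (s * z * J ^ 3 * T * R / (theta p z * theta p y * (theta p (s * y) * theta p (- (s * y))))) / (- 2 * s * z * W)"
    by (rule eq_divide_imp) (use s0 z nz in simp, use main in \<open>simp only: mult.commute\<close>)
  also have "\<dots> = - (eu 2 ^ 3 * T * A / (W * theta (p ^ 2) z * theta p y * B))"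
    unfolding R K_def[symmetric] Zv Bv using s0 z nz(1) ny(1) J nzz Bnz
    by (simp add: field_simps power2_eq_square power3_eq_cube)
  finally show ?thesis unfolding M_def A_def B_def W_def w_def T_def y_def .
qed

text \<open>The fourth power covers s = 1, -1 and the imaginary units at once; the latter enter
  through s = i / p^5.\<close>

lemma root_of_unity_powi:
  assumes "s ^ 4 = 1" "k \<noteq> 0"
  shows "s * p powi k \<noteq> 1"
proof
  assume "s * p powi k = 1"
  then have "(s * p powi k) ^ 4 = 1" by simp
  then have "p powi (k * 4) = 1" using power_int_power'[of p k 4] assms(1) by (simp add: power_mult_distrib)
  then show False using assms(2) by (simp add: powi_eq_1_iff)
qed

lemma no_pole:
  assumes "s ^ 4 = 1" "n > 0" "\<not> int n dvd e"
  shows "(p ^ n) powi k * (s * p powi e) \<noteq> 1"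
proof -
  have "(p ^ n) powi k * (s * p powi e) = s * p powi (int n * k + e)"
    using power_int_power[of p n k] by (simp add: powi_add)
  moreover have "int n * k + e \<noteq> 0"
  proof
    assume "int n * k + e = 0"
    then have "e = int n * (- k)" by simp
    with assms(3) show False by (metis dvd_triv_left)
  qed
  ultimately show ?thesis using root_of_unity_powi[OF assms(1), of "int n * k + e"] by metis
qed

lemma theta_power_nonzero:
  assumes "s ^ 4 = 1" "n > 0" "\<not> int n dvd e"
  shows "theta (p ^ n) (s * p powi e) \<noteq> 0"
proof -
  interpret P: nome "p ^ n" by (rule power_nome[OF assms(2)])
  have "s \<noteq> 0" using assms(1) by auto
  then show ?thesis by (intro P.theta_nonzero no_pole[OF assms]) (use p0 in simp)
qed

end

section \<open>The theta identity\<close>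

text \<open>The letters record theta values: a_k and b_k are those of base p^10 at p^k and -p^k, c_k
  and d_k those of base p^20; h4, g' and g are those of base p^40 at p^4, p^8 and p^24. J10, J20,
  J40 are Euler products, while e, f, g5 stand for (-p^5;p^10), (-p^10;p^20), (p^10;p^20). X, Y, TH,
  T1, T2 are the remaining theta functions.\<close>

lemma final_algebra:
  fixes J10 :: complex
  assumes "a1 \<noteq> 0" "a3 \<noteq> 0" "b1 \<noteq> 0" "b3 \<noteq> 0" "c2 \<noteq> 0" "c4 \<noteq> 0" "c6 \<noteq> 0" "d4 \<noteq> 0" "d8 \<noteq> 0"
    "g5 \<noteq> 0" "g \<noteq> 0" "g' \<noteq> 0" "J10 \<noteq> 0" "J20 \<noteq> 0" "J40 \<noteq> 0"
    and E1: "a1 * b1 * J20 = c2 * J10 ^ 2" and E2: "a3 * b3 * J20 = c6 * J10 ^ 2"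
    and E3: "b4 * J20 ^ 2 = d4 * d6 * J10" and E4: "b2 * J20 ^ 2 = d2 * d8 * J10"
    and E5: "b4 * a3 + p * (b2 * a1) = X * Y"
    and E9: "X * J10 = b1 * a4 * e" and E10: "Y * J10 = a2 * b3 * e"
    and E11: "TH * J10 ^ 5 = b1 ^ 2 * b3 ^ 2 * e ^ 2 * a2 * a4"
    and E12: "T1 * J20 = d2 * c8 * f" and E13: "T2 * J20 ^ 2 * J40 = c2 * c6 * g5 * g' * g"
    and E14: "J10 = g5 * J20" and E15: "c2 * d2 * J40 = h4 * J20 ^ 2" and E16: "c8 * d8 * J40 = g * J20 ^ 2"
    and E17: "c4 * J40 ^ 2 = h4 * g * J20" and E18: "c4 * d4 * J40 = g' * J20 ^ 2"
  shows "J20 ^ 3 * (f * J10) / (g * c2) * (d6 / (a1 * d8) + p * d2 / (a3 * d4)) = TH * T1 / T2"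
proof -
  have k1: "J20 ^ 5 * g' = c2 * d2 * c8 * d8 * d4 * J40"
  proof -
    have "(c2 * d2 * c8 * d8 * d4 * J40) * (c4 * J40 ^ 2) = (c2 * d2 * J40) * (c8 * d8 * J40) * (c4 * d4 * J40)"
      by (simp add: power2_eq_square mult_ac)
    also have "\<dots> = J20 ^ 5 * g' * (c4 * J40 ^ 2)"
      unfolding E15 E16 E18 E17 by (simp add: eval_nat_numeral mult_ac)
    finally show ?thesis using assms(6,15) by simp
  qed
  have k2: "(d6 * a3 * d4 + p * d2 * a1 * d8) * J10 = J20 ^ 2 * (X * Y)"
  proof -
    have "(d6 * a3 * d4 + p * d2 * a1 * d8) * J10 = (d4 * d6 * J10) * a3 + p * (d2 * d8 * J10) * a1"
      by (simp add: algebra_simps)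
    also have "\<dots> = J20 ^ 2 * (b4 * a3 + p * (b2 * a1))" unfolding E3[symmetric] E4[symmetric] by (simp add: algebra_simps)
    finally show ?thesis unfolding E5 .
  qed
  have k3: "TH * J10 ^ 3 = X * Y * (b1 * b3)"
  proof -
    have "TH * J10 ^ 3 * J10 ^ 2 = TH * J10 ^ 5" by (simp add: eval_nat_numeral mult_ac)
    also have "\<dots> = (X * J10) * (Y * J10) * (b1 * b3)"
      unfolding E11 E9 E10 by (simp add: power2_eq_square mult_ac)
    also have "\<dots> = X * Y * (b1 * b3) * J10 ^ 2" by (simp add: power2_eq_square mult_ac)
    finally show ?thesis using assms(13) by simp
  qed
  have k4: "a1 * a3 * (b1 * b3) * J20 ^ 2 = c2 * c6 * J10 ^ 4"
  proof -
    have "a1 * a3 * (b1 * b3) * J20 ^ 2 = (a1 * b1 * J20) * (a3 * b3 * J20)" by (simp add: power2_eq_square mult_ac)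
    then show ?thesis unfolding E1 E2 by (simp add: eval_nat_numeral mult_ac)
  qed
  have XY: "X * Y = TH * J10 ^ 3 / (b1 * b3)" using k3 assms by (simp add: field_simps)
  have aa: "a1 * a3 = c2 * c6 * J10 ^ 4 / ((b1 * b3) * J20 ^ 2)" using k4 assms by (simp add: field_simps)
  have N: "d6 * a3 * d4 + p * d2 * a1 * d8 = J20 ^ 2 * (X * Y) / J10" using k2 assms(13) by (simp add: field_simps)
  have "d6 / (a1 * d8) + p * d2 / (a3 * d4) = (d6 * a3 * d4 + p * d2 * a1 * d8) / ((a1 * a3) * (d4 * d8))"
    using assms by (simp add: field_simps)
  also have "\<dots> = J20 ^ 4 * TH / (J10 ^ 2 * c2 * c6 * d4 * d8)"
    unfolding N XY aa using assms(3-5,7-9,13,14) by (simp add: field_simps eval_nat_numeral)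
  finally have S: "d6 / (a1 * d8) + p * d2 / (a3 * d4) = J20 ^ 4 * TH / (J10 ^ 2 * c2 * c6 * d4 * d8)" .
  have "J20 ^ 3 * (f * J10) / (g * c2) * (d6 / (a1 * d8) + p * d2 / (a3 * d4))
    = TH * (J20 ^ 7 * f / (g * c2 ^ 2 * c6 * J10 * d4 * d8))"
    unfolding S using assms(5,7-9,11,13,14) by (simp add: field_simps eval_nat_numeral)
  also have "J20 ^ 7 * f / (g * c2 ^ 2 * c6 * J10 * d4 * d8) = J20 ^ 6 * f / (g * c2 ^ 2 * c6 * g5 * d4 * d8)"
    unfolding E14 using assms(5,7-11,14) by (simp add: field_simps eval_nat_numeral)
  also have "J20 ^ 6 * f / (g * c2 ^ 2 * c6 * g5 * d4 * d8) = (J20 ^ 5 * g') * (J20 * f) / (g * c2 ^ 2 * c6 * g5 * d4 * d8 * g')"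
    using assms(12) by (simp add: field_simps eval_nat_numeral)
  also have "\<dots> = d2 * c8 * f * J20 * J40 / (c2 * c6 * g5 * g' * g)"
    unfolding k1 using assms(5,7-12) by (simp add: field_simps eval_nat_numeral)
  also have "\<dots> = T1 / T2"
    unfolding E12[symmetric] E13[symmetric] using assms(14,15) by (simp add: field_simps power2_eq_square)
  finally show ?thesis by simp
qed

context nome
begin

section \<open>Theta values at powers of p, split to bases p^10, p^20 and p^40\<close>

lemma theta_power:
  assumes "k \<le> n" "n > 0"
  shows "theta (p ^ n) (p ^ k) = qpoch_inf (p ^ k) (p ^ n) * qpoch_inf (p ^ (n - k)) (p ^ n) * eu n"
    and "theta (p ^ n) (- (p ^ k)) = qpoch_inf (- (p ^ k)) (p ^ n) * qpoch_inf (- (p ^ (n - k))) (p ^ n) * eu n"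
proof -
  interpret P: nome "p ^ n" by (rule power_nome[OF assms(2)])
  have e: "p ^ n / p ^ k = p ^ (n - k)" using p0 assms(1) by (simp add: power_diff)
  have n: "p ^ k \<noteq> 0" "- (p ^ k) \<noteq> 0" using p0 by simp_all
  show "theta (p ^ n) (p ^ k) = qpoch_inf (p ^ k) (p ^ n) * qpoch_inf (p ^ (n - k)) (p ^ n) * eu n"
    "theta (p ^ n) (- (p ^ k)) = qpoch_inf (- (p ^ k)) (p ^ n) * qpoch_inf (- (p ^ (n - k))) (p ^ n) * eu n"
    unfolding P.theta_eq_jtheta[OF n(1)] P.theta_eq_jtheta[OF n(2)] jtheta_def by (simp_all add: e)
qed

lemma theta_power_reflect:
  assumes "k \<le> n" "n > 0"
  shows "theta (p ^ n) (p ^ k) = theta (p ^ n) (p ^ (n - k))"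
    and "theta (p ^ n) (- (p ^ k)) = theta (p ^ n) (- (p ^ (n - k)))"
  using assms by (simp_all add: theta_power)

lemma prod_lessThan_5: "(\<Prod>i<5. f i) = f 0 * f 1 * f 2 * f 3 * f (4::nat)" for f :: "nat \<Rightarrow> complex"
  by (simp add: eval_nat_numeral)

lemma norm_power_less: "n > 0 \<Longrightarrow> norm (p ^ n) < 1"
  using nome.p1[OF power_nome] .

lemma qpoch_inf_power_split:
  assumes "0 < n" "0 < m"
  shows "qpoch_inf (p ^ k) (p ^ n) = (\<Prod>i<m. qpoch_inf (p ^ (k + n * i)) (p ^ (n * m)))"
    and "qpoch_inf (- (p ^ k)) (p ^ n) = (\<Prod>i<m. qpoch_inf (- (p ^ (k + n * i))) (p ^ (n * m)))"
  using qpoch_inf_split[OF norm_power_less[OF assms(1)] assms(2)]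
  by (simp_all add: power_mult[symmetric] power_add mult.commute)

text \<open>Every product is split by residues modulo 10; then k and 10 - k are paired, with 5 left
  alone.\<close>

lemma theta_2_split: "theta (p ^ 2) (- p) * eu 10 ^ 5
  = theta (p ^ 10) (- p) ^ 2 * theta (p ^ 10) (- (p ^ 3)) ^ 2 * qpoch_inf (- (p ^ 5)) (p ^ 10) ^ 2
    * theta (p ^ 10) (p ^ 2) * theta (p ^ 10) (p ^ 4)"
proof -
  have "theta (p ^ 2) (- p) = qpoch_inf (- p) (p ^ 2) ^ 2 * eu 2"
    using theta_power(2)[of 1 2] by (simp add: power2_eq_square)
  moreover have "qpoch_inf (- p) (p ^ 2) = qpoch_inf (- p) (p ^ 10) * qpoch_inf (- (p ^ 3)) (p ^ 10)
    * qpoch_inf (- (p ^ 5)) (p ^ 10) * qpoch_inf (- (p ^ 7)) (p ^ 10) * qpoch_inf (- (p ^ 9)) (p ^ 10)"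
    using qpoch_inf_power_split(2)[of 2 5 1] unfolding prod_lessThan_5 by (simp add: power3_eq_cube mult_ac)
  moreover have "eu 2 = qpoch_inf (p ^ 2) (p ^ 10) * qpoch_inf (p ^ 4) (p ^ 10)
    * qpoch_inf (p ^ 6) (p ^ 10) * qpoch_inf (p ^ 8) (p ^ 10) * eu 10"
    using qpoch_inf_power_split(1)[of 2 5 2] unfolding prod_lessThan_5 by simp
  moreover have "theta (p ^ 10) (- p) = qpoch_inf (- p) (p ^ 10) * qpoch_inf (- (p ^ 9)) (p ^ 10) * eu 10"
    using theta_power(2)[of 1 10] by simp
  moreover have "theta (p ^ 10) (- (p ^ 3)) = qpoch_inf (- (p ^ 3)) (p ^ 10) * qpoch_inf (- (p ^ 7)) (p ^ 10) * eu 10"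
    using theta_power(2)[of 3 10] by simp
  moreover have "theta (p ^ 10) (p ^ 2) = qpoch_inf (p ^ 2) (p ^ 10) * qpoch_inf (p ^ 8) (p ^ 10) * eu 10"
    using theta_power(1)[of 2 10] by simp
  moreover have "theta (p ^ 10) (p ^ 4) = qpoch_inf (p ^ 4) (p ^ 10) * qpoch_inf (p ^ 6) (p ^ 10) * eu 10"
    using theta_power(1)[of 4 10] by simp
  ultimately show ?thesis by (simp only: power_mult_distrib) (simp add: eval_nat_numeral)
qed

lemma theta_4_split: "theta (p ^ 4) p * eu 10 ^ 2 * eu 20
  = theta (p ^ 10) p * theta (p ^ 10) (p ^ 3) * qpoch_inf (p ^ 5) (p ^ 10) * theta (p ^ 20) (p ^ 4) * theta (p ^ 20) (p ^ 8)"
proof -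
  have two: "(\<Prod>i<2. f i) = f 0 * f (1::nat)" for f :: "nat \<Rightarrow> complex" by (simp add: eval_nat_numeral)
  have "theta (p ^ 4) p = qpoch_inf p (p ^ 4) * qpoch_inf (p ^ 3) (p ^ 4) * eu 4"
    using theta_power(1)[of 1 4] by simp
  moreover have "qpoch_inf p (p ^ 4) = qpoch_inf p (p ^ 20) * qpoch_inf (p ^ 5) (p ^ 20)
    * qpoch_inf (p ^ 9) (p ^ 20) * qpoch_inf (p ^ 13) (p ^ 20) * qpoch_inf (p ^ 17) (p ^ 20)"
    using qpoch_inf_power_split(1)[of 4 5 1] unfolding prod_lessThan_5 by simp
  moreover have "qpoch_inf (p ^ 3) (p ^ 4) = qpoch_inf (p ^ 3) (p ^ 20) * qpoch_inf (p ^ 7) (p ^ 20)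
    * qpoch_inf (p ^ 11) (p ^ 20) * qpoch_inf (p ^ 15) (p ^ 20) * qpoch_inf (p ^ 19) (p ^ 20)"
    using qpoch_inf_power_split(1)[of 4 5 3] unfolding prod_lessThan_5 by simp
  moreover have "eu 4 = qpoch_inf (p ^ 4) (p ^ 20) * qpoch_inf (p ^ 8) (p ^ 20)
    * qpoch_inf (p ^ 12) (p ^ 20) * qpoch_inf (p ^ 16) (p ^ 20) * eu 20"
    using qpoch_inf_power_split(1)[of 4 5 4] unfolding prod_lessThan_5 by simp
  moreover have "theta (p ^ 10) p = qpoch_inf p (p ^ 20) * qpoch_inf (p ^ 11) (p ^ 20)
      * (qpoch_inf (p ^ 9) (p ^ 20) * qpoch_inf (p ^ 19) (p ^ 20)) * eu 10"
    using theta_power(1)[of 1 10] qpoch_inf_power_split(1)[of 10 2 1] qpoch_inf_power_split(1)[of 10 2 9]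
    unfolding two by simp
  moreover have "theta (p ^ 10) (p ^ 3) = qpoch_inf (p ^ 3) (p ^ 20) * qpoch_inf (p ^ 13) (p ^ 20)
      * (qpoch_inf (p ^ 7) (p ^ 20) * qpoch_inf (p ^ 17) (p ^ 20)) * eu 10"
    using theta_power(1)[of 3 10] qpoch_inf_power_split(1)[of 10 2 3] qpoch_inf_power_split(1)[of 10 2 7]
    unfolding two by simp
  moreover have "qpoch_inf (p ^ 5) (p ^ 10) = qpoch_inf (p ^ 5) (p ^ 20) * qpoch_inf (p ^ 15) (p ^ 20)"
    using qpoch_inf_power_split(1)[of 10 2 5] unfolding two by simp
  moreover have "theta (p ^ 20) (p ^ 4) = qpoch_inf (p ^ 4) (p ^ 20) * qpoch_inf (p ^ 16) (p ^ 20) * eu 20"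
    using theta_power(1)[of 4 20] by simp
  moreover have "theta (p ^ 20) (p ^ 8) = qpoch_inf (p ^ 8) (p ^ 20) * qpoch_inf (p ^ 12) (p ^ 20) * eu 20"
    using theta_power(1)[of 8 20] by simp
  ultimately show ?thesis by (simp only: power2_eq_square mult_ac)
qed

text \<open>Squaring the base -p^5 splits each product into two of base p^10; the shift by -p^5
  changes the sign as well as the exponent.\<close>

lemma theta_neg_5_split:
  "theta (- (p ^ 5)) (- p) * eu 10 = theta (p ^ 10) (- p) * theta (p ^ 10) (p ^ 4) * qpoch_inf (- (p ^ 5)) (p ^ 10)"
  "theta (- (p ^ 5)) (p ^ 2) * eu 10 = theta (p ^ 10) (p ^ 2) * theta (p ^ 10) (- (p ^ 3)) * qpoch_inf (- (p ^ 5)) (p ^ 10)"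
proof -
  interpret P5: nome "p ^ 5" by (rule power_nome) simp
  interpret R: nome "- (p ^ 5)" by (rule P5.minus_nome)
  have s: "qpoch_inf x (- (p ^ 5)) = qpoch_inf x (p ^ 10) * qpoch_inf (- (p ^ 5) * x) (p ^ 10)" for x
    using qpoch_inf_split_2[OF R.p1, of x] by (simp add: power_mult[symmetric])
  have q: "- (p ^ 5) / (- p) = p ^ 4" "- (p ^ 5) / p ^ 2 = - (p ^ 3)" using p0 by (simp_all add: eval_nat_numeral)
  have m: "- (p ^ 5) * (- p) = p ^ 6" "- (p ^ 5) * p ^ 4 = - (p ^ 9)" "- (p ^ 5) * p ^ 2 = - (p ^ 7)"
    "- (p ^ 5) * (- (p ^ 3)) = p ^ 8" "- (p ^ 5) * (- (p ^ 5)) = p ^ 10" by (simp_all add: eval_nat_numeral)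
  have j: "theta (- (p ^ 5)) (- p) = jtheta (- p) (- (p ^ 5))" "theta (- (p ^ 5)) (p ^ 2) = jtheta (p ^ 2) (- (p ^ 5))"
    by (rule R.theta_eq_jtheta; use p0 in simp)+
  have t: "theta (p ^ 10) (- p) = qpoch_inf (- p) (p ^ 10) * qpoch_inf (- (p ^ 9)) (p ^ 10) * eu 10"
    "theta (p ^ 10) (p ^ 4) = qpoch_inf (p ^ 4) (p ^ 10) * qpoch_inf (p ^ 6) (p ^ 10) * eu 10"
    "theta (p ^ 10) (p ^ 2) = qpoch_inf (p ^ 2) (p ^ 10) * qpoch_inf (p ^ 8) (p ^ 10) * eu 10"
    "theta (p ^ 10) (- (p ^ 3)) = qpoch_inf (- (p ^ 3)) (p ^ 10) * qpoch_inf (- (p ^ 7)) (p ^ 10) * eu 10"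
    using theta_power(2)[of 1 10] theta_power(1)[of 4 10] theta_power(1)[of 2 10] theta_power(2)[of 3 10] by simp_all
  show "theta (- (p ^ 5)) (- p) * eu 10 = theta (p ^ 10) (- p) * theta (p ^ 10) (p ^ 4) * qpoch_inf (- (p ^ 5)) (p ^ 10)"
    "theta (- (p ^ 5)) (p ^ 2) * eu 10 = theta (p ^ 10) (p ^ 2) * theta (p ^ 10) (- (p ^ 3)) * qpoch_inf (- (p ^ 5)) (p ^ 10)"
    unfolding j jtheta_def q s m t by (simp_all only: mult_ac)
qed

text \<open>All four theta values on the left expand over c_1, c_3, c_7, c_9 of base p^20, where the
  sum factors as (c_7 + p c_3)(c_9 - p^2 c_1). Each factor is a two-term dissection of a theta
  function of base -p^5, whose fourth power is p^20.\<close>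

lemma theta_neg_5_mult:
  "theta (p ^ 10) (- (p ^ 4)) * theta (p ^ 10) (p ^ 3) + p * (theta (p ^ 10) (- (p ^ 2)) * theta (p ^ 10) p)
   = theta (- (p ^ 5)) (- p) * theta (- (p ^ 5)) (p ^ 2)"
proof -
  interpret P: nome "p ^ 10" by (rule power_nome) simp
  interpret P5: nome "p ^ 5" by (rule power_nome) simp
  interpret R: nome "- (p ^ 5)" by (rule P5.minus_nome)
  define c where "c k = theta (p ^ 20) (p ^ k)" for k
  have c: "c 11 = c 9" "c 17 = c 3" "c 13 = c 7" "c 19 = c 1"
    using theta_power_reflect(1)[of 11 20] theta_power_reflect(1)[of 17 20] theta_power_reflect(1)[of 13 20]
      theta_power_reflect(1)[of 19 20] by (simp_all add: c_def)
  have n: "p ^ k \<noteq> 0" "- (p ^ k) \<noteq> 0" for k using p0 by simp_all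
  have i: "- (p ^ 3 * - (p ^ 4)) = p ^ 7" "- (p ^ 10 * - (p ^ 4) / p ^ 3) = p ^ 11"
      "- (p ^ 10 * p ^ 3 * - (p ^ 4)) = p ^ 17" "- (- (p ^ 4) / p ^ 3) = p ^ 1" "(p ^ 10) ^ 2 = p ^ 20"
    "- (p ^ 1 * - (p ^ 2)) = p ^ 3" "- (p ^ 10 * - (p ^ 2) / p ^ 1) = p ^ 11"
      "- (p ^ 10 * p ^ 1 * - (p ^ 2)) = p ^ 13" "- (- (p ^ 2) / p ^ 1) = p ^ 1"
    "(- (p ^ 5)) ^ 4 = p ^ 20" "- (- (p ^ 5) * (- (p ^ 1)) ^ 2) = p ^ 7" "- ((- (p ^ 5)) ^ 3 * (- (p ^ 1)) ^ 2) = p ^ 17"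
    "- (- (p ^ 5) * (p ^ 2) ^ 2) = p ^ 9" "- ((- (p ^ 5)) ^ 3 * (p ^ 2) ^ 2) = p ^ 19"
    using p0 by (simp_all add: eval_nat_numeral)
  have 1: "theta (p ^ 10) (p ^ 3) * theta (p ^ 10) (- (p ^ 4)) = c 7 * c 9 - p ^ 3 * (c 3 * c 1)"
    unfolding P.theta_mult[OF n(1) n(2)] i c_def[symmetric] c ..
  have 2: "theta (p ^ 10) (p ^ 1) * theta (p ^ 10) (- (p ^ 2)) = c 3 * c 9 - p ^ 1 * (c 7 * c 1)"
    unfolding P.theta_mult[OF n(1) n(2)] i c_def[symmetric] c ..
  have 3: "theta (- (p ^ 5)) (- (p ^ 1)) = c 7 - - (p ^ 1) * c 3"
    unfolding R.theta_dissect[OF n(2)] i c_def[symmetric] c ..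
  have 4: "theta (- (p ^ 5)) (p ^ 2) = c 9 - p ^ 2 * c 1"
    unfolding R.theta_dissect[OF n(1)] i c_def[symmetric] c ..
  have "theta (p ^ 10) (- (p ^ 4)) * theta (p ^ 10) (p ^ 3) + p * (theta (p ^ 10) (- (p ^ 2)) * theta (p ^ 10) p)
    = (c 7 * c 9 - p ^ 3 * (c 3 * c 1)) + p * (c 3 * c 9 - p * (c 7 * c 1))"
    using 1 2 by (simp add: mult_ac)
  also have "\<dots> = (c 7 + p * c 3) * (c 9 - p ^ 2 * c 1)"
    by (simp add: algebra_simps power2_eq_square power3_eq_cube)
  also have "\<dots> = theta (- (p ^ 5)) (- p) * theta (- (p ^ 5)) (p ^ 2)"
    using 3 4 by simp
  finally show ?thesis .
qed

lemma theta_10_imaginary: "theta (p ^ 10) (1 / (\<i> / p ^ 5)) = qpoch_inf (- (p ^ 10)) (p ^ 20) * eu 10"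
proof -
  interpret P: nome "p ^ 10" by (rule power_nome) simp
  have x: "1 / (\<i> / p ^ 5) = - (\<i> * p ^ 5)" "p ^ 10 / (- (\<i> * p ^ 5)) = \<i> * p ^ 5" "(\<i> * p ^ 5) ^ 2 = - (p ^ 10)"
    using p0 by (simp_all add: field_simps power_mult_distrib flip: power_add power_mult)
  have "- (\<i> * p ^ 5) \<noteq> 0" using p0 by simp
  from P.theta_eq_jtheta[OF this] qpoch_inf_mult_minus[OF P.p1, of "\<i> * p ^ 5"] show ?thesis
    unfolding x jtheta_def by (simp add: power_mult[symmetric] mult_ac)
qed

text \<open>The bracket collects what the dissections of the two sums for phi leave behind. Over a
  common denominator its numerator becomes, by \<open>theta_split_2\<close>, the left side of
  \<open>theta_neg_5_mult\<close>.\<close>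

theorem theta_identity:
  "eu 20 ^ 3 * theta (p ^ 10) (1 / (\<i> / p ^ 5)) / (theta (p ^ 40) (p ^ 24) * theta (p ^ 20) (p ^ 2))
    * (theta (p ^ 20) (- (p ^ 6)) / (theta (p ^ 10) p * theta (p ^ 20) (- (p ^ 8)))
       + p * theta (p ^ 20) (- (p ^ 2)) / (theta (p ^ 10) (p ^ 3) * theta (p ^ 20) (- (p ^ 4))))
   = theta (p ^ 2) (- p) * theta (- (p ^ 10)) (- (p ^ 2)) / theta (p ^ 8) (p ^ 2)"
proof -
  interpret P2: nome "p ^ 2" by (rule power_nome) simp
  interpret P10: nome "p ^ 10" by (rule power_nome) simp
  interpret P20: nome "p ^ 20" by (rule power_nome) simp
  have nz: "p ^ k \<noteq> 0" "- (p ^ k) \<noteq> 0" for k using p0 by simp_all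
  have pw: "(p ^ a) ^ b = p ^ (a * b)" for a b by (simp add: power_mult)
  have tp: "theta (p ^ n) (p ^ k) \<noteq> 0" "theta (p ^ n) (- (p ^ k)) \<noteq> 0" if "n > 0" "\<not> n dvd k" for n k
    using theta_power_nonzero[of 1 n "int k"] theta_power_nonzero[of "- 1" n "int k"] that by simp_all
  show ?thesis
    unfolding theta_10_imaginary
  proof (rule final_algebra[where ?b1.0 = "theta (p ^ 10) (- p)" and ?b3.0 = "theta (p ^ 10) (- (p ^ 3))"
        and ?c4.0 = "theta (p ^ 20) (p ^ 4)" and ?c6.0 = "theta (p ^ 20) (p ^ 6)"
        and ?g5.0 = "qpoch_inf (p ^ 10) (p ^ 20)" and g' = "theta (p ^ 40) (p ^ 8)" and ?J40.0 = "eu 40"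
        and ?b4.0 = "theta (p ^ 10) (- (p ^ 4))" and ?b2.0 = "theta (p ^ 10) (- (p ^ 2))"
        and X = "theta (- (p ^ 5)) (- p)" and Y = "theta (- (p ^ 5)) (p ^ 2)"
        and ?a2.0 = "theta (p ^ 10) (p ^ 2)" and ?a4.0 = "theta (p ^ 10) (p ^ 4)" and e = "qpoch_inf (- (p ^ 5)) (p ^ 10)"
        and ?c8.0 = "theta (p ^ 20) (p ^ 8)" and ?h4.0 = "theta (p ^ 40) (p ^ 4)"])
    show "theta (p ^ 10) p \<noteq> 0" "theta (p ^ 10) (- p) \<noteq> 0" using tp[of 10 1] by simp_all
    show "theta (p ^ 10) (p ^ 3) \<noteq> 0" "theta (p ^ 10) (- (p ^ 3)) \<noteq> 0"
      "theta (p ^ 20) (p ^ 2) \<noteq> 0" "theta (p ^ 20) (p ^ 4) \<noteq> 0" "theta (p ^ 20) (p ^ 6) \<noteq> 0"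
      "theta (p ^ 20) (- (p ^ 4)) \<noteq> 0" "theta (p ^ 20) (- (p ^ 8)) \<noteq> 0"
      "theta (p ^ 40) (p ^ 24) \<noteq> 0" "theta (p ^ 40) (p ^ 8) \<noteq> 0"
      using tp by simp_all
    show "eu 10 \<noteq> 0" "eu 20 \<noteq> 0" "eu 40 \<noteq> 0" by (rule eta_nonzero; simp)+
    show e14: "eu 10 = qpoch_inf (p ^ 10) (p ^ 20) * eu 20"
      using qpoch_inf_split_2[OF P10.p1, of "p ^ 10"] by (simp add: pw power_add[symmetric])
    show "qpoch_inf (p ^ 10) (p ^ 20) \<noteq> 0"
      using e14 eta_nonzero[of 10] by auto
    show "theta (p ^ 10) p * theta (p ^ 10) (- p) * eu 20 = theta (p ^ 20) (p ^ 2) * eu 10 ^ 2"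
      using P10.theta_mult_minus[OF p0] by (simp add: pw)
    show "theta (p ^ 10) (p ^ 3) * theta (p ^ 10) (- (p ^ 3)) * eu 20 = theta (p ^ 20) (p ^ 6) * eu 10 ^ 2"
      using P10.theta_mult_minus[OF nz(1)[of 3]] by (simp add: pw)
    show "theta (p ^ 10) (- (p ^ 4)) * eu 20 ^ 2 = theta (p ^ 20) (- (p ^ 4)) * theta (p ^ 20) (- (p ^ 6)) * eu 10"
      using P10.theta_split_2[OF nz(2)[of 4]] theta_power_reflect(2)[of 14 20] by (simp add: pw power_add[symmetric])
    show "theta (p ^ 10) (- (p ^ 2)) * eu 20 ^ 2 = theta (p ^ 20) (- (p ^ 2)) * theta (p ^ 20) (- (p ^ 8)) * eu 10"
      using P10.theta_split_2[OF nz(2)[of 2]] theta_power_reflect(2)[of 12 20] by (simp add: pw power_add[symmetric])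
    show "theta (p ^ 10) (- (p ^ 4)) * theta (p ^ 10) (p ^ 3) + p * (theta (p ^ 10) (- (p ^ 2)) * theta (p ^ 10) p)
      = theta (- (p ^ 5)) (- p) * theta (- (p ^ 5)) (p ^ 2)"
      by (rule theta_neg_5_mult)
    show "theta (- (p ^ 5)) (- p) * eu 10 = theta (p ^ 10) (- p) * theta (p ^ 10) (p ^ 4) * qpoch_inf (- (p ^ 5)) (p ^ 10)"
      "theta (- (p ^ 5)) (p ^ 2) * eu 10 = theta (p ^ 10) (p ^ 2) * theta (p ^ 10) (- (p ^ 3)) * qpoch_inf (- (p ^ 5)) (p ^ 10)"
      by (rule theta_neg_5_split)+
    show "theta (p ^ 2) (- p) * eu 10 ^ 5
      = theta (p ^ 10) (- p) ^ 2 * theta (p ^ 10) (- (p ^ 3)) ^ 2 * qpoch_inf (- (p ^ 5)) (p ^ 10) ^ 2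
        * theta (p ^ 10) (p ^ 2) * theta (p ^ 10) (p ^ 4)"
      by (rule theta_2_split)
    show "theta (- (p ^ 10)) (- (p ^ 2)) * eu 20
      = theta (p ^ 20) (- (p ^ 2)) * theta (p ^ 20) (p ^ 8) * qpoch_inf (- (p ^ 10)) (p ^ 20)"
      using P2.theta_neg_5_split(1) by (simp add: pw)
    show "theta (p ^ 8) (p ^ 2) * eu 20 ^ 2 * eu 40
      = theta (p ^ 20) (p ^ 2) * theta (p ^ 20) (p ^ 6) * qpoch_inf (p ^ 10) (p ^ 20) * theta (p ^ 40) (p ^ 8) * theta (p ^ 40) (p ^ 24)"
      using P2.theta_4_split theta_power_reflect(1)[of 24 40] by (simp add: pw)
    show "theta (p ^ 20) (p ^ 2) * theta (p ^ 20) (- (p ^ 2)) * eu 40 = theta (p ^ 40) (p ^ 4) * eu 20 ^ 2"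
      using P20.theta_mult_minus[OF nz(1)[of 2]] by (simp add: pw)
    show "theta (p ^ 20) (p ^ 8) * theta (p ^ 20) (- (p ^ 8)) * eu 40 = theta (p ^ 40) (p ^ 24) * eu 20 ^ 2"
      using P20.theta_mult_minus[OF nz(1)[of 8]] theta_power_reflect(1)[of 24 40] by (simp add: pw)
    show "theta (p ^ 20) (p ^ 4) * eu 40 ^ 2 = theta (p ^ 40) (p ^ 4) * theta (p ^ 40) (p ^ 24) * eu 20"
      using P20.theta_split_2[OF nz(1)[of 4]] by (simp add: pw power_add[symmetric])
    show "theta (p ^ 20) (p ^ 4) * theta (p ^ 20) (- (p ^ 4)) * eu 40 = theta (p ^ 40) (p ^ 8) * eu 20 ^ 2"
      using P20.theta_mult_minus[OF nz(1)[of 4]] by (simp add: pw)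
  qed
qed

section \<open>Dissection of the sums for phi and the final identity\<close>

text \<open>In base p^10 the equation for s is solved by i / p^5, and z = p^2. The conditions on e
  and e - 5 exclude poles at u z and at the two points s u z and -(s u z).\<close>

lemma lerch_dissect_10:
  assumes u: "u * p ^ 2 = p powi e" and e: "\<not> 10 dvd e" "\<not> 10 dvd (e - 5)"
  shows "nome.lerch (p ^ 10) (p ^ 2) u
      - (nome.lerch (p ^ 40) (p ^ 24) (- (p ^ 10 * u ^ 2)) - u / p ^ 10 * nome.lerch (p ^ 40) (p ^ 24) (- (u ^ 2 / p ^ 10)))
    = - (eu 20 ^ 3 * theta (p ^ 10) (1 / (\<i> / p ^ 5)) * theta (p ^ 20) (- (p ^ 2 * (u * p ^ 2) ^ 2 / p ^ 10))
       / (theta (p ^ 40) (p ^ 24) * theta (p ^ 20) (p ^ 2) * theta (p ^ 10) (u * p ^ 2) * theta (p ^ 20) (- ((u * p ^ 2) ^ 2 / p ^ 10))))"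
proof -
  interpret P: nome "p ^ 10" by (rule power_nome) simp
  have pw: "(p ^ a) ^ b = p ^ (a * b)" for a b by (simp add: power_mult)
  have i4: "\<i> ^ 4 = 1" "(- \<i>) ^ 4 = 1" by (simp_all add: eval_nat_numeral)
  have s: "(\<i> / p ^ 5) ^ 2 * p ^ 10 = - 1" using p0 by (simp add: power_divide pw)
  have nz: "p ^ 2 \<noteq> 0" "u \<noteq> 0" using p0 u by auto
  have n10: "int 10 = 10" by simp
  have e5: "p powi e / p ^ 5 = p powi (e - 5)" using p0 by (simp add: power_int_diff)
  have su: "\<i> / p ^ 5 * u * p ^ 2 = \<i> * p powi (e - 5)" unfolding e5[symmetric] u[symmetric] by simp
  have sz: "\<i> / p ^ 5 * p ^ 2 = \<i> * p powi (- 3)"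
    using p0 by (simp add: power_int_minus field_simps eval_nat_numeral)
  have ne: "(p ^ 10) powi k * (u * p ^ 2) \<noteq> 1" "(p ^ 10) powi k * (\<i> / p ^ 5 * u * p ^ 2) \<noteq> 1"
    "(p ^ 10) powi k * (- (\<i> / p ^ 5 * u * p ^ 2)) \<noteq> 1" for k
    unfolding su u using no_pole[of 1 10 e k] no_pole[OF i4(1), of 10 "e - 5" k] no_pole[OF i4(2), of 10 "e - 5" k] e
    by simp_all
  have t: "theta (p ^ 10) (p ^ 2) \<noteq> 0" "theta (p ^ 10) (\<i> / p ^ 5 * p ^ 2) \<noteq> 0" "theta (p ^ 10) (- (\<i> / p ^ 5 * p ^ 2)) \<noteq> 0"
      "theta ((p ^ 10) ^ 4) ((p ^ 10) ^ 2 * (p ^ 2) ^ 2) \<noteq> 0"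
    unfolding sz using theta_power_nonzero[of 1 10 2] theta_power_nonzero[OF i4(1), of 10 "- 3"]
      theta_power_nonzero[OF i4(2), of 10 "- 3"] theta_power_nonzero[of 1 40 24]
    by (simp_all add: pw power_add[symmetric])
  have w: "(p ^ 10) ^ 4 = p ^ 40" "(p ^ 10) ^ 2 = p ^ 20" "p ^ 20 * (p ^ 2) ^ 2 = p ^ 24"
    by (simp_all add: pw power_add[symmetric])
  show ?thesis
    using P.lerch_dissect[OF s nz ne t] unfolding w .
qed

lemma theta_neg_inverse_power: "theta (p ^ 20) (- (1 / p ^ k)) = theta (p ^ 20) (- (p ^ k)) / p ^ k"
proof -
  interpret P: nome "p ^ 20" by (rule power_nome) simp
  have "inverse (- (p ^ k)) = - (1 / p ^ k)" by (simp add: divide_inverse)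
  then show ?thesis using P.theta_inverse[of "- (p ^ k)"] p0 by simp
qed

text \<open>The matching is crosswise: u = p dissects into the sums at -p^12 and -p^(-8), u = 1/p
  into those at -p^8 and -p^(-12). The pair with exponent 12 makes up psi(-p^4), the pair with
  exponent 8 makes up chi(p^8), and only the two theta quotients remain.\<close>

theorem mock_theta_identity:
  "mock_phi p - mock_psi (- (p ^ 4)) / p + mock_chi (p ^ 8) / p ^ 2
    = theta (p ^ 2) (- p) * theta (- (p ^ 10)) (- (p ^ 2)) / theta (p ^ 8) (p ^ 2)"
proof -
  interpret P4: nome "p ^ 4" by (rule power_nome) simp
  interpret R: nome "- (p ^ 4)" by (rule P4.minus_nome)
  have pw: "(p ^ a) ^ b = p ^ (a * b)" for a b by (simp add: power_mult)
  define m where "m u = nome.lerch (p ^ 40) (p ^ 24) u" for u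
  define C where "C = eu 20 ^ 3 * theta (p ^ 10) (1 / (\<i> / p ^ 5)) / (theta (p ^ 40) (p ^ 24) * theta (p ^ 20) (p ^ 2))"
  define A where "A = nome.lerch (p ^ 10) (p ^ 2) p"
  define B where "B = nome.lerch (p ^ 10) (p ^ 2) (1 / p)"
  define X where "X = theta (p ^ 20) (- (p ^ 2)) / (theta (p ^ 10) (p ^ 3) * theta (p ^ 20) (- (p ^ 4)))"
  define Y where "Y = theta (p ^ 20) (- (p ^ 6)) / (theta (p ^ 10) p * theta (p ^ 20) (- (p ^ 8)))"
  have phi: "mock_phi p = - A / p - B / p ^ 2"
    unfolding A_def B_def by (rule mock_phi_appell)
  have psi: "mock_psi (- (p ^ 4)) = - m (- (p ^ 12)) + m (- (1 / p ^ 12)) / p ^ 12"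
  proof -
    have "(- (p ^ 4)) ^ 10 = p ^ 40" "(- (p ^ 4)) ^ 6 = p ^ 24" "(- (p ^ 4)) ^ 3 = - (p ^ 12)"
      by (simp_all add: pw power_minus_odd)
    then show ?thesis using R.mock_psi_appell by (simp add: m_def)
  qed
  have chi: "mock_chi (p ^ 8) = m (- (p ^ 8)) - m (- (1 / p ^ 8)) / p ^ 8"
    using P4.mock_chi_appell by (simp add: m_def pw)
  have r: "k * a * (b / p ^ i) / (w * c * x * (y / p ^ j)) = k * a / (w * c) * (p ^ 2 * (b / (x * y)))"
    if "j = 2 + i" for k a b w c x y i j
    unfolding that power_add using p0 by (simp add: mult_ac)
  have r24: "k * a * (b / p ^ 2) / (w * c * x * (y / p ^ 4)) = k * a / (w * c) * (p ^ 2 * (b / (x * y)))"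
    and r68: "k * a * (b / p ^ 6) / (w * c * x * (y / p ^ 8)) = k * a / (w * c) * (p ^ 2 * (b / (x * y)))"
    for k a b w c x y by (rule r; simp)+
  have 1: "A - (m (- (p ^ 12)) - m (- (1 / p ^ 8)) / p ^ 9) = - (C * (p ^ 2 * X))"
  proof -
    have e: "p * p ^ 2 = p ^ 3" "p ^ 10 * p ^ 2 = p ^ 12" "p ^ 2 / p ^ 10 = 1 / p ^ 8" "p / p ^ 10 = 1 / p ^ 9"
      "p ^ 2 * (p ^ 3) ^ 2 / p ^ 10 = 1 / p ^ 2" "(p ^ 3) ^ 2 / p ^ 10 = 1 / p ^ 4"
      using p0 by (simp_all add: eval_nat_numeral)
    have "p * p ^ 2 = p powi 3" unfolding e by simp
    from lerch_dissect_10[OF this] show ?thesis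
      unfolding e theta_neg_inverse_power r24 A_def m_def C_def X_def by simp
  qed
  have 2: "B - (m (- (p ^ 8)) - m (- (1 / p ^ 12)) / p ^ 11) = - (C * (p ^ 2 * Y))"
  proof -
    have e: "1 / p * p ^ 2 = p" "p ^ 10 * (1 / p) ^ 2 = p ^ 8" "(1 / p) ^ 2 / p ^ 10 = 1 / p ^ 12" "1 / p / p ^ 10 = 1 / p ^ 11"
      "p ^ 2 * p ^ 2 / p ^ 10 = 1 / p ^ 6" "p ^ 2 / p ^ 10 = 1 / p ^ 8"
      using p0 by (simp_all add: eval_nat_numeral)
    have "1 / p * p ^ 2 = p powi 1" unfolding e by simp
    from lerch_dissect_10[OF this] show ?thesis
      unfolding e theta_neg_inverse_power r68 B_def m_def C_def Y_def by simp
  qed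
  have "mock_phi p - mock_psi (- (p ^ 4)) / p + mock_chi (p ^ 8) / p ^ 2
    = - (A - (m (- (p ^ 12)) - m (- (1 / p ^ 8)) / p ^ 9)) / p - (B - (m (- (p ^ 8)) - m (- (1 / p ^ 12)) / p ^ 11)) / p ^ 2"
    unfolding phi psi chi using p0 by (simp add: field_simps eval_nat_numeral)
  also have "\<dots> = C * (Y + p * X)"
    unfolding 1 2 using p0 by (simp add: field_simps power2_eq_square)
  also have "\<dots> = theta (p ^ 2) (- p) * theta (- (p ^ 10)) (- (p ^ 2)) / theta (p ^ 8) (p ^ 2)"
    using theta_identity unfolding C_def X_def Y_def by simp
  finally show ?thesis .
qed

end

theorem mainTheorem5:
  fixes q :: complex
  assumes "0 < norm q" and "norm q < 1"
  shows "mock_phi q - q powi (-1) * mock_psi (- (q ^ 4)) + q powi (-2) * mock_chi (q ^ 8)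
           = J_bar q 1 2 * jtheta (- (q ^ 2)) (- (q ^ 10)) / J q 2 8"
proof -
  interpret nome q by unfold_locales (use assms in simp_all)
  interpret P2: nome "q ^ 2" by (rule power_nome) simp
  interpret P8: nome "q ^ 8" by (rule power_nome) simp
  interpret P10: nome "q ^ 10" by (rule power_nome) simp
  interpret R: nome "- (q ^ 10)" by (rule P10.minus_nome)
  have "J_bar q 1 2 = theta (q ^ 2) (- q)" "J q 2 8 = theta (q ^ 8) (q ^ 2)"
    "jtheta (- (q ^ 2)) (- (q ^ 10)) = theta (- (q ^ 10)) (- (q ^ 2))"
    using P2.theta_eq_jtheta[of "- q"] P8.theta_eq_jtheta[of "q ^ 2"] R.theta_eq_jtheta[of "- (q ^ 2)"] p0
    by (simp_all add: J_bar_def J_def)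
  then show ?thesis
    using mock_theta_identity by (simp add: power_int_minus divide_inverse mult.commute)
qed

end
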